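(* Let $n\in\mathbb N$, $s>0$, $P\in\mathcal P^{(I)}_s$, and let $\theta\in\mathcal T$ satisfy $E_P[\theta]<\infty$. Then there exists a stopping time $\hat\theta\in\mathcal T$ with $\hat\theta\ge\theta$ such that $P$-a.s. $\hat\theta<\infty$ and $$\frac{B_{\hat\theta}}{B_\theta}\in\left\{\exp(-\overline\sigma\sqrt{T/n}),\,1,\,\exp(\overline\sigma\sqrt{T/n})\right\}.$$ Furthermore, $E_P(\hat\theta-\theta|\mathcal F_\theta)=z(n)$ and ($P$-a.s.) $$P\Big(\tfrac{B_{\hat\theta}}{B_\theta}=\exp(\overline\sigma\sqrt{T/n})\,\Big|\,\mathcal F_\theta\Big)\in\frac1{1+\exp(\overline\sigma\sqrt{T/n})}\Big[\exp(-4\overline\sigma\sqrt{T/n})\,\underline\sigma^2/\overline\sigma^2,\,1\Big],$$ $$P\Big(\tfrac{B_{\hat\theta}}{B_\theta}=\exp(-\overline\sigma\sqrt{T/n})\,\Big|\,\mathcal F_\theta\Big)=\exp(\overline\sigma\sqrt{T/n})\,P\Big(\tfrac{B_{\hat\theta}}{B_\theta}=\exp(\overline\sigma\sqrt{T/n})\,\Big|\,\mathcal F_\theta\Big),$$ $$P\big(B_{\hat\theta}=B_\theta\,\big|\,\mathcal F_\theta\big)=1-P\Big(\tfrac{B_{\hat\theta}}{B_\theta}=\exp(\overline\sigma\sqrt{T/n})\,\Big|\,\mathcal F_\theta\Big)-P\Big(\tfrac{B_{\hat\theta}}{B_\theta}=\exp(-\overline\sigma\sqrt{T/n})\,\Big|\,\mathcal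 F_\theta\Big).$$
   Context: $T\in(0,\infty)$; $I=[\underline\sigma,\overline\sigma]$ with $0<\underline\sigma\le\overline\sigma<\infty$. $\Omega=C(\mathbb R_+,\mathbb R)$ with the topology of locally uniform convergence and Borel $\sigma$-field; $B_t(\omega)=\omega_t$ is the canonical process, $\{\mathcal F_t\}_{t\ge0}$ its natural filtration; $\mathcal T$ is the set of all $\{\mathcal F_t\}$-stopping times (the value $\infty$ is allowed). For $s>0$, $\mathcal P^{(I)}_s$ is the set of all probability measures $P$ on $\Omega$ under which $B$ is a strictly positive martingale, $B_0=s$ $P$-a.s., the quadratic variation $\langle B\rangle$ is absolutely continuous in time, and $B_t^{-1}\sqrt{d\langle B\rangle_t/dt}\in I$ $dt\otimes P$-a.s. The deterministic number $z(n)$ is $$z(n)=\exp(-2\overline\sigma\sqrt{T/n})\,\overline\sigma^{-2}\,\frac{\exp(2\overline\sigma\sqrt{T/n})+\exp(-2\overline\sigma\sqrt{T/n})-2}{2+\exp(\overline\sigma\sqrt{T/n})+\exp(-\overline\sigma\sqrt{T/n})}.$$ *)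

theory Defs
  imports "HOL-Probability.Probability"
begin

section \<open>The path space\<close>

text \<open>
  A continuous function on the half line is represented by the function on \<^typ>\<open>real\<close> that is
  \<^const>\<open>undefined\<close> at negative arguments, so that equal paths are equal functions.
\<close>

definition path_space :: "(real \<Rightarrow> real) set" where
  "path_space = {\<omega> \<in> extensional {0..}. continuous_on {0..} \<omega>}"

definition locally_uniform_open :: "(real \<Rightarrow> real) set \<Rightarrow> bool" where
  "locally_uniform_open U \<longleftrightarrow> U \<subseteq> path_space \<and>
     (\<forall>\<omega>\<in>U. \<exists>b\<ge>0. \<exists>\<epsilon>>0. \<forall>\<eta>\<in>path_space. (\<forall>t\<in>{0..b}. \<bar>\<eta> t - \<omega> t\<bar> < \<epsilon>) \<longrightarrow> \<eta> \<in> U)"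

definition path_topology :: "(real \<Rightarrow> real) topology" where
  "path_topology = topology locally_uniform_open"

lemma istopology_locally_uniform_open: "istopology locally_uniform_open"
  unfolding istopology_def
proof (intro conjI allI impI)
  fix S T assume S: "locally_uniform_open S" and T: "locally_uniform_open T"
  show "locally_uniform_open (S \<inter> T)"
    unfolding locally_uniform_open_def
  proof (intro conjI ballI)
    show "S \<inter> T \<subseteq> path_space" using S by (auto simp: locally_uniform_open_def)
    fix \<omega> assume \<omega>: "\<omega> \<in> S \<inter> T"
    obtain b e where 1: "b \<ge> 0" "e > 0"
      "\<forall>\<eta>\<in>path_space. (\<forall>t\<in>{0..b}. \<bar>\<eta> t - \<omega> t\<bar> < e) \<longrightarrow> \<eta> \<in> S"
      using S \<omega> unfolding locally_uniform_open_def by blast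
    obtain c d where 2: "c \<ge> 0" "d > 0"
      "\<forall>\<eta>\<in>path_space. (\<forall>t\<in>{0..c}. \<bar>\<eta> t - \<omega> t\<bar> < d) \<longrightarrow> \<eta> \<in> T"
      using T \<omega> unfolding locally_uniform_open_def by blast
    have "\<forall>\<eta>\<in>path_space. (\<forall>t\<in>{0..max b c}. \<bar>\<eta> t - \<omega> t\<bar> < min e d) \<longrightarrow> \<eta> \<in> S \<inter> T"
    proof (intro ballI impI)
      fix \<eta> assume "\<eta> \<in> path_space" "\<forall>t\<in>{0..max b c}. \<bar>\<eta> t - \<omega> t\<bar> < min e d"
      then have "\<forall>t\<in>{0..b}. \<bar>\<eta> t - \<omega> t\<bar> < e" "\<forall>t\<in>{0..c}. \<bar>\<eta> t - \<omega> t\<bar> < d"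
        by auto
      with \<open>\<eta> \<in> path_space\<close> 1(3) 2(3) show "\<eta> \<in> S \<inter> T" by blast
    qed
    moreover have "max b c \<ge> 0" "min e d > 0" using 1 2 by auto
    ultimately show "\<exists>b\<ge>0. \<exists>\<epsilon>>0. \<forall>\<eta>\<in>path_space.
        (\<forall>t\<in>{0..b}. \<bar>\<eta> t - \<omega> t\<bar> < \<epsilon>) \<longrightarrow> \<eta> \<in> S \<inter> T" by blast
  qed
next
  fix K :: "(real \<Rightarrow> real) set set" assume "\<forall>S\<in>K. locally_uniform_open S"
  then show "locally_uniform_open (\<Union>K)"
    unfolding locally_uniform_open_def
  proof (intro conjI ballI)
    assume K: "\<forall>S\<in>K. S \<subseteq> path_space \<and> (\<forall>\<omega>\<in>S. \<exists>b\<ge>0. \<exists>\<epsilon>>0. \<forall>\<eta>\<in>path_space.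
      (\<forall>t\<in>{0..b}. \<bar>\<eta> t - \<omega> t\<bar> < \<epsilon>) \<longrightarrow> \<eta> \<in> S)"
    show "\<Union>K \<subseteq> path_space" using K by blast
    fix \<omega> assume "\<omega> \<in> \<Union>K"
    then obtain S where S: "S \<in> K" "\<omega> \<in> S" by blast
    then obtain b e where "b \<ge> 0" "e > 0"
      "\<forall>\<eta>\<in>path_space. (\<forall>t\<in>{0..b}. \<bar>\<eta> t - \<omega> t\<bar> < e) \<longrightarrow> \<eta> \<in> S"
      using K by blast
    then show "\<exists>b\<ge>0. \<exists>\<epsilon>>0. \<forall>\<eta>\<in>path_space.
        (\<forall>t\<in>{0..b}. \<bar>\<eta> t - \<omega> t\<bar> < \<epsilon>) \<longrightarrow> \<eta> \<in> \<Union>K"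
      using S(1) by (intro exI[of _ b] conjI exI[of _ e]) auto
  qed
qed

lemma openin_path_topology: "openin path_topology = locally_uniform_open"
  unfolding path_topology_def by (rule topology_inverse'[OF istopology_locally_uniform_open])

definition path_borel :: "(real \<Rightarrow> real) measure" where
  "path_borel = sigma path_space {U. openin path_topology U}"

lemma space_path_borel: "space path_borel = path_space"
  unfolding path_borel_def
  by (rule space_measure_of) (auto simp: openin_path_topology locally_uniform_open_def)

lemma sets_path_borel: "sets path_borel = sigma_sets path_space {U. openin path_topology U}"
  unfolding path_borel_def
  by (rule sets_measure_of) (auto simp: openin_path_topology locally_uniform_open_def)

section \<open>The canonical filtration\<close>

text \<open>
  The index set is \<^typ>\<open>ennreal\<close> so that the library's \<^const>\<open>stopping_time\<close> covers times with
  value \<open>\<infinity>\<close>: the condition at index \<open>\<infinity>\<close> is implied by those at the finite indices. In the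
  \<sigma>-field of events prior to a stopping time, index \<open>\<infinity>\<close> contributes the requirement that an event
  belongs to the \<sigma>-field generated by the whole path.
\<close>

definition canonical_filtration :: "ennreal \<Rightarrow> (real \<Rightarrow> real) measure" where
  "canonical_filtration t = sigma path_space
     {(\<lambda>\<omega>. \<omega> u) -` V \<inter> path_space | u V. 0 \<le> u \<and> ennreal u \<le> t \<and> V \<in> sets borel}"

lemma space_canonical_filtration: "space (canonical_filtration t) = path_space"
  unfolding canonical_filtration_def by (rule space_measure_of) auto

lemma sets_canonical_filtration:
  "sets (canonical_filtration t) = sigma_sets path_space
     {(\<lambda>\<omega>. \<omega> u) -` V \<inter> path_space | u V. 0 \<le> u \<and> ennreal u \<le> t \<and> V \<in> sets borel}"
  unfolding canonical_filtration_def by (rule sets_measure_of) auto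

interpretation canonical: filtration path_space canonical_filtration
proof
  show "space (canonical_filtration t) = path_space" for t
    by (rule space_canonical_filtration)
  show "sets (canonical_filtration t) \<subseteq> sets (canonical_filtration t')" if "t \<le> t'" for t t'
    unfolding sets_canonical_filtration
    by (rule sigma_sets_mono') (use that in \<open>auto intro: order_trans\<close>)
qed

lemma evaluation_measurable:
  assumes "0 \<le> u" shows "(\<lambda>\<omega>. \<omega> u) \<in> borel_measurable path_borel"
proof (rule borel_measurableI)
  fix S :: "real set" assume "open S"
  have "locally_uniform_open ((\<lambda>\<omega>. \<omega> u) -` S \<inter> path_space)"
    unfolding locally_uniform_open_def
  proof (intro conjI ballI)
    fix \<omega> assume "\<omega> \<in> (\<lambda>\<omega>. \<omega> u) -` S \<inter> path_space"
    then obtain e where "e > 0" "\<forall>y. dist y (\<omega> u) < e \<longrightarrow> y \<in> S"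
      using \<open>open S\<close> unfolding open_dist by auto
    then show "\<exists>b\<ge>0. \<exists>\<epsilon>>0. \<forall>\<eta>\<in>path_space. (\<forall>t\<in>{0..b}. \<bar>\<eta> t - \<omega> t\<bar> < \<epsilon>) \<longrightarrow>
        \<eta> \<in> (\<lambda>\<omega>. \<omega> u) -` S \<inter> path_space"
      using assms by (intro exI[of _ u] conjI exI[of _ e]) (auto simp: dist_real_def)
  qed auto
  then show "(\<lambda>\<omega>. \<omega> u) -` S \<inter> space path_borel \<in> sets path_borel"
    unfolding space_path_borel sets_path_borel openin_path_topology by auto
qed

lemma sets_canonical_filtration_subset: "sets (canonical_filtration t) \<subseteq> sets path_borel"
proof -
  have "{(\<lambda>\<omega>. \<omega> u) -` V \<inter> path_space | u V. 0 \<le> u \<and> ennreal u \<le> t \<and> V \<in> sets borel}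
      \<subseteq> sets path_borel"
  proof
    fix A :: "(real \<Rightarrow> real) set"
    assume "A \<in> {(\<lambda>\<omega>. \<omega> u) -` V \<inter> path_space | u V. 0 \<le> u \<and> ennreal u \<le> t \<and> V \<in> sets borel}"
    then obtain u and V :: "real set"
      where A: "A = (\<lambda>\<omega>. \<omega> u) -` V \<inter> path_space" "0 \<le> u" "V \<in> sets borel"
      by blast
    show "A \<in> sets path_borel"
      using measurable_sets[OF evaluation_measurable[OF A(2)] A(3)]
      unfolding A(1) space_path_borel .
  qed
  from sets.sigma_sets_subset[OF this] show ?thesis
    unfolding sets_canonical_filtration space_path_borel .
qed

lemma subalgebra_pre_sigma:
  assumes "stopping_time canonical_filtration \<theta>" and "sets P = sets path_borel"
  shows "subalgebra P (canonical.pre_sigma \<theta>)"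
proof -
  have "sets (canonical.pre_sigma \<theta>) \<subseteq> sets P"
  proof
    fix A assume "A \<in> sets (canonical.pre_sigma \<theta>)"
    from canonical.sets_pre_sigmaD[OF assms(1) this, of top]
    show "A \<in> sets P" using sets_canonical_filtration_subset[of top] assms(2) by auto
  qed
  then show ?thesis
    unfolding subalgebra_def canonical.space_pre_sigma
    using sets_eq_imp_space_eq[OF assms(2)] by (simp add: space_path_borel)
qed

text \<open>
  The value of the canonical process at a random time. Where the time is \<open>\<infinity>\<close> this is the value
  at time 0 by the convention of \<^const>\<open>enn2real\<close>; it is only used for a.s. finite times.
\<close>

definition at_time :: "((real \<Rightarrow> real) \<Rightarrow> ennreal) \<Rightarrow> (real \<Rightarrow> real) \<Rightarrow> real" where
  "at_time \<theta> \<omega> = \<omega> (enn2real (\<theta> \<omega>))"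

section \<open>Martingales, quadratic variation, absolute continuity\<close>

definition is_martingale ::
    "'a measure \<Rightarrow> (ennreal \<Rightarrow> 'a measure) \<Rightarrow> (real \<Rightarrow> 'a \<Rightarrow> real) \<Rightarrow> bool" where
  "is_martingale P F X \<longleftrightarrow>
     (\<forall>t\<ge>0. X t \<in> borel_measurable (F (ennreal t)) \<and> integrable P (X t)) \<and>
     (\<forall>u t. 0 \<le> u \<and> u \<le> t \<longrightarrow>
        (AE \<omega> in P. real_cond_exp P (F (ennreal u)) (X t) \<omega> = X u \<omega>))"

definition is_partition :: "real \<Rightarrow> real \<Rightarrow> nat \<Rightarrow> (nat \<Rightarrow> real) \<Rightarrow> bool" where
  "is_partition t \<delta> m \<pi> \<longleftrightarrow> \<pi> 0 = 0 \<and> \<pi> m = t \<and>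
     (\<forall>i<m. \<pi> i \<le> \<pi> (Suc i) \<and> \<pi> (Suc i) - \<pi> i < \<delta>)"

text \<open>
  \<open>A\<close> is (a version of) the quadratic variation process of \<open>X\<close>: a continuous nondecreasing process
  started at 0 such that, for every \<open>t\<close>, the sums of squared increments along partitions of
  \<open>[0, t]\<close> converge to \<open>A t\<close> in probability as the mesh tends to 0. Such a process is
  unique up to indistinguishability.
\<close>

definition is_quadratic_variation ::
    "'a measure \<Rightarrow> (real \<Rightarrow> 'a \<Rightarrow> real) \<Rightarrow> (real \<Rightarrow> 'a \<Rightarrow> real) \<Rightarrow> bool" where
  "is_quadratic_variation P X A \<longleftrightarrow>
     (\<forall>t\<ge>0. A t \<in> borel_measurable P) \<and>
     (AE \<omega> in P. A 0 \<omega> = 0 \<and> continuous_on {0..} (\<lambda>t. A t \<omega>) \<and> mono_on {0..} (\<lambda>t. A t \<omega>)) \<and>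
     (\<forall>t\<ge>0. \<forall>\<epsilon>>0. \<forall>\<eta>>0. \<exists>\<delta>>0. \<forall>m \<pi>. is_partition t \<delta> m \<pi> \<longrightarrow>
        measure P {\<omega> \<in> space P. \<epsilon> < \<bar>(\<Sum>i<m. (X (\<pi> (Suc i)) \<omega> - X (\<pi> i) \<omega>)\<^sup>2) - A t \<omega>\<bar>} < \<eta>)"

definition absolutely_continuous_on :: "real \<Rightarrow> real \<Rightarrow> (real \<Rightarrow> real) \<Rightarrow> bool" where
  "absolutely_continuous_on a b f \<longleftrightarrow>
     (\<forall>\<epsilon>>0. \<exists>\<delta>>0. \<forall>D :: (real \<times> real) set.
        finite D \<and> (\<forall>(x, y)\<in>D. a \<le> x \<and> x \<le> y \<and> y \<le> b) \<and>
        disjoint_family_on (\<lambda>(x, y). {x<..<y}) D \<and> (\<Sum>(x, y)\<in>D. y - x) < \<delta>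
        \<longrightarrow> (\<Sum>(x, y)\<in>D. \<bar>f y - f x\<bar>) < \<epsilon>)"

text \<open>
  Since \<open>A\<close> is determined up to indistinguishability, the existential quantifier over \<open>A\<close> is
  independent of the chosen version. \<open>D\<close> is the time derivative of \<open>A\<close>, which for an absolutely
  continuous path exists at almost every \<open>t\<close>.
\<close>

definition martingale_laws :: "real set \<Rightarrow> real \<Rightarrow> (real \<Rightarrow> real) measure set" where
  "martingale_laws I s = {P. prob_space P \<and> sets P = sets path_borel \<and>
     is_martingale P canonical_filtration (\<lambda>t \<omega>. \<omega> t) \<and>
     (AE \<omega> in P. \<forall>t\<ge>0. 0 < \<omega> t) \<and>
     (AE \<omega> in P. \<omega> 0 = s) \<and>
     (\<exists>A. is_quadratic_variation P (\<lambda>t \<omega>. \<omega> t) A \<and>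
        (AE \<omega> in P. \<forall>b\<ge>0. absolutely_continuous_on 0 b (\<lambda>t. A t \<omega>)) \<and>
        (AE (t, \<omega>) in restrict_space lborel {0..} \<Otimes>\<^sub>M P.
           \<exists>D. ((\<lambda>u. A u \<omega>) has_real_derivative D) (at t within {0..}) \<and> sqrt D / \<omega> t \<in> I))}"

definition cond_prob_given :: "'a measure \<Rightarrow> 'a measure \<Rightarrow> ('a \<Rightarrow> bool) \<Rightarrow> 'a \<Rightarrow> real" where
  "cond_prob_given P G Q = real_cond_exp P G (indicator {\<omega> \<in> space P. Q \<omega>})"

definition z_const :: "real \<Rightarrow> real \<Rightarrow> nat \<Rightarrow> real" where
  "z_const T \<sigma> n =
     exp (- 2 * \<sigma> * sqrt (T / n)) * (1 / \<sigma>\<^sup>2) *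
     ((exp (2 * \<sigma> * sqrt (T / n)) + exp (- 2 * \<sigma> * sqrt (T / n)) - 2) /
      (2 + exp (\<sigma> * sqrt (T / n)) + exp (- \<sigma> * sqrt (T / n))))"

end

theory Submission
  imports Defs
begin

text \<open>
  Write \<open>R = B / B\<^sub>\<theta>\<close> for the path after \<open>\<theta>\<close>, normalised to start at 1. For a level
  \<open>x \<in> [0, 1]\<close>, follow \<open>R\<close> until it leaves the interval from \<open>1 - (1 - e\<^bsup>-h\<^esup>) x\<close> to
  \<open>1 + (e\<^sup>h - 1) x\<close> (the exit time), and from there until it is back at 1 or has reached \<open>e\<^sup>h\<close> or
  \<open>e\<^bsup>-h\<^esup>\<close> (the return time). For \<open>x = 0\<close> this stops at \<open>\<theta>\<close>; for \<open>x = 1\<close> it is the first exit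
  of \<open>R\<close> from the corridor between \<open>e\<^bsup>-h\<^esup>\<close> and \<open>e\<^sup>h\<close>. The level may be random as long as it is
  known at time \<open>\<theta>\<close>, and the theorem is proved by choosing it so that the expected
  duration is the prescribed constant.

  Two facts control the return time. First, the martingale property alone determines the
  conditional law of \<open>R\<close> there (\<open>return_means\<close>): after an upward exit \<open>R\<close> ends in \<open>{1, e\<^sup>h}\<close>, after a
  downward exit in \<open>{e\<^bsup>-h\<^esup>, 1}\<close>, and on a two-point set squares are affine functions. Optional
  stopping gives \<open>E(R\<^sup>2 - 1 | \<F>\<^sub>\<theta>) = c x\<close> with \<open>c = (e\<^sup>h - 1) (1 - e\<^bsup>-h\<^esup>)\<close>. Secondly, between stopping
  times inside the corridor the conditional expectation of the increment of \<open>R\<^sup>2\<close> is that of the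
  increment of \<open>\<langle>B\<rangle> / B\<^sub>\<theta>\<^sup>2\<close>, hence lies between \<open>lo\<^sup>2 e\<^bsup>-2h\<^esup>\<close> and \<open>hi\<^sup>2 e\<^bsup>2h\<^esup>\<close> times the expected
  duration (\<open>duration_bounds\<close>). So the expected duration is Lipschitz in \<open>x\<close>, vanishes at
  \<open>x = 0\<close>, and is at least \<open>z = c e\<^bsup>-2h\<^esup> / hi\<^sup>2\<close> at \<open>x = 1\<close>; a conditional version of the intermediate
  value theorem (\<open>conditional_intermediate_value\<close>) produces a level with duration exactly \<open>z\<close>. Let
  \<open>p\<close> be the conditional probability of stopping at \<open>e\<^sup>h\<close>. That \<open>R\<close> has mean 1 forces probability
  \<open>e\<^sup>h p\<close> for \<open>e\<^bsup>-h\<^esup>\<close>, so \<open>(1 + e\<^sup>h) p \<le> 1\<close>, and the lower energy bound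
  \<open>(1 + e\<^sup>h) c p = E(R\<^sup>2 - 1 | \<F>\<^sub>\<theta>) \<ge> lo\<^sup>2 e\<^bsup>-2h\<^esup> z\<close> is the lower bound for \<open>p\<close>.

  The stochastic calculus behind this is elementary. Optional stopping (\<open>optional_stopping\<close>) follows by
  rounding a stopping time up to a grid. The energy identity (\<open>increment_energy\<close>) is proved for
  normalised increments of \<open>B\<close> between two stopping times, which are bounded although \<open>B\<close> is
  not: their sums of squares over dyadic grids have constant mean and bounded second moments, and
  along a subsequence they converge almost surely to the increment of the quadratic variation. The
  derivative bounds on \<open>\<langle>B\<rangle>\<close> are integrated by a covering argument for absolutely continuous functions
  (\<open>absolutely_continuous_growth_bounds\<close>).
\<close>

section \<open>Truncation, uniform integrability and discrete energy\<close>

context prob_space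
begin

text \<open>
  Bounded variables may be added, multiplied and integrated without further conditions, which
  disposes of the integrability conditions in the computations with bounded martingales.
\<close>

definition ess_bounded :: "('a \<Rightarrow> real) \<Rightarrow> bool" where
  "ess_bounded f \<longleftrightarrow> f \<in> borel_measurable M \<and> (\<exists>C. AE x in M. \<bar>f x\<bar> \<le> C)"

lemma ess_boundedI: "f \<in> borel_measurable M \<Longrightarrow> AE x in M. \<bar>f x\<bar> \<le> C \<Longrightarrow> ess_bounded f"
  unfolding ess_bounded_def by blast

lemma ess_bounded_integrable:
  assumes "ess_bounded f" shows "integrable M f"
proof -
  from assms obtain C where "f \<in> borel_measurable M" "AE x in M. \<bar>f x\<bar> \<le> C"
    unfolding ess_bounded_def by blast
  then show ?thesis by (intro integrable_const_bound[where B=C]) auto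
qed

lemma ess_bounded_const: "ess_bounded (\<lambda>x. c)"
  by (rule ess_boundedI[of _ "\<bar>c\<bar>"]) auto

lemma ess_bounded_add:
  assumes "ess_bounded f" "ess_bounded g" shows "ess_bounded (\<lambda>x. f x + g x)"
proof -
  from assms obtain C D where m [measurable]: "f \<in> borel_measurable M" "g \<in> borel_measurable M"
    and *: "AE x in M. \<bar>f x\<bar> \<le> C" "AE x in M. \<bar>g x\<bar> \<le> D" unfolding ess_bounded_def by blast
  show ?thesis
    by (rule ess_boundedI[of _ "C + D"], measurable) (use * in \<open>eventually_elim, linarith\<close>)
qed

lemma ess_bounded_mult:
  assumes "ess_bounded f" "ess_bounded g" shows "ess_bounded (\<lambda>x. f x * g x)"
proof -
  from assms obtain C D where m [measurable]: "f \<in> borel_measurable M" "g \<in> borel_measurable M"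
    and *: "AE x in M. \<bar>f x\<bar> \<le> C" "AE x in M. \<bar>g x\<bar> \<le> D" unfolding ess_bounded_def by blast
  show ?thesis
    by (rule ess_boundedI[of _ "C * D"], measurable)
       (use * in \<open>eventually_elim, auto simp: abs_mult intro!: mult_mono\<close>)
qed

lemma ess_bounded_diff: "ess_bounded f \<Longrightarrow> ess_bounded g \<Longrightarrow> ess_bounded (\<lambda>x. f x - g x)"
  using ess_bounded_add[OF _ ess_bounded_mult[OF ess_bounded_const[of "-1"]], of f g] by simp

lemma ess_bounded_power: "ess_bounded f \<Longrightarrow> ess_bounded (\<lambda>x. f x ^ n)"
  by (induction n) (auto intro: ess_bounded_const ess_bounded_mult)

lemma ess_bounded_sum: "(\<And>i. i \<in> I \<Longrightarrow> ess_bounded (f i)) \<Longrightarrow> ess_bounded (\<lambda>x. \<Sum>i\<in>I. f i x)"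
  by (induction I rule: infinite_finite_induct) (auto intro: ess_bounded_const ess_bounded_add)

lemmas ess_bounded_intros =
  ess_bounded_const ess_bounded_add ess_bounded_diff ess_bounded_mult ess_bounded_power ess_bounded_sum

text \<open>
  Nonnegative variables with a common mean and bounded second moments are uniformly integrable:
  truncation at level \<open>m\<close> costs at most \<open>C / m\<close>, because \<open>x - min x m \<le> x\<^sup>2 / m\<close>. So the
  mean survives an almost sure limit.
\<close>

lemma L2_bounded_limit:
  fixes S :: "nat \<Rightarrow> 'a \<Rightarrow> real"
  assumes S: "\<And>k. integrable M (S k)" "\<And>k x. 0 \<le> S k x"
    and S2: "\<And>k. integrable M (\<lambda>x. (S k x)\<^sup>2)" "\<And>k. (\<integral>x. (S k x)\<^sup>2 \<partial>M) \<le> C"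
    and mean: "\<And>k. (\<integral>x. S k x \<partial>M) = e"
    and lim: "AE x in M. (\<lambda>k. S k x) \<longlonglongrightarrow> L x" and L: "L \<in> borel_measurable M"
  shows "integrable M L" "(\<integral>x. L x \<partial>M) = e"
proof -
  note [measurable] = borel_measurable_integrable[OF S(1)] L
  have Lnn: "AE x in M. 0 \<le> L x"
    using lim by eventually_elim (rule LIMSEQ_le_const, auto simp: S(2))
  have ib: "integrable M (\<lambda>x. min (S k x) (real m))" for k m
    by (rule Bochner_Integration.integrable_bound[OF S(1)[of k]]) (auto simp: S(2))
  have trunc: "e - C / real (Suc m) \<le> (\<integral>x. min (S k x) (real (Suc m)) \<partial>M) \<and>
      (\<integral>x. min (S k x) (real (Suc m)) \<partial>M) \<le> e" for k m
  proof
    have pt: "s \<le> min s M + s\<^sup>2 / M" if "0 \<le> s" "0 < M" for s M :: real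
    proof (cases "s \<le> M")
      case False
      then have "s * M \<le> s\<^sup>2" using that by (simp add: power2_eq_square)
      then have "s \<le> s\<^sup>2 / M" using that by (simp add: pos_le_divide_eq)
      then show ?thesis using False that by (simp add: min_def)
    qed (use that in simp)
    have "e \<le> (\<integral>x. min (S k x) (real (Suc m)) + (S k x)\<^sup>2 / real (Suc m) \<partial>M)"
      unfolding mean[of k, symmetric]
      by (intro integral_mono S(1) Bochner_Integration.integrable_add ib integrable_divide_zero S2(1) pt S(2)) auto
    also have "\<dots> = (\<integral>x. min (S k x) (real (Suc m)) \<partial>M) + (\<integral>x. (S k x)\<^sup>2 \<partial>M) / real (Suc m)"
      by (subst Bochner_Integration.integral_add) (auto intro: ib S2(1) simp del: of_nat_Suc)
    also have "\<dots> \<le> (\<integral>x. min (S k x) (real (Suc m)) \<partial>M) + C / real (Suc m)"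
      by (intro add_left_mono divide_right_mono S2(2)) auto
    finally show "e - C / real (Suc m) \<le> (\<integral>x. min (S k x) (real (Suc m)) \<partial>M)" by simp
    show "(\<integral>x. min (S k x) (real (Suc m)) \<partial>M) \<le> e"
      unfolding mean[of k, symmetric] by (intro integral_mono S(1) ib) simp
  qed
  have conv: "(\<lambda>k. \<integral>x. min (S k x) (real (Suc m)) \<partial>M) \<longlonglongrightarrow> (\<integral>x. min (L x) (real (Suc m)) \<partial>M)" for m
  proof (rule integral_dominated_convergence[where w="\<lambda>_. real (Suc m)"])
    show "AE x in M. (\<lambda>k. min (S k x) (real (Suc m))) \<longlonglongrightarrow> min (L x) (real (Suc m))"
      using lim by eventually_elim (intro tendsto_intros)
    show "AE x in M. norm (min (S k x) (real (Suc m))) \<le> real (Suc m)" for k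
      using S(2) by (auto simp del: of_nat_Suc)
  qed (simp_all del: of_nat_Suc)
  have lims: "(\<lambda>m. \<integral>x. min (L x) (real (Suc m)) \<partial>M) \<longlonglongrightarrow> e"
  proof (rule tendsto_sandwich[OF _ _ _ tendsto_const])
    have "e - C / real (Suc m) \<le> (\<integral>x. min (L x) (real (Suc m)) \<partial>M)" for m
      using trunc by (intro LIMSEQ_le_const[OF conv]) blast
    then show "eventually (\<lambda>m. e - C / real (Suc m) \<le> (\<integral>x. min (L x) (real (Suc m)) \<partial>M)) sequentially" by simp
    have "(\<integral>x. min (L x) (real (Suc m)) \<partial>M) \<le> e" for m
      using trunc by (intro LIMSEQ_le_const2[OF conv]) blast
    then show "eventually (\<lambda>m. (\<integral>x. min (L x) (real (Suc m)) \<partial>M) \<le> e) sequentially" by simp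
    have "(\<lambda>m. e - C / real (Suc m)) \<longlonglongrightarrow> e - 0"
      by (intro tendsto_intros LIMSEQ_Suc[OF lim_const_over_n])
    then show "(\<lambda>m. e - C / real (Suc m)) \<longlonglongrightarrow> e" by simp
  qed
  have a1: "integrable M (\<lambda>x. min (L x) (real (Suc m)))" for m
    by (rule integrable_const_bound[where B="real (Suc m)"]) (use Lnn in \<open>auto simp del: of_nat_Suc\<close>)
  have a2: "AE x in M. mono (\<lambda>m. min (L x) (real (Suc m)))"
    by (auto simp: mono_def)
  have a3: "AE x in M. 0 \<le> min (L x) (real (Suc m))" for m
    using Lnn by auto
  have a4: "AE x in M. (\<lambda>m. min (L x) (real (Suc m))) \<longlonglongrightarrow> L x"
  proof (rule AE_I2)
    fix x
    obtain N :: nat where "L x \<le> real N" using real_arch_simple by blast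
    then have "eventually (\<lambda>m. min (L x) (real (Suc m)) = L x) sequentially"
      unfolding eventually_sequentially by (intro exI[of _ N]) auto
    then show "(\<lambda>m. min (L x) (real (Suc m))) \<longlonglongrightarrow> L x" by (rule tendsto_eventually)
  qed
  show "integrable M L" "(\<integral>x. L x \<partial>M) = e"
    by (rule integral_monotone_convergence_nonneg[OF a1 a2 a3 a4 lims L])+
qed

end

text \<open>
  Grouping the products \<open>a\<^sub>i a\<^sub>j\<close> by their smaller index turns the second moment of a sum of squared
  martingale increments into energies of the remaining increments.
\<close>

lemma sum_squared_le_tails:
  fixes a :: "nat \<Rightarrow> real"
  assumes "\<And>i. 0 \<le> a i"
  shows "(\<Sum>i<n. a i)\<^sup>2 \<le> 2 * (\<Sum>i<n. a i * (\<Sum>j\<in>{i..<n}. a j))"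
proof (induction n)
  case (Suc n)
  have "(\<Sum>i<n. a i * (\<Sum>j\<in>{i..<Suc n}. a j)) = (\<Sum>i<n. a i * (\<Sum>j\<in>{i..<n}. a j) + a i * a n)"
    by (intro sum.cong) (auto simp: algebra_simps)
  also have "\<dots> = (\<Sum>i<n. a i * (\<Sum>j\<in>{i..<n}. a j)) + (\<Sum>i<n. a i) * a n"
    by (simp add: sum.distrib sum_distrib_right)
  finally have "2 * (\<Sum>i<Suc n. a i * (\<Sum>j\<in>{i..<Suc n}. a j)) =
     2 * (\<Sum>i<n. a i * (\<Sum>j\<in>{i..<n}. a j)) + 2 * (\<Sum>i<n. a i) * a n + 2 * (a n)\<^sup>2"
    by (simp add: power2_eq_square algebra_simps)
  moreover have "(\<Sum>i<Suc n. a i)\<^sup>2 = (\<Sum>i<n. a i)\<^sup>2 + 2 * (\<Sum>i<n. a i) * a n + (a n)\<^sup>2"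
    by (simp add: power2_eq_square algebra_simps)
  ultimately show ?case using Suc zero_le_power2[of "a n"] by linarith
qed simp

text \<open>
  The martingale property in tested form: no conditional expectation is mentioned, so that it can be
  verified directly from optional stopping.
\<close>

locale bounded_discrete_martingale = prob_space M for M :: "'a measure" +
  fixes F :: "nat \<Rightarrow> 'a measure" and Y :: "nat \<Rightarrow> 'a \<Rightarrow> real" and K :: real
  assumes sub: "\<And>i. subalgebra M (F i)"
    and mono: "\<And>i j. i \<le> j \<Longrightarrow> sets (F i) \<subseteq> sets (F j)"
    and adapted: "\<And>i. Y i \<in> borel_measurable (F i)"
    and bound: "\<And>i. AE x in M. \<bar>Y i x\<bar> \<le> K"
    and fair: "\<And>i j W C. i \<le> j \<Longrightarrow> W \<in> borel_measurable (F i) \<Longrightarrow> AE x in M. \<bar>W x\<bar> \<le> C \<Longrightarrow>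
        (\<integral>x. W x * (Y j x - Y i x) \<partial>M) = 0"
begin

abbreviation sq_sum :: "nat \<Rightarrow> nat \<Rightarrow> 'a \<Rightarrow> real" where
  "sq_sum i n x \<equiv> \<Sum>j\<in>{i..<n}. (Y (Suc j) x - Y j x)\<^sup>2"

lemma F_mono: "i \<le> j \<Longrightarrow> f \<in> borel_measurable (F i) \<Longrightarrow> f \<in> borel_measurable (F j)"
  using mono[of i j] sub[of i] sub[of j] by (auto simp: measurable_def subalgebra_def)

lemma F_M: "f \<in> borel_measurable (F i) \<Longrightarrow> f \<in> borel_measurable M"
  by (rule measurable_from_subalg[OF sub])

lemma ess_bounded_Y: "ess_bounded (Y i)"
  by (rule ess_boundedI[OF F_M[OF adapted] bound])

lemma ess_bounded_sq_sum: "ess_bounded (sq_sum i n)"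
  by (intro ess_bounded_intros ess_bounded_Y)

text \<open>
  Increments over disjoint intervals are orthogonal, even after multiplication by a variable known at
  the start, because the cross term is again an increment tested against the past.
\<close>

lemma weighted_energy:
  assumes "i \<le> n" and W: "W \<in> borel_measurable (F i)" "AE x in M. \<bar>W x\<bar> \<le> C"
  shows "(\<integral>x. W x * (Y n x - Y i x)\<^sup>2 \<partial>M) = (\<integral>x. W x * sq_sum i n x \<partial>M)"
  using assms(1)
proof (induction n rule: dec_induct)
  case base then show ?case by simp
next
  case (step n)
  have bW: "ess_bounded W" by (rule ess_boundedI[OF F_M[OF W(1)] W(2)])
  let ?V = "\<lambda>x. W x * (Y n x - Y i x)"
  have [measurable]: "W \<in> borel_measurable (F n)" "Y n \<in> borel_measurable (F n)" "Y i \<in> borel_measurable (F n)"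
    using F_mono[OF step(1)] W(1) adapted by auto
  have bV: "ess_bounded ?V" by (intro ess_bounded_intros ess_bounded_Y bW)
  then obtain D where D: "AE x in M. \<bar>?V x\<bar> \<le> D" unfolding ess_bounded_def by blast
  have z: "(\<integral>x. ?V x * (Y (Suc n) x - Y n x) \<partial>M) = 0"
    by (rule fair[OF _ _ D]) auto
  have "(\<integral>x. W x * (Y (Suc n) x - Y i x)\<^sup>2 \<partial>M) =
     (\<integral>x. (W x * (Y n x - Y i x)\<^sup>2 + 2 * (?V x * (Y (Suc n) x - Y n x))) + W x * (Y (Suc n) x - Y n x)\<^sup>2 \<partial>M)"
    by (intro Bochner_Integration.integral_cong) (auto simp: power2_eq_square algebra_simps)
  also have "\<dots> = (\<integral>x. W x * (Y n x - Y i x)\<^sup>2 \<partial>M) + 2 * (\<integral>x. ?V x * (Y (Suc n) x - Y n x) \<partial>M)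
      + (\<integral>x. W x * (Y (Suc n) x - Y n x)\<^sup>2 \<partial>M)"
    by (subst Bochner_Integration.integral_add Bochner_Integration.integral_add integral_mult_right_zero,
        (intro ess_bounded_integrable ess_bounded_intros ess_bounded_Y bW)+)+ simp
  also have "\<dots> = (\<integral>x. W x * sq_sum i n x \<partial>M) + (\<integral>x. W x * (Y (Suc n) x - Y n x)\<^sup>2 \<partial>M)"
    using step z by simp
  also have "\<dots> = (\<integral>x. W x * sq_sum i n x + W x * (Y (Suc n) x - Y n x)\<^sup>2 \<partial>M)"
    by (intro Bochner_Integration.integral_add[symmetric] ess_bounded_integrable ess_bounded_intros ess_bounded_Y bW)
  also have "\<dots> = (\<integral>x. W x * sq_sum i (Suc n) x \<partial>M)"
    using step(1) by (intro Bochner_Integration.integral_cong) (auto simp: algebra_simps)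
  finally show ?case .
qed

lemma energy:
  "(\<integral>x. sq_sum 0 n x \<partial>M) = (\<integral>x. (Y n x - Y 0 x)\<^sup>2 \<partial>M)"
  using weighted_energy[of 0 n "\<lambda>_. 1" 1] by simp

lemma AE_sq_diff_le: "AE x in M. (Y j x - Y i x)\<^sup>2 \<le> 4 * K\<^sup>2"
  using bound[of i] bound[of j]
proof eventually_elim
  case (elim x)
  then have "\<bar>Y j x - Y i x\<bar> \<le> 2 * K" by linarith
  then have "\<bar>Y j x - Y i x\<bar>\<^sup>2 \<le> (2 * K)\<^sup>2" by (intro power_mono) auto
  then show ?case by (simp add: power_mult_distrib)
qed

text \<open>
  Given the past, the remaining sum of squares has the mean of a single squared increment, at most
  \<open>4 K\<^sup>2\<close>. So the bound does not depend on the number of steps.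
\<close>

lemma sq_sum_second_moment:
  "(\<integral>x. (sq_sum 0 n x)\<^sup>2 \<partial>M) \<le> 64 * K ^ 4"
proof -
  note bd = ess_bounded_integrable ess_bounded_intros ess_bounded_Y
  have summand: "(\<integral>x. (Y (Suc i) x - Y i x)\<^sup>2 * sq_sum i n x \<partial>M) \<le> 8 * K\<^sup>2 * (\<integral>x. (Y (Suc i) x - Y i x)\<^sup>2 \<partial>M)"
    if i: "i < n" for i
  proof -
    let ?d = "\<lambda>x. (Y (Suc i) x - Y i x)\<^sup>2"
    have [measurable]: "Y (Suc i) \<in> borel_measurable (F (Suc i))" "Y i \<in> borel_measurable (F (Suc i))"
      using F_mono[of i "Suc i"] adapted by auto
    have "ess_bounded ?d" by (intro bd)
    then obtain C where C: "AE x in M. \<bar>?d x\<bar> \<le> C" unfolding ess_bounded_def by blast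
    have "(\<integral>x. ?d x * sq_sum i n x \<partial>M) = (\<integral>x. ?d x * ?d x + ?d x * sq_sum (Suc i) n x \<partial>M)"
      using i by (intro Bochner_Integration.integral_cong) (auto simp: sum.atLeast_Suc_lessThan algebra_simps)
    also have "\<dots> = (\<integral>x. ?d x * ?d x \<partial>M) + (\<integral>x. ?d x * sq_sum (Suc i) n x \<partial>M)"
      by (intro Bochner_Integration.integral_add bd)
    also have "(\<integral>x. ?d x * sq_sum (Suc i) n x \<partial>M) = (\<integral>x. ?d x * (Y n x - Y (Suc i) x)\<^sup>2 \<partial>M)"
      using i by (intro weighted_energy[OF _ _ C, symmetric]) auto
    also have "(\<integral>x. ?d x * ?d x \<partial>M) + \<dots> = (\<integral>x. ?d x * ?d x + ?d x * (Y n x - Y (Suc i) x)\<^sup>2 \<partial>M)"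
      by (intro Bochner_Integration.integral_add[symmetric] bd)
    also have "\<dots> \<le> (\<integral>x. 8 * K\<^sup>2 * ?d x \<partial>M)"
    proof (intro integral_mono_AE bd)
      show "AE x in M. ?d x * ?d x + ?d x * (Y n x - Y (Suc i) x)\<^sup>2 \<le> 8 * K\<^sup>2 * ?d x"
        using AE_sq_diff_le[of "Suc i" i] AE_sq_diff_le[of n "Suc i"]
      proof eventually_elim
        case (elim x)
        then have "?d x * (?d x + (Y n x - Y (Suc i) x)\<^sup>2) \<le> ?d x * (8 * K\<^sup>2)"
          by (intro mult_left_mono) auto
        then show ?case by (simp add: algebra_simps)
      qed
    qed
    finally show ?thesis by simp
  qed
  have "(\<integral>x. (sq_sum 0 n x)\<^sup>2 \<partial>M) \<le> (\<integral>x. 2 * (\<Sum>i<n. (Y (Suc i) x - Y i x)\<^sup>2 * sq_sum i n x) \<partial>M)"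
    using sum_squared_le_tails[of "\<lambda>i. (Y (Suc i) _ - Y i _)\<^sup>2" n]
    by (intro integral_mono bd) (auto simp: atLeast0LessThan)
  also have "\<dots> = 2 * (\<Sum>i<n. \<integral>x. (Y (Suc i) x - Y i x)\<^sup>2 * sq_sum i n x \<partial>M)"
    by (subst integral_mult_right_zero, subst Bochner_Integration.integral_sum, intro bd) simp
  also have "\<dots> \<le> 2 * (\<Sum>i<n. 8 * K\<^sup>2 * (\<integral>x. (Y (Suc i) x - Y i x)\<^sup>2 \<partial>M))"
    by (intro mult_left_mono sum_mono summand) auto
  also have "\<dots> = 16 * K\<^sup>2 * (\<Sum>i<n. \<integral>x. (Y (Suc i) x - Y i x)\<^sup>2 \<partial>M)"
    by (simp add: sum_distrib_left mult.assoc)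
  also have "(\<Sum>i<n. \<integral>x. (Y (Suc i) x - Y i x)\<^sup>2 \<partial>M) = (\<integral>x. sq_sum 0 n x \<partial>M)"
    by (subst Bochner_Integration.integral_sum, intro bd) (simp add: atLeast0LessThan)
  also have "\<dots> = (\<integral>x. (Y n x - Y 0 x)\<^sup>2 \<partial>M)" by (rule energy)
  also have "\<dots> \<le> (\<integral>x. 4 * K\<^sup>2 \<partial>M)"
    by (intro integral_mono_AE bd AE_sq_diff_le)
  also have "\<dots> = 4 * K\<^sup>2" by (simp add: prob_space)
  finally show ?thesis by (simp add: mult_left_mono power2_eq_square power4_eq_xxxx)
qed

end

section \<open>Growth of absolutely continuous functions\<close>

lemma derivative_local_growth:
  assumes der: "(f has_real_derivative D) (at x within {0..})" and D: "D \<le> U" and \<eta>: "0 < \<eta>" and x: "0 \<le> x"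
  obtains r where "0 < r"
    "\<And>u v. 0 \<le> u \<Longrightarrow> u \<le> x \<Longrightarrow> x \<le> v \<Longrightarrow> x - u < r \<Longrightarrow> v - x < r \<Longrightarrow> f v - f u \<le> (U + \<eta>) * (v - u)"
proof -
  from der have "(f has_derivative (*) D) (at x within {0..})" by (simp add: has_field_derivative_def)
  then obtain r where r: "0 < r" "\<And>y. 0 \<le> y \<Longrightarrow> \<bar>y - x\<bar> < r \<Longrightarrow> \<bar>f y - f x - D * (y - x)\<bar> \<le> \<eta> * \<bar>y - x\<bar>"
    using \<eta> unfolding has_derivative_within_alt by fastforce
  show ?thesis
  proof
    fix u v assume *: "0 \<le> u" "u \<le> x" "x \<le> v" "x - u < r" "v - x < r"
    have "\<bar>f u - f x - D * (u - x)\<bar> \<le> \<eta> * (x - u)" using r(2)[of u] * by auto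
    moreover have "\<bar>f v - f x - D * (v - x)\<bar> \<le> \<eta> * (v - x)" using r(2)[of v] * by auto
    ultimately have "f v - f u \<le> D * (v - u) + \<eta> * (v - u)" by (simp add: algebra_simps)
    also have "\<dots> \<le> U * (v - u) + \<eta> * (v - u)" using * D by (intro add_mono mult_right_mono) auto
    finally show "f v - f u \<le> (U + \<eta>) * (v - u)" by (simp add: algebra_simps)
  qed (rule r(1))
qed

text \<open>
  Let \<open>N\<close> be a null set containing the points where the derivative does not exist or exceeds \<open>U\<close>. Choose a
  gauge that forces the intervals tagged in \<open>N\<close> into an open set \<open>S\<close> of small measure, and every
  other interval to be so short that the derivative at its tag controls the increment. Absolute
  continuity makes the contribution of the first kind negligible, and the others add up to at
  most \<open>(U + \<eta>) (b - a)\<close>.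
\<close>

lemma absolutely_continuous_growth_le:
  assumes ac: "absolutely_continuous_on 0 b f" and ab: "0 \<le> a" "a \<le> b"
    and der: "AE t in lborel. a \<le> t \<and> t \<le> b \<longrightarrow>
       (\<exists>D. (f has_real_derivative D) (at t within {0..}) \<and> D \<le> U)"
  shows "f b - f a \<le> U * (b - a)"
proof (rule field_le_epsilon)
  fix e :: real assume e: "0 < e"
  define \<eta> where "\<eta> = e / (2 * (b - a + 1))"
  have \<eta>: "0 < \<eta>" "\<eta> * (b - a) \<le> e / 2"
    using e ab by (auto simp: \<eta>_def divide_simps mult_left_mono)
  define c where "c = \<bar>U + \<eta>\<bar>"
  have "0 < e / 4" using e by simp
  with ac obtain \<delta> where \<delta>: "\<delta> > 0" and \<delta>2: "\<forall>D :: (real \<times> real) set.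
        finite D \<and> (\<forall>(x, y)\<in>D. 0 \<le> x \<and> x \<le> y \<and> y \<le> b) \<and>
        disjoint_family_on (\<lambda>(x, y). {x<..<y}) D \<and> (\<Sum>(x, y)\<in>D. y - x) < \<delta>
        \<longrightarrow> (\<Sum>(x, y)\<in>D. \<bar>f y - f x\<bar>) < e / 4"
    unfolding absolutely_continuous_on_def by (elim allE[of _ "e / 4"] impE exE conjE)
  \<comment> \<open>the second bound absorbs the terms \<open>c (v - u)\<close> that the exceptional intervals would have contributed to the main sum\<close>
  define \<delta>' where "\<delta>' = min \<delta> (e / (4 * (c + 1)))"
  have c: "0 \<le> c" by (simp add: c_def)
  have \<delta>': "0 < \<delta>'" "\<delta>' \<le> \<delta>" "c * \<delta>' \<le> e / 4"
  proof -
    show "0 < \<delta>'" "\<delta>' \<le> \<delta>" using \<delta> e c by (auto simp: \<delta>'_def)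
    have "c * \<delta>' \<le> c * (e / (4 * (c + 1)))" using c by (intro mult_left_mono) (auto simp: \<delta>'_def)
    also have "\<dots> \<le> e / 4" using c e by (simp add: divide_simps mult_left_mono)
    finally show "c * \<delta>' \<le> e / 4" .
  qed
  obtain N where N: "N \<in> null_sets lborel"
    "\<And>t. a \<le> t \<Longrightarrow> t \<le> b \<Longrightarrow> t \<notin> N \<Longrightarrow> \<exists>D. (f has_real_derivative D) (at t within {0..}) \<and> D \<le> U"
    using der unfolding eventually_ae_filter by (auto simp: subset_iff) blast
  obtain S where S: "N \<subseteq> S" "open S" "emeasure lborel S < ennreal \<delta>'"
  proof -
    have "N \<in> null_sets lebesgue" using N(1) by (rule null_sets_completionI)
    then have "N \<in> sets lebesgue" "emeasure lebesgue N = 0" by auto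
    from sets_lebesgue_outer_open[OF this(1) \<delta>'(1)] obtain T
      where T: "open T" "N \<subseteq> T" "T - N \<in> lmeasurable" "emeasure lebesgue (T - N) < ennreal \<delta>'" by auto
    have "emeasure lebesgue T = emeasure lebesgue (T - N)"
      using \<open>N \<in> null_sets lebesgue\<close> T(1) by (intro emeasure_Diff_null_set[symmetric]) auto
    then have "emeasure lborel T < ennreal \<delta>'" using T by simp
    then show ?thesis using that T by blast
  qed
  have ex: "\<exists>r>0. \<forall>u v. a \<le> u \<longrightarrow> u \<le> x \<longrightarrow> x \<le> v \<longrightarrow> x - u < r \<longrightarrow> v - x < r \<longrightarrow> f v - f u \<le> (U + \<eta>) * (v - u)"
    if xN: "x \<in> {a..b} - N" for x
  proof -
    obtain D where D: "(f has_real_derivative D) (at x within {0..})" "D \<le> U" using N(2)[of x] xN by auto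
    obtain r where "0 < r"
    "\<And>u v. 0 \<le> u \<Longrightarrow> u \<le> x \<Longrightarrow> x \<le> v \<Longrightarrow> x - u < r \<Longrightarrow> v - x < r \<Longrightarrow> f v - f u \<le> (U + \<eta>) * (v - u)"
      using derivative_local_growth[OF D \<eta>(1), of thesis] xN ab by auto
    then show ?thesis using ab by (intro exI[of _ r]) auto
  qed
  then obtain r where r: "\<And>x. x \<in> {a..b} - N \<Longrightarrow> r x > 0"
    "\<And>x u v. x \<in> {a..b} - N \<Longrightarrow> a \<le> u \<Longrightarrow> u \<le> x \<Longrightarrow> x \<le> v \<Longrightarrow> x - u < r x \<Longrightarrow> v - x < r x \<Longrightarrow> f v - f u \<le> (U + \<eta>) * (v - u)"
    by metis
  define \<gamma> where "\<gamma> = (\<lambda>x. if x \<in> N then S else if x \<in> {a..b} then ball x (r x) else UNIV)"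
  have "gauge \<gamma>" unfolding gauge_def \<gamma>_def using S r(1) by auto
  then obtain p where p: "p tagged_division_of {a..b}" "\<gamma> fine p" by (rule fine_division_exists_real)
  note pD = tagged_division_ofD[OF p(1)]
  have K: "Inf K \<le> x \<and> x \<le> Sup K \<and> a \<le> Inf K \<and> Sup K \<le> b \<and> K = {Inf K..Sup K} \<and> {Inf K..Sup K} \<subseteq> \<gamma> x"
    if xK: "(x, K) \<in> p" for x K
  proof -
    obtain u v where uv: "K = cbox u v" using pD(4)[OF xK] by blast
    have "x \<in> K" "K \<subseteq> {a..b}" "K \<subseteq> \<gamma> x" using pD(2,3)[OF xK] p(2) xK by (auto simp: fine_def)
    then show ?thesis using uv by auto
  qed
  define B where "B = {(x, K) \<in> p. x \<in> N \<and> Inf K < Sup K}"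
  have finB: "finite B" using pD(1) by (auto simp: B_def intro: finite_subset[of _ p])
  \<comment> \<open>nondegenerate intervals of a tagged division determine their tags, so the exceptional ones can be listed by their endpoints\<close>
  define J where "J = (\<lambda>(x :: real, K). (Inf K, Sup K :: real))"
  have disj: "{Inf K<..<Sup K} \<inter> {Inf K'<..<Sup K'} = {}"
    if "(x, K) \<in> p" "(x', K') \<in> p" "(x, K) \<noteq> (x', K')" for x K x' K'
  proof -
    have 1: "interior K = {Inf K<..<Sup K}" using K[OF that(1)] by (metis interior_atLeastAtMost_real)
    have 2: "interior K' = {Inf K'<..<Sup K'}" using K[OF that(2)] by (metis interior_atLeastAtMost_real)
    show ?thesis using pD(5)[OF that] unfolding 1 2 .
  qed
  have inj: "inj_on J B"
  proof (rule inj_onI)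
    fix y z assume yz: "y \<in> B" "z \<in> B" "J y = J z"
    obtain x K x' K' where xK: "y = (x, K)" "z = (x', K')" by (cases y, cases z)
    show "y = z"
    proof (rule ccontr)
      assume "y \<noteq> z"
      then have "{Inf K<..<Sup K} \<inter> {Inf K'<..<Sup K'} = {}" using disj yz xK by (auto simp: B_def)
      moreover have "Inf K = Inf K'" "Sup K = Sup K'" "Inf K < Sup K" using yz xK by (auto simp: J_def B_def)
      ultimately show False by (auto dest: dense)
    qed
  qed
  have disjJ: "disjoint_family_on (\<lambda>(x, y). {x<..<y}) (J ` B)"
    unfolding disjoint_family_on_def
  proof (intro ballI impI)
    fix d d' assume d: "d \<in> J ` B" "d' \<in> J ` B" "d \<noteq> d'"
    obtain x K where xK: "(x, K) \<in> p" "d = (Inf K, Sup K)" using d(1) by (auto simp: J_def B_def)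
    obtain x' K' where xK': "(x', K') \<in> p" "d' = (Inf K', Sup K')" using d(2) by (auto simp: J_def B_def)
    have "(x, K) \<noteq> (x', K')" using xK xK' d(3) by auto
    from disj[OF xK(1) xK'(1) this]
    show "(case d of (x, y) \<Rightarrow> {x<..<y}) \<inter> (case d' of (x, y) \<Rightarrow> {x<..<y}) = {}"
      unfolding xK xK' by simp
  qed
  have subJ: "\<forall>(x, y)\<in>J ` B. 0 \<le> x \<and> x \<le> y \<and> y \<le> b"
  proof
    fix d assume "d \<in> J ` B"
    then obtain x L where xL: "(x, L) \<in> p" "d = (Inf L, Sup L)" by (auto simp: J_def B_def)
    show "case d of (x, y) \<Rightarrow> 0 \<le> x \<and> x \<le> y \<and> y \<le> b"
      using K[OF xL(1)] ab(1) unfolding xL(2) prod.case by linarith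
  qed
  have "ennreal (\<Sum>(x, y)\<in>J ` B. y - x) = (\<Sum>d\<in>J ` B. ennreal (snd d - fst d))"
    using subJ by (subst sum_ennreal[symmetric]) (auto simp: case_prod_unfold)
  also have "\<dots> = (\<Sum>d\<in>J ` B. emeasure lborel (case d of (x, y) \<Rightarrow> {x<..<y}))"
    using subJ by (intro sum.cong) (auto simp: case_prod_unfold)
  also have "\<dots> = emeasure lborel (\<Union>d\<in>J ` B. case d of (x, y) \<Rightarrow> {x<..<y})"
    using finB disjJ by (intro sum_emeasure) auto
  also have "\<dots> \<le> emeasure lborel S"
  proof (rule emeasure_mono)
    show "(\<Union>d\<in>J ` B. case d of (x, y) \<Rightarrow> {x<..<y}) \<subseteq> S"
    proof
      fix t assume "t \<in> (\<Union>d\<in>J ` B. case d of (x, y) \<Rightarrow> {x<..<y})"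
      then obtain x L where xL: "(x, L) \<in> p" "x \<in> N" "Inf L < t" "t < Sup L" by (auto simp: B_def J_def)
      then have "t \<in> \<gamma> x" using K[OF xL(1)] by auto
      then show "t \<in> S" using xL(2) by (simp add: \<gamma>_def)
    qed
  qed (use S in simp)
  also have "\<dots> < ennreal \<delta>'" by (rule S(3))
  finally have len_ennreal: "ennreal (\<Sum>(x, y)\<in>J ` B. y - x) < ennreal \<delta>'" .
  have "0 \<le> (\<Sum>(x, y)\<in>J ` B. y - x)" using subJ by (intro sum_nonneg) auto
  from len_ennreal[unfolded ennreal_less_iff[OF this]] have len: "(\<Sum>(x, y)\<in>J ` B. y - x) < \<delta>'" .
  have small: "(\<Sum>(x, y)\<in>J ` B. \<bar>f y - f x\<bar>) < e / 4"
    using finB subJ disjJ len \<delta>'(2) by (intro mp[OF spec[OF \<delta>2]] conjI) auto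
  have reind: "(\<Sum>(x, K)\<in>B. g (Inf K) (Sup K)) = (\<Sum>(x, y)\<in>J ` B. g x y)" for g :: "real \<Rightarrow> real \<Rightarrow> real"
    by (subst sum.reindex[OF inj]) (auto simp: J_def case_prod_unfold)
  have "(f b - f a) - (U + \<eta>) * (b - a) = (\<Sum>(x, K)\<in>p. f (Sup K) - f (Inf K)) - (U + \<eta>) * (\<Sum>(x, K)\<in>p. Sup K - Inf K)"
    using additive_tagged_division_1[OF ab(2) p(1), of f] additive_tagged_division_1[OF ab(2) p(1), of "\<lambda>x. x"] by simp
  also have "\<dots> = (\<Sum>(x, K)\<in>p. f (Sup K) - f (Inf K) - (U + \<eta>) * (Sup K - Inf K))"
    by (simp add: sum_distrib_left sum_subtractf[symmetric] case_prod_unfold)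
  also have "\<dots> \<le> (\<Sum>(x, K)\<in>p. if (x, K) \<in> B then \<bar>f (Sup K) - f (Inf K)\<bar> + c * (Sup K - Inf K) else 0)"
  proof (rule sum_mono, clarify)
    fix x K assume xK: "(x, K) \<in> p"
    note k = K[OF xK]
    show "f (Sup K) - f (Inf K) - (U + \<eta>) * (Sup K - Inf K) \<le>
      (if (x, K) \<in> B then \<bar>f (Sup K) - f (Inf K)\<bar> + c * (Sup K - Inf K) else 0)"
    proof (cases "(x, K) \<in> B")
      case True
      have "- (U + \<eta>) * (Sup K - Inf K) \<le> c * (Sup K - Inf K)"
        using k by (intro mult_right_mono) (auto simp: c_def)
      then have "- ((U + \<eta>) * (Sup K - Inf K)) \<le> c * (Sup K - Inf K)" by (simp only: mult_minus_left)
      then have "f (Sup K) - f (Inf K) - (U + \<eta>) * (Sup K - Inf K) \<le> \<bar>f (Sup K) - f (Inf K)\<bar> + c * (Sup K - Inf K)"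
        by linarith
      then show ?thesis using True by (simp only: if_True)
    next
      case False
      then consider "Inf K = Sup K" | "x \<notin> N" using k xK by (auto simp: B_def)
      then have "f (Sup K) - f (Inf K) \<le> (U + \<eta>) * (Sup K - Inf K)"
      proof cases
        case 2
        then have xab: "x \<in> {a..b} - N" using k by auto
        have "{Inf K..Sup K} \<subseteq> ball x (r x)" using k 2 xab by (auto simp: \<gamma>_def)
        moreover have "Inf K \<le> Sup K" using k by linarith
        then have "Inf K \<in> {Inf K..Sup K}" "Sup K \<in> {Inf K..Sup K}" by simp_all
        ultimately have "Inf K \<in> ball x (r x)" "Sup K \<in> ball x (r x)" by (blast dest: subsetD)+
        then show ?thesis using k by (intro r(2)[OF xab]) (auto simp: dist_real_def)
      qed simp
      then show ?thesis using False by simp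
    qed
  qed
  also have "\<dots> = (\<Sum>(x, K)\<in>B. \<bar>f (Sup K) - f (Inf K)\<bar> + c * (Sup K - Inf K))"
    using pD(1) by (intro sum.mono_neutral_cong_right) (auto simp: B_def split: if_splits)
  also have "\<dots> = (\<Sum>(x, y)\<in>J ` B. \<bar>f y - f x\<bar>) + c * (\<Sum>(x, y)\<in>J ` B. y - x)"
    unfolding reind[of "\<lambda>u v. \<bar>f v - f u\<bar>", symmetric] reind[of "\<lambda>u v. v - u", symmetric]
    by (simp add: sum.distrib sum_distrib_left case_prod_unfold)
  also have "\<dots> \<le> e / 4 + e / 4"
  proof (rule add_mono)
    have "c * (\<Sum>(x, y)\<in>J ` B. y - x) \<le> c * \<delta>'" using len c by (intro mult_left_mono) auto
    then show "c * (\<Sum>(x, y)\<in>J ` B. y - x) \<le> e / 4" using \<delta>'(3) by linarith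
  qed (use small in simp)
  finally show "f b - f a \<le> U * (b - a) + e" using \<eta>(2) by (simp add: algebra_simps)
qed

lemma absolutely_continuous_growth_bounds:
  assumes ac: "absolutely_continuous_on 0 b f" and ab: "0 \<le> a" "a \<le> b"
    and der: "AE t in lborel. a \<le> t \<and> t \<le> b \<longrightarrow>
       (\<exists>D. (f has_real_derivative D) (at t within {0..}) \<and> L \<le> D \<and> D \<le> U)"
  shows "L * (b - a) \<le> f b - f a" "f b - f a \<le> U * (b - a)"
proof -
  show "f b - f a \<le> U * (b - a)"
    by (rule absolutely_continuous_growth_le[OF ac ab]) (use der in \<open>eventually_elim, blast\<close>)
  have "- f b - - f a \<le> - L * (b - a)"
  proof (rule absolutely_continuous_growth_le[OF _ ab])
    have "\<bar>- f y - - f x\<bar> = \<bar>f y - f x\<bar>" for x y by simp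
    then show "absolutely_continuous_on 0 b (\<lambda>t. - f t)" using ac unfolding absolutely_continuous_on_def by simp
    show "AE t in lborel. a \<le> t \<and> t \<le> b \<longrightarrow>
       (\<exists>D. ((\<lambda>t. - f t) has_real_derivative D) (at t within {0..}) \<and> D \<le> - L)"
      using der
    proof eventually_elim
      case (elim t)
      show ?case
      proof
        assume "a \<le> t \<and> t \<le> b"
        then obtain D where "(f has_real_derivative D) (at t within {0..})" "L \<le> D" using elim by blast
        then show "\<exists>D. ((\<lambda>t. - f t) has_real_derivative D) (at t within {0..}) \<and> D \<le> - L"
          by (intro exI[of _ "- D"] conjI DERIV_minus) auto
      qed
    qed
  qed
  then show "L * (b - a) \<le> f b - f a" by simp
qed

section \<open>Quadratic variation along dyadic grids\<close>

text \<open>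
  The grid points \<open>i / 2\<^sup>k\<close> do not depend on \<open>r\<close>, and an incomplete last cell is dropped. This makes the
  sum nondecreasing in \<open>r\<close>; at dyadic \<open>r\<close> and large \<open>k\<close> it is the sum over a partition of \<open>[0, r]\<close>.
\<close>

definition dyadic_sq :: "(real \<Rightarrow> real) \<Rightarrow> nat \<Rightarrow> real \<Rightarrow> real" where
  "dyadic_sq f k r = (\<Sum>i<nat \<lfloor>r * 2 ^ k\<rfloor>. (f (real (Suc i) / 2 ^ k) - f (real i / 2 ^ k))\<^sup>2)"

lemma dyadic_sq_mono: "r \<le> s \<Longrightarrow> dyadic_sq f k r \<le> dyadic_sq f k s"
  unfolding dyadic_sq_def by (intro sum_mono2) (auto intro!: nat_mono floor_mono mult_right_mono)

lemma dyadic_in_interval: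
  assumes "0 \<le> a" "a < b"
  obtains j l :: nat where "a < real j / 2 ^ l" "real j / 2 ^ l < b"
proof -
  obtain l :: nat where l: "1 / (b - a) < 2 ^ l" using real_arch_pow[of 2 "1 / (b - a)"] by auto
  then have gap: "1 < (b - a) * 2 ^ l" using assms by (simp add: divide_simps mult.commute)
  define j where "j = nat (\<lfloor>a * 2 ^ l\<rfloor> + 1)"
  have j: "real j = real_of_int \<lfloor>a * 2 ^ l\<rfloor> + 1" using assms by (simp add: j_def)
  have "a * 2 ^ l < real j" "real j \<le> a * 2 ^ l + 1" unfolding j by linarith+
  moreover have "a * 2 ^ l + 1 < b * 2 ^ l" using gap by (simp add: algebra_simps)
  ultimately show ?thesis by (intro that[of j l]) (auto simp: pos_less_divide_eq pos_divide_less_eq)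
qed

text \<open>
  Convergence at the dyadic points spreads to all times because both sides are monotone in time
  and the limit is continuous.
\<close>

lemma dyadic_sq_tendsto:
  assumes lim: "\<And>j l. (\<lambda>m. dyadic_sq f (\<kappa> m) (real j / 2 ^ l)) \<longlonglongrightarrow> A (real j / 2 ^ l)"
    and A: "continuous_on {0..} A" and r: "0 \<le> r"
  shows "(\<lambda>m. dyadic_sq f (\<kappa> m) r) \<longlonglongrightarrow> A r"
proof (rule LIMSEQ_I)
  fix e :: real assume e: "0 < e"
  from A[unfolded continuous_on_iff, rule_format, of r "e / 2"] r e
  obtain d where d: "d > 0" "\<And>x. 0 \<le> x \<Longrightarrow> \<bar>x - r\<bar> < d \<Longrightarrow> \<bar>A x - A r\<bar> < e / 2"
    by (auto simp: dist_real_def)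
  obtain j l where q: "r < real j / 2 ^ l" "real j / 2 ^ l < r + d"
    using dyadic_in_interval[of r "r + d"] r d(1) by auto
  have up: "eventually (\<lambda>m. dyadic_sq f (\<kappa> m) r < A r + e) sequentially"
  proof -
    have "\<bar>A (real j / 2 ^ l) - A r\<bar> < e / 2" using q r by (intro d(2)) auto
    then have "A (real j / 2 ^ l) < A r + e" using e by linarith
    from order_tendstoD(2)[OF lim this]
    show ?thesis
      by eventually_elim (rule le_less_trans[OF dyadic_sq_mono], use q in auto)
  qed
  have "\<exists>j l. real j / 2 ^ l \<le> r \<and> \<bar>A (real j / 2 ^ l) - A r\<bar> < e"
  proof (cases "r = 0")
    case True then show ?thesis using e by (intro exI[of _ 0]) simp
  next
    case False
    obtain j l where "max 0 (r - d) < real j / 2 ^ l" "real j / 2 ^ l < r"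
      using dyadic_in_interval[of "max 0 (r - d)" r] r False d(1) by auto
    then have "\<bar>A (real j / 2 ^ l) - A r\<bar> < e / 2" "real j / 2 ^ l \<le> r"
      using d(2)[of "real j / 2 ^ l"] by auto
    then show ?thesis using e by (intro exI[of _ j] exI[of _ l]) linarith
  qed
  then obtain j' l' where p: "real j' / 2 ^ l' \<le> r" "\<bar>A (real j' / 2 ^ l') - A r\<bar> < e" by blast
  have lo: "eventually (\<lambda>m. A r - e < dyadic_sq f (\<kappa> m) r) sequentially"
  proof -
    have "A r - e < A (real j' / 2 ^ l')" using p by linarith
    from order_tendstoD(1)[OF lim this]
    show ?thesis
      by eventually_elim (rule less_le_trans[OF _ dyadic_sq_mono], use p in auto)
  qed
  from up lo have "eventually (\<lambda>m. norm (dyadic_sq f (\<kappa> m) r - A r) < e) sequentially"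
    by eventually_elim auto
  then show "\<exists>no. \<forall>n\<ge>no. norm (dyadic_sq f (\<kappa> n) r - A r) < e" by (simp add: eventually_sequentially)
qed

definition clip :: "real \<Rightarrow> real \<Rightarrow> real \<Rightarrow> real" where
  "clip a b t = max a (min b t)"

text \<open>
  Squared increments of the path frozen outside \<open>[a, b]\<close>. Only the two grid cells that contain
  \<open>a\<close> and \<open>b\<close> contribute differently from the unfrozen path, and there the increments are
  uniformly small.
\<close>

lemma clipped_sq_tendsto:
  fixes f :: "real \<Rightarrow> real" and N :: nat
  assumes f: "continuous_on {0..} f" and A: "continuous_on {0..} A"
    and lim: "\<And>j l. (\<lambda>m. dyadic_sq f (\<kappa> m) (real j / 2 ^ l)) \<longlonglongrightarrow> A (real j / 2 ^ l)"
    and \<kappa>: "\<And>m. m \<le> \<kappa> m" and ab: "0 \<le> a" "a \<le> b" "b \<le> real N"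
  shows "(\<lambda>m. \<Sum>i<N * 2 ^ \<kappa> m. (f (clip a b (real (Suc i) / 2 ^ \<kappa> m)) - f (clip a b (real i / 2 ^ \<kappa> m)))\<^sup>2)
     \<longlonglongrightarrow> A b - A a"
proof -
  let ?C = "\<lambda>k. \<Sum>i<N * 2 ^ k. (f (clip a b (real (Suc i) / 2 ^ k)) - f (clip a b (real i / 2 ^ k)))\<^sup>2"
  let ?V = "\<lambda>k. dyadic_sq f k b - dyadic_sq f k a"
  have V: "(\<lambda>m. ?V (\<kappa> m)) \<longlonglongrightarrow> A b - A a"
    using ab by (intro tendsto_diff dyadic_sq_tendsto[OF lim A]) auto
  have "(\<lambda>m. ?C (\<kappa> m) - ?V (\<kappa> m)) \<longlonglongrightarrow> 0"
  proof (rule LIMSEQ_I)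
    fix e :: real assume e: "0 < e"
    define \<epsilon> where "\<epsilon> = min 1 (e / 4)"
    have \<epsilon>: "0 < \<epsilon>" "2 * \<epsilon>\<^sup>2 < e"
    proof -
      show "0 < \<epsilon>" using e by (simp add: \<epsilon>_def)
      have "\<epsilon> * \<epsilon> \<le> \<epsilon> * 1" using e by (intro mult_left_mono) (auto simp: \<epsilon>_def)
      then have "\<epsilon>\<^sup>2 \<le> \<epsilon>" by (simp add: power2_eq_square)
      also have "\<epsilon> \<le> e / 4" by (simp add: \<epsilon>_def)
      finally show "2 * \<epsilon>\<^sup>2 < e" using e by linarith
    qed
    have "uniformly_continuous_on {0..real N + 1} f"
      by (rule compact_uniformly_continuous[OF continuous_on_subset[OF f]]) auto
    then obtain d where d: "d > 0"
      "\<And>x y. x \<in> {0..real N + 1} \<Longrightarrow> y \<in> {0..real N + 1} \<Longrightarrow> \<bar>y - x\<bar> < d \<Longrightarrow> \<bar>f y - f x\<bar> < \<epsilon>"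
      using \<epsilon>(1) unfolding uniformly_continuous_on_def dist_real_def by meson
    obtain M :: nat where M: "1 / d < 2 ^ M" using real_arch_pow[of 2 "1 / d"] by auto
    have main: "\<bar>?C k - ?V k\<bar> < e" if kM: "M \<le> k" for k
    proof -
      have "(2::real) ^ M \<le> 2 ^ k" using kM by (rule power_increasing) simp
      then have "1 / d < 2 ^ k" using M by linarith
      then have mesh: "1 / 2 ^ k < d" using d(1) by (simp add: divide_simps mult.commute)
      define ia where "ia = nat \<lfloor>a * 2 ^ k\<rfloor>"
      define ib where "ib = nat \<lfloor>b * 2 ^ k\<rfloor>"
      let ?t = "\<lambda>i. real i / 2 ^ k"
      let ?\<delta> = "\<lambda>i. (f (?t (Suc i)) - f (?t i))\<^sup>2"
      let ?c = "\<lambda>i. (f (clip a b (?t (Suc i))) - f (clip a b (?t i)))\<^sup>2"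
      let ?e = "\<lambda>i. if ia \<le> i \<and> i < ib then ?\<delta> i else 0"
      have iab: "ia \<le> ib" unfolding ia_def ib_def using ab by (intro nat_mono floor_mono mult_right_mono) auto
      have "b * 2 ^ k \<le> real (N * 2 ^ k)" using ab by (simp add: mult_right_mono)
      then have ibN: "ib \<le> N * 2 ^ k" unfolding ib_def by linarith
      have "?V k = (\<Sum>i<ib. ?\<delta> i) - (\<Sum>i<ia. ?\<delta> i)" by (simp add: dyadic_sq_def ia_def ib_def)
      also have "\<dots> = (\<Sum>i\<in>{ia..<ib}. ?\<delta> i)"
        using sum.atLeastLessThan_concat[of 0 ia ib ?\<delta>] iab by (simp add: atLeast0LessThan)
      also have "\<dots> = (\<Sum>i<N * 2 ^ k. ?e i)"
        using ibN by (intro sum.mono_neutral_cong_left) auto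
      finally have Ve: "?V k = (\<Sum>i<N * 2 ^ k. ?e i)" .
      have small: "(f y - f x)\<^sup>2 \<le> \<epsilon>\<^sup>2"
        if "x \<in> {0..real N + 1}" "y \<in> {0..real N + 1}" "\<bar>y - x\<bar> \<le> 1 / 2 ^ k" for x y
      proof -
        have "\<bar>f y - f x\<bar> \<le> \<epsilon>" using d(2)[OF that(1,2)] that(3) mesh by linarith
        then have "\<bar>f y - f x\<bar>\<^sup>2 \<le> \<epsilon>\<^sup>2" by (intro power_mono) auto
        then show ?thesis by simp
      qed
      have cl_range: "clip a b x \<in> {0..real N + 1}" for x using ab by (auto simp: clip_def)
      have cl_lip: "\<bar>clip a b y - clip a b x\<bar> \<le> \<bar>y - x\<bar>" for x y by (auto simp: clip_def)
      have step: "?t (Suc i) - ?t i = 1 / 2 ^ k" for i by (simp add: diff_divide_distrib[symmetric])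
      have c_small: "?c i \<le> \<epsilon>\<^sup>2" for i
        using cl_lip[of "?t (Suc i)" "?t i"] step[of i] by (intro small cl_range) simp
      have e_small: "?e i \<le> \<epsilon>\<^sup>2" for i
      proof (cases "ia \<le> i \<and> i < ib")
        case True
        then have "real (Suc i) \<le> real ib" by simp
        also have "real ib \<le> b * 2 ^ k" unfolding ib_def using ab by simp
        finally have "?t (Suc i) \<le> b" by (simp add: pos_divide_le_eq)
        moreover have "?t i \<le> ?t (Suc i)" by (simp add: divide_right_mono)
        ultimately have "?t i \<in> {0..real N + 1}" "?t (Suc i) \<in> {0..real N + 1}" using ab by auto
        then show ?thesis using True step[of i] by (simp, intro small) auto
      next
        case False
        then have "?e i = 0" by (rule if_not_P)
        then show ?thesis by (simp only: zero_le_power2)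
      qed
      have same: "?c i = ?e i" if i: "i \<noteq> ia" "i \<noteq> ib" for i
      proof -
        consider "i < ia" | "ia < i" "i < ib" | "ib < i" using i by linarith
        then show ?thesis
        proof cases
          case 1
          then have "real (Suc i) \<le> real ia" by simp
          also have "real ia \<le> a * 2 ^ k" unfolding ia_def using ab by simp
          finally have "?t (Suc i) \<le> a" by (simp add: pos_divide_le_eq)
          moreover have "?t i \<le> ?t (Suc i)" by (simp add: divide_right_mono)
          ultimately show ?thesis using 1 ab by (auto simp: clip_def)
        next
          case 2
          then have "real ia + 1 \<le> real i" "real (Suc i) \<le> real ib" by auto
          moreover have "a * 2 ^ k \<le> real ia + 1" unfolding ia_def using ab by linarith
          moreover have "real ib \<le> b * 2 ^ k" unfolding ib_def using ab by simp
          ultimately have "a \<le> ?t i" "?t (Suc i) \<le> b" by (auto simp: pos_divide_le_eq pos_le_divide_eq)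
          moreover have "?t i \<le> ?t (Suc i)" by (simp add: divide_right_mono)
          ultimately show ?thesis using 2 by (auto simp: clip_def)
        next
          case 3
          then have "real ib + 1 \<le> real i" by simp
          moreover have "b * 2 ^ k \<le> real ib + 1" unfolding ib_def using ab by linarith
          ultimately have "b \<le> ?t i" by (simp add: pos_le_divide_eq)
          moreover have "?t i \<le> ?t (Suc i)" by (simp add: divide_right_mono)
          ultimately show ?thesis using 3 ab iab by (auto simp: clip_def)
        qed
      qed
      have "\<bar>?C k - ?V k\<bar> = \<bar>\<Sum>i<N * 2 ^ k. ?c i - ?e i\<bar>" unfolding Ve by (simp add: sum_subtractf)
      also have "(\<Sum>i<N * 2 ^ k. ?c i - ?e i) = (\<Sum>i\<in>{..<N * 2 ^ k} \<inter> {ia, ib}. ?c i - ?e i)"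
        using same by (intro sum.mono_neutral_right) auto
      also have "\<bar>\<dots>\<bar> \<le> (\<Sum>i\<in>{..<N * 2 ^ k} \<inter> {ia, ib}. \<bar>?c i - ?e i\<bar>)" by (rule sum_abs)
      also have "\<dots> \<le> (\<Sum>i\<in>{..<N * 2 ^ k} \<inter> {ia, ib}. \<epsilon>\<^sup>2)"
      proof (rule sum_mono)
        fix i
        have "0 \<le> ?c i" "0 \<le> ?e i" by auto
        then show "\<bar>?c i - ?e i\<bar> \<le> \<epsilon>\<^sup>2" using c_small[of i] e_small[of i] by linarith
      qed
      also have "\<dots> \<le> 2 * \<epsilon>\<^sup>2"
      proof -
        have "card ({..<N * 2 ^ k} \<inter> {ia, ib}) \<le> card {ia, ib}" by (intro card_mono) auto
        also have "\<dots> \<le> 2" by (cases "ia = ib") auto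
        finally have "real (card ({..<N * 2 ^ k} \<inter> {ia, ib})) \<le> 2" by simp
        then show ?thesis by (simp add: mult_right_mono)
      qed
      also have "\<dots> < e" by (rule \<epsilon>(2))
      finally show ?thesis .
    qed
    show "\<exists>no. \<forall>m\<ge>no. norm (?C (\<kappa> m) - ?V (\<kappa> m) - 0) < e"
      using main \<kappa> by (intro exI[of _ M]) (auto intro: order_trans)
  qed
  from tendsto_add[OF this V] show ?thesis by simp
qed

text \<open>
  Convergence in probability at each of the countably many dyadic times becomes almost sure
  convergence at all of them along one subsequence, by a diagonal choice and Borel-Cantelli.
\<close>

lemma (in prob_space) quadratic_variation_subsequence:
  assumes qv: "is_quadratic_variation M X A"
    and X: "\<And>t. 0 \<le> t \<Longrightarrow> X t \<in> borel_measurable M"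
  obtains \<kappa> :: "nat \<Rightarrow> nat" where "\<And>m. m \<le> \<kappa> m"
    "AE \<omega> in M. \<forall>j l. (\<lambda>m. dyadic_sq (\<lambda>t. X t \<omega>) (\<kappa> m) (real j / 2 ^ l)) \<longlonglongrightarrow> A (real j / 2 ^ l) \<omega>"
proof -
  have A [measurable]: "A t \<in> borel_measurable M" if "0 \<le> t" for t
    using qv that unfolding is_quadratic_variation_def by blast
  let ?V = "\<lambda>k r \<omega>. dyadic_sq (\<lambda>t. X t \<omega>) k r"
  have Vm [measurable]: "?V k r \<in> borel_measurable M" for k r
    unfolding dyadic_sq_def by (intro borel_measurable_sum borel_measurable_power borel_measurable_diff X) auto
  let ?r = "\<lambda>e. real (fst (prod_decode e)) / 2 ^ snd (prod_decode e)"
  have conv: "\<exists>k0. \<forall>k\<ge>k0. measure M {\<omega>\<in>space M. \<epsilon> < \<bar>?V k (?r e) \<omega> - A (?r e) \<omega>\<bar>} < \<eta>"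
    if \<epsilon>\<eta>: "0 < \<epsilon>" "0 < \<eta>" for e and \<epsilon> \<eta> :: real
  proof -
    obtain j l where jl: "prod_decode e = (j, l)" by (cases "prod_decode e")
    have r0: "0 \<le> real j / 2 ^ l" by simp
    obtain \<delta> where \<delta>: "\<delta> > 0" "\<And>m \<pi>. is_partition (real j / 2 ^ l) \<delta> m \<pi> \<Longrightarrow>
        measure M {\<omega> \<in> space M. \<epsilon> < \<bar>(\<Sum>i<m. (X (\<pi> (Suc i)) \<omega> - X (\<pi> i) \<omega>)\<^sup>2) - A (real j / 2 ^ l) \<omega>\<bar>} < \<eta>"
      using qv \<epsilon>\<eta> r0 unfolding is_quadratic_variation_def by meson
    obtain k1 :: nat where k1: "1 / \<delta> < 2 ^ k1" using real_arch_pow[of 2 "1 / \<delta>"] by auto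
    show ?thesis
    proof (intro exI[of _ "max l k1"] allI impI)
      fix k assume k: "max l k1 \<le> k"
      have "(2::real) ^ k1 \<le> 2 ^ k" using k by (intro power_increasing) auto
      then have "1 / \<delta> < 2 ^ k" using k1 by linarith
      then have mesh: "1 / 2 ^ k < \<delta>" using \<delta>(1) by (simp add: divide_simps mult.commute)
      have pw: "(2::real) ^ k = 2 ^ (k - l) * 2 ^ l" using k by (simp add: power_add[symmetric])
      have "real j / 2 ^ l * 2 ^ k = real (j * 2 ^ (k - l))" unfolding pw by simp
      then have idx: "nat \<lfloor>real j / 2 ^ l * 2 ^ k\<rfloor> = j * 2 ^ (k - l)" by (metis floor_of_nat nat_int)
      have "is_partition (real j / 2 ^ l) \<delta> (j * 2 ^ (k - l)) (\<lambda>i. real i / 2 ^ k)"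
        unfolding is_partition_def
      proof (intro conjI allI impI)
        show "real (j * 2 ^ (k - l)) / 2 ^ k = real j / 2 ^ l" unfolding pw by simp
        show "real (Suc i) / 2 ^ k - real i / 2 ^ k < \<delta>" for i
          using mesh by (simp add: diff_divide_distrib[symmetric])
      qed (auto simp: divide_right_mono)
      from \<delta>(2)[OF this]
      show "measure M {\<omega>\<in>space M. \<epsilon> < \<bar>?V k (?r e) \<omega> - A (?r e) \<omega>\<bar>} < \<eta>"
        unfolding jl fst_conv snd_conv dyadic_sq_def idx .
    qed
  qed
  \<comment> \<open>at stage \<open>m\<close> only the first \<open>m + 1\<close> dyadic times are controlled, each with error probability \<open>2\<^bsup>-m\<^esup> / (m + 1)\<close>\<close>
  let ?Bad = "\<lambda>m k. \<Union>e\<le>m. {\<omega>\<in>space M. (1/2) ^ m < \<bar>?V k (?r e) \<omega> - A (?r e) \<omega>\<bar>}"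
  have "\<exists>k\<ge>m. measure M (?Bad m k) \<le> (1/2) ^ m" for m :: nat
  proof -
    have pos: "0 < (1/2 :: real) ^ m" "0 < (1/2 :: real) ^ m / real (Suc m)" by auto
    have "\<forall>e. \<exists>k0. \<forall>k\<ge>k0. measure M {\<omega>\<in>space M. (1/2) ^ m < \<bar>?V k (?r e) \<omega> - A (?r e) \<omega>\<bar>} < (1/2) ^ m / real (Suc m)"
      using conv[OF pos] by blast
    from choice[OF this] obtain k0 where k0': "\<forall>e. \<forall>k\<ge>k0 e.
      measure M {\<omega>\<in>space M. (1/2) ^ m < \<bar>?V k (?r e) \<omega> - A (?r e) \<omega>\<bar>} < (1/2) ^ m / real (Suc m)"
      by (rule exE)
    have k0: "measure M {\<omega>\<in>space M. (1/2) ^ m < \<bar>?V k (?r e) \<omega> - A (?r e) \<omega>\<bar>} < (1/2) ^ m / real (Suc m)"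
      if "k0 e \<le> k" for e k using k0' that by simp
    define k where "k = m + (\<Sum>e\<le>m. k0 e)"
    have "measure M (?Bad m k) \<le> (\<Sum>e\<le>m. measure M {\<omega>\<in>space M. (1/2) ^ m < \<bar>?V k (?r e) \<omega> - A (?r e) \<omega>\<bar>})"
      by (intro finite_measure_subadditive_finite) auto
    also have "\<dots> \<le> (\<Sum>e\<le>m. (1/2) ^ m / real (Suc m))"
    proof (rule sum_mono, rule less_imp_le, rule k0)
      fix e assume "e \<in> {..m}"
      then have "k0 e \<le> (\<Sum>e\<le>m. k0 e)" by (intro member_le_sum) auto
      then show "k0 e \<le> k" by (simp add: k_def)
    qed
    also have "\<dots> = (1/2) ^ m" by simp
    finally show ?thesis by (intro exI[of _ k]) (simp add: k_def)
  qed
  then have "\<forall>m. \<exists>k\<ge>m. measure M (?Bad m k) \<le> (1/2) ^ m" by blast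
  from choice[OF this] obtain \<kappa> where \<kappa>': "\<forall>m. m \<le> \<kappa> m \<and> measure M (?Bad m (\<kappa> m)) \<le> (1/2) ^ m"
    by (rule exE)
  have \<kappa>: "m \<le> \<kappa> m" "measure M (?Bad m (\<kappa> m)) \<le> (1/2) ^ m" for m
    using spec[OF \<kappa>', of m] by (rule conjunct1, rule conjunct2)
  have "AE \<omega> in M. eventually (\<lambda>m. \<omega> \<in> space M - ?Bad m (\<kappa> m)) sequentially"
  proof (rule borel_cantelli_AE1)
    show "?Bad m (\<kappa> m) \<in> sets M" for m by measurable
    show "emeasure M (?Bad m (\<kappa> m)) < \<infinity>" for m by (simp add: less_top[symmetric])
    show "summable (\<lambda>m. measure M (?Bad m (\<kappa> m)))"
      by (rule summable_comparison_test'[OF summable_geometric[of "1/2 :: real"]]) (use \<kappa>(2) in auto)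
  qed
  then have "AE \<omega> in M. \<forall>j l. (\<lambda>m. ?V (\<kappa> m) (real j / 2 ^ l) \<omega>) \<longlonglongrightarrow> A (real j / 2 ^ l) \<omega>"
  proof eventually_elim
    case (elim \<omega>)
    show ?case
    proof (intro allI)
      fix j l
      define e where "e = prod_encode (j, l)"
      have re: "?r e = real j / 2 ^ l" by (simp add: e_def)
      have "eventually (\<lambda>m. norm (?V (\<kappa> m) (?r e) \<omega> - A (?r e) \<omega>) \<le> (1/2) ^ m) sequentially"
        using elim eventually_ge_at_top[of e]
      proof eventually_elim
        case (elim m)
        show ?case
        proof (rule ccontr)
          assume "\<not> ?case"
          then have "\<omega> \<in> {\<omega>\<in>space M. (1/2) ^ m < \<bar>?V (\<kappa> m) (?r e) \<omega> - A (?r e) \<omega>\<bar>}"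
            using DiffD1[OF elim(1)] by (simp only: real_norm_def not_le mem_Collect_eq)
          note bad = this
          have em: "e \<in> {..m}" using elim(2) by simp
          have "\<omega> \<in> ?Bad m (\<kappa> m)" by (rule UN_I[of e], rule em, rule bad)
          then show False by (rule DiffD2[OF elim(1)])
        qed
      qed
      moreover have "(\<lambda>m. (1/2 :: real) ^ m) \<longlonglongrightarrow> 0" by (rule LIMSEQ_realpow_zero) auto
      ultimately have "(\<lambda>m. ?V (\<kappa> m) (?r e) \<omega> - A (?r e) \<omega>) \<longlonglongrightarrow> 0"
        by (rule Lim_null_comparison)
      then have "(\<lambda>m. ?V (\<kappa> m) (?r e) \<omega>) \<longlonglongrightarrow> A (?r e) \<omega>" by (rule LIM_zero_cancel)
      then show "(\<lambda>m. ?V (\<kappa> m) (real j / 2 ^ l) \<omega>) \<longlonglongrightarrow> A (real j / 2 ^ l) \<omega>" unfolding re .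
    qed
  qed
  with \<kappa>(1) show ?thesis by (rule that)
qed

section \<open>Comparison and intermediate values under conditioning\<close>

text \<open>
  Test the inequality on the event where it fails.
\<close>

lemma (in prob_space) AE_le_of_set_integrals:
  fixes f g :: "'a \<Rightarrow> real"
  assumes sub: "subalgebra M F" and meas: "f \<in> borel_measurable F" "g \<in> borel_measurable F"
    and int: "integrable M f" "integrable M g"
    and le: "\<And>H. H \<in> sets F \<Longrightarrow> (\<integral>x. indicator H x * f x \<partial>M) \<le> (\<integral>x. indicator H x * g x \<partial>M)"
  shows "AE x in M. f x \<le> g x"
proof -
  note [measurable] = meas
  define H where "H = {x \<in> space F. g x < f x}"
  have HF: "H \<in> sets F" unfolding H_def by measurable
  then have [measurable]: "H \<in> sets M" using sub unfolding subalgebra_def by blast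
  have i: "integrable M (\<lambda>x. indicator H x * f x)" "integrable M (\<lambda>x. indicator H x * g x)"
    using integrable_mult_indicator[OF \<open>H \<in> sets M\<close> int(1)] integrable_mult_indicator[OF \<open>H \<in> sets M\<close> int(2)] by auto
  have nn: "AE x in M. 0 \<le> indicator H x * f x - indicator H x * g x"
    by (auto simp: H_def indicator_def)
  have "(\<integral>x. indicator H x * f x - indicator H x * g x \<partial>M) \<le> 0"
    using le[OF HF] by (subst Bochner_Integration.integral_diff[OF i]) simp
  moreover have "0 \<le> (\<integral>x. indicator H x * f x - indicator H x * g x \<partial>M)"
    by (rule integral_nonneg_AE[OF nn])
  ultimately have "AE x in M. indicator H x * f x - indicator H x * g x = 0"
    using integral_nonneg_eq_0_iff_AE[OF Bochner_Integration.integrable_diff[OF i] nn] by simp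
  then show ?thesis using AE_space
  proof eventually_elim
    case (elim x)
    then show ?case using sub by (cases "x \<in> H") (auto simp: H_def subalgebra_def)
  qed
qed

text \<open>
  Bisection, carried out simultaneously at all \<open>\<omega>\<close>: at each stage the half of the current
  interval is selected according to whether the conditional expectation at the midpoint is
  below or above \<open>z\<close>, which is an event of \<open>F\<close>. The Lipschitz bound makes the two ends meet.
\<close>

lemma (in prob_space) conditional_intermediate_value:
  fixes d :: "real \<Rightarrow> 'a \<Rightarrow> ennreal" and z C :: real
  assumes sub: "subalgebra M F"
    and meas: "\<And>x. x \<in> borel_measurable F \<Longrightarrow> (\<And>\<omega>. \<omega> \<in> space M \<Longrightarrow> x \<omega> \<in> {0..1}) \<Longrightarrow> (\<lambda>\<omega>. d (x \<omega>) \<omega>) \<in> borel_measurable M"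
    and lip: "\<And>x y \<epsilon> H. x \<in> borel_measurable F \<Longrightarrow> y \<in> borel_measurable F \<Longrightarrow>
        (\<And>\<omega>. \<omega> \<in> space M \<Longrightarrow> 0 \<le> x \<omega> \<and> x \<omega> \<le> y \<omega> \<and> y \<omega> \<le> 1 \<and> y \<omega> \<le> x \<omega> + \<epsilon>) \<Longrightarrow> H \<in> sets F \<Longrightarrow>
        (\<integral>\<^sup>+\<omega>\<in>H. d (y \<omega>) \<omega> \<partial>M) \<le> (\<integral>\<^sup>+\<omega>\<in>H. d (x \<omega>) \<omega> \<partial>M) + ennreal (C * \<epsilon>)"
    and lower: "\<And>H. H \<in> sets F \<Longrightarrow> (\<integral>\<^sup>+\<omega>\<in>H. d 0 \<omega> \<partial>M) \<le> ennreal z * emeasure M H"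
    and upper: "\<And>H. H \<in> sets F \<Longrightarrow> ennreal z * emeasure M H \<le> (\<integral>\<^sup>+\<omega>\<in>H. d 1 \<omega> \<partial>M)"
  obtains x where "x \<in> borel_measurable F" "\<And>\<omega>. \<omega> \<in> space M \<Longrightarrow> x \<omega> \<in> {0..1}"
    "\<And>H. H \<in> sets F \<Longrightarrow> (\<integral>\<^sup>+\<omega>\<in>H. d (x \<omega>) \<omega> \<partial>M) = ennreal z * emeasure M H"
proof -
  interpret fs: finite_measure_subalgebra M F by unfold_locales (rule sub)
  have spF: "space F = space M" and setsF: "\<And>H. H \<in> sets F \<Longrightarrow> H \<in> sets M" using sub by (auto simp: subalgebra_def)
  let ?I = "\<lambda>x H. \<integral>\<^sup>+\<omega>\<in>H. d (x \<omega>) \<omega> \<partial>M"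
  \<comment> \<open>\<open>z\<close> is between the conditional expectations at the two ends of the current interval of length \<open>2\<^bsup>-k\<^esup>\<close>\<close>
  define good where "good = (\<lambda>k (x :: 'a \<Rightarrow> real). x \<in> borel_measurable F \<and> (\<forall>\<omega>\<in>space M. 0 \<le> x \<omega> \<and> x \<omega> + (1/2)^k \<le> 1) \<and>
     (\<forall>H\<in>sets F. ?I x H \<le> ennreal z * emeasure M H \<and> ennreal z * emeasure M H \<le> ?I (\<lambda>\<omega>. x \<omega> + (1/2)^k) H))"
  have start: "good 0 (\<lambda>_. 0)" unfolding good_def using lower upper by simp
  have step: "\<exists>y. good (Suc k) y \<and> (\<forall>\<omega>\<in>space M. x \<omega> \<le> y \<omega> \<and> y \<omega> + (1/2)^Suc k \<le> x \<omega> + (1/2)^k)"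
    if x: "good k x" for k x
  proof -
    let ?h = "(1/2 :: real)^Suc k"
    have h2: "(1/2 :: real)^k = ?h + ?h" by simp
    have xF [measurable]: "x \<in> borel_measurable F" and xb: "\<And>\<omega>. \<omega> \<in> space M \<Longrightarrow> 0 \<le> x \<omega> \<and> x \<omega> + (?h + ?h) \<le> 1"
      using x unfolding good_def h2 by auto
    have hpos: "0 < ?h" by simp
    let ?m = "\<lambda>\<omega>. d (x \<omega> + ?h) \<omega>"
    have dx: "(\<lambda>\<omega>. d (x \<omega>) \<omega>) \<in> borel_measurable M"
    proof (rule meas)
      show "x \<in> borel_measurable F" by (rule xF)
      show "x \<omega> \<in> {0..1}" if "\<omega> \<in> space M" for \<omega> using xb[OF that] hpos unfolding atLeastAtMost_iff by linarith
    qed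
    have dm [measurable]: "?m \<in> borel_measurable M"
    proof (rule meas)
      show "(\<lambda>\<omega>. x \<omega> + ?h) \<in> borel_measurable F" by measurable
      show "x \<omega> + ?h \<in> {0..1}" if "\<omega> \<in> space M" for \<omega> using xb[OF that] hpos unfolding atLeastAtMost_iff by linarith
    qed
    have dt: "(\<lambda>\<omega>. d (x \<omega> + (?h + ?h)) \<omega>) \<in> borel_measurable M"
    proof (rule meas)
      show "(\<lambda>\<omega>. x \<omega> + (?h + ?h)) \<in> borel_measurable F" by measurable
      show "x \<omega> + (?h + ?h) \<in> {0..1}" if "\<omega> \<in> space M" for \<omega> using xb[OF that] hpos unfolding atLeastAtMost_iff by linarith
    qed
    let ?e = "nn_cond_exp M F ?m"
    have eF [measurable]: "?e \<in> borel_measurable F" by simp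
    have eint: "(\<integral>\<^sup>+\<omega>\<in>H. ?m \<omega> \<partial>M) = (\<integral>\<^sup>+\<omega>\<in>H. ?e \<omega> \<partial>M)" if "H \<in> sets F" for H
    proof -
      have "(\<integral>\<^sup>+\<omega>. indicator H \<omega> * ?e \<omega> \<partial>M) = (\<integral>\<^sup>+\<omega>. indicator H \<omega> * ?m \<omega> \<partial>M)"
        by (rule fs.nn_cond_exp_intg[OF _ dm]) (use that in measurable)
      then show ?thesis by (simp only: mult.commute[of _ "indicator H _"])
    qed
    define G where "G = {\<omega> \<in> space F. ?e \<omega> \<le> ennreal z}"
    have GF [measurable]: "G \<in> sets F" unfolding G_def by measurable
    define y where "y = (\<lambda>\<omega>. x \<omega> + indicator G \<omega> * ?h)"
    have yF: "y \<in> borel_measurable F" unfolding y_def by measurable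
    have split: "(\<integral>\<^sup>+\<omega>\<in>H. (if \<omega> \<in> G then f \<omega> else g \<omega>) \<partial>M) = (\<integral>\<^sup>+\<omega>\<in>H \<inter> G. f \<omega> \<partial>M) + (\<integral>\<^sup>+\<omega>\<in>H - G. g \<omega> \<partial>M)"
      if "H \<in> sets F" "f \<in> borel_measurable M" "g \<in> borel_measurable M" for H and f g :: "'a \<Rightarrow> ennreal"
    proof -
      have [measurable]: "H \<in> sets M" "G \<in> sets M" using setsF that(1) GF by auto
      note [measurable] = that(2,3)
      show ?thesis
        by (subst nn_integral_add[symmetric]) (auto intro!: nn_integral_cong simp: indicator_def)
    qed
    have Hsplit: "ennreal z * emeasure M H = ennreal z * emeasure M (H \<inter> G) + ennreal z * emeasure M (H - G)"
      if "H \<in> sets F" for H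
    proof -
      have "emeasure M (H \<inter> G) + emeasure M (H - G) = emeasure M ((H \<inter> G) \<union> (H - G))"
        using setsF that GF by (intro plus_emeasure) auto
      also have "(H \<inter> G) \<union> (H - G) = H" by auto
      finally show ?thesis by (simp only: distrib_left[symmetric])
    qed
    have below: "(\<integral>\<^sup>+\<omega>\<in>H \<inter> G. ?m \<omega> \<partial>M) \<le> ennreal z * emeasure M (H \<inter> G)" if "H \<in> sets F" for H
    proof -
      have HG: "H \<inter> G \<in> sets F" using that GF by auto
      have "(\<integral>\<^sup>+\<omega>\<in>H \<inter> G. ?e \<omega> \<partial>M) \<le> (\<integral>\<^sup>+\<omega>\<in>H \<inter> G. ennreal z \<partial>M)"
        by (intro nn_integral_mono) (auto simp: indicator_def G_def)
      then show ?thesis unfolding eint[OF HG] using setsF[OF HG] by (simp add: nn_integral_cmult_indicator)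
    qed
    have above: "ennreal z * emeasure M (H - G) \<le> (\<integral>\<^sup>+\<omega>\<in>H - G. ?m \<omega> \<partial>M)" if "H \<in> sets F" for H
    proof -
      have HG: "H - G \<in> sets F" using that GF by auto
      have "(\<integral>\<^sup>+\<omega>\<in>H - G. ennreal z \<partial>M) \<le> (\<integral>\<^sup>+\<omega>\<in>H - G. ?e \<omega> \<partial>M)"
        by (intro nn_integral_mono) (auto simp: indicator_def G_def spF)
      then show ?thesis unfolding eint[OF HG] using setsF[OF HG] by (simp add: nn_integral_cmult_indicator)
    qed
    have Iy: "?I y H \<le> ennreal z * emeasure M H" if H: "H \<in> sets F" for H
    proof -
      have "?I y H = (\<integral>\<^sup>+\<omega>\<in>H. (if \<omega> \<in> G then ?m \<omega> else d (x \<omega>) \<omega>) \<partial>M)"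
        by (intro nn_integral_cong) (auto simp: y_def indicator_def)
      also have "\<dots> = (\<integral>\<^sup>+\<omega>\<in>H \<inter> G. ?m \<omega> \<partial>M) + (\<integral>\<^sup>+\<omega>\<in>H - G. d (x \<omega>) \<omega> \<partial>M)" by (rule split[OF H dm dx])
      also have "\<dots> \<le> ennreal z * emeasure M (H \<inter> G) + ennreal z * emeasure M (H - G)"
        using x H GF unfolding good_def by (intro add_mono below[OF H]) auto
      finally show ?thesis unfolding Hsplit[OF H] .
    qed
    have Iyh: "ennreal z * emeasure M H \<le> ?I (\<lambda>\<omega>. y \<omega> + ?h) H" if H: "H \<in> sets F" for H
    proof -
      have "H \<inter> G \<in> sets F" using H GF by auto
      then have up: "ennreal z * emeasure M (H \<inter> G) \<le> (\<integral>\<^sup>+\<omega>\<in>H \<inter> G. d (x \<omega> + (?h + ?h)) \<omega> \<partial>M)"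
        using x unfolding good_def h2 by blast
      have "ennreal z * emeasure M H \<le> (\<integral>\<^sup>+\<omega>\<in>H \<inter> G. d (x \<omega> + (?h + ?h)) \<omega> \<partial>M) + (\<integral>\<^sup>+\<omega>\<in>H - G. ?m \<omega> \<partial>M)"
        unfolding Hsplit[OF H] by (rule add_mono[OF up above[OF H]])
      also have "\<dots> = (\<integral>\<^sup>+\<omega>\<in>H. (if \<omega> \<in> G then d (x \<omega> + (?h + ?h)) \<omega> else ?m \<omega>) \<partial>M)"
        by (rule split[OF H dt dm, symmetric])
      also have "\<dots> = ?I (\<lambda>\<omega>. y \<omega> + ?h) H"
        by (intro nn_integral_cong) (auto simp: y_def indicator_def add.assoc simp del: power_Suc)
      finally show ?thesis .
    qed
    have "0 \<le> y \<omega> \<and> y \<omega> + ?h \<le> 1 \<and> x \<omega> \<le> y \<omega> \<and> y \<omega> + ?h \<le> x \<omega> + (?h + ?h)" if "\<omega> \<in> space M" for \<omega>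
    proof (cases "\<omega> \<in> G")
      case True
      then have "y \<omega> = x \<omega> + ?h" by (simp add: y_def)
      then show ?thesis using xb[OF that] hpos by linarith
    next
      case False
      then have "y \<omega> = x \<omega>" by (simp add: y_def)
      then show ?thesis using xb[OF that] hpos by linarith
    qed
    then show ?thesis unfolding good_def h2 using yF Iy Iyh by blast
  qed
  have "\<exists>X. \<forall>k. good k (X k) \<and>
      (\<forall>\<omega>\<in>space M. X k \<omega> \<le> X (Suc k) \<omega> \<and> X (Suc k) \<omega> + (1/2)^Suc k \<le> X k \<omega> + (1/2)^k)"
    by (rule dependent_nat_choice[where Q="\<lambda>k x y. \<forall>\<omega>\<in>space M. x \<omega> \<le> y \<omega> \<and> y \<omega> + (1/2)^Suc k \<le> x \<omega> + (1/2)^k"])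
       (use start step in blast)+
  then obtain X where X0: "\<forall>k. good k (X k) \<and>
      (\<forall>\<omega>\<in>space M. X k \<omega> \<le> X (Suc k) \<omega> \<and> X (Suc k) \<omega> + (1/2)^Suc k \<le> X k \<omega> + (1/2)^k)" by (rule exE)
  have X: "good k (X k)"
    "\<omega> \<in> space M \<Longrightarrow> X k \<omega> \<le> X (Suc k) \<omega> \<and> X (Suc k) \<omega> + (1/2)^Suc k \<le> X k \<omega> + (1/2)^k" for k \<omega>
    using spec[OF X0, of k] by blast+
  have XF [measurable]: "X k \<in> borel_measurable F" for k using X(1) unfolding good_def by blast
  have Xb: "0 \<le> X k \<omega>" "X k \<omega> + (1/2)^k \<le> 1" if "\<omega> \<in> space M" for k \<omega>
    using X(1)[of k] that unfolding good_def by auto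
  have inc: "X k \<omega> \<le> X j \<omega>" "X j \<omega> + (1/2)^j \<le> X k \<omega> + (1/2)^k" if "\<omega> \<in> space M" "k \<le> j" for k j \<omega>
    using that(2)
  proof (induction j rule: dec_induct)
    case (step j)
    { case 1 then show ?case using step X(2)[OF that(1), of j] by linarith }
    { case 2 then show ?case using step X(2)[OF that(1), of j] by linarith }
  qed auto
  define x where "x = (\<lambda>\<omega>. lim (\<lambda>k. X k \<omega>))"
  have conv: "(\<lambda>k. X k \<omega>) \<longlonglongrightarrow> x \<omega>" if "\<omega> \<in> space M" for \<omega>
  proof -
    have "incseq (\<lambda>k. X k \<omega>)" using inc(1)[OF that] by (simp add: mono_def)
    moreover have "X k \<omega> \<le> 1" for k using Xb(2)[OF that, of k] zero_le_power[of "1/2 :: real" k] by linarith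
    ultimately obtain L where "(\<lambda>k. X k \<omega>) \<longlonglongrightarrow> L" by (meson incseq_convergent)
    then show ?thesis unfolding x_def by (simp add: limI)
  qed
  have xF: "x \<in> borel_measurable F" unfolding x_def by (rule borel_measurable_lim_metric) (rule XF)
  have xk: "X k \<omega> \<le> x \<omega> \<and> x \<omega> \<le> X k \<omega> + (1/2)^k" if "\<omega> \<in> space M" for k \<omega>
  proof
    show "X k \<omega> \<le> x \<omega>" using inc(1)[OF that] by (intro LIMSEQ_le_const[OF conv[OF that]]) auto
    have "X j \<omega> \<le> X k \<omega> + (1/2)^k" if "k \<le> j" for j
      using inc(2)[OF \<open>\<omega> \<in> space M\<close> that] zero_le_power[of "1/2 :: real" j] by linarith
    then show "x \<omega> \<le> X k \<omega> + (1/2)^k" by (intro LIMSEQ_le_const2[OF conv[OF that]]) auto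
  qed
  have x01: "x \<omega> \<in> {0..1}" if "\<omega> \<in> space M" for \<omega>
    using xk[OF that, of 0] Xb[OF that, of 0] by auto
  have small: "\<exists>k. C * (1/2)^k \<le> e" if "0 < e" for e :: real
  proof -
    have "(\<lambda>k. C * (1/2)^k) \<longlonglongrightarrow> C * 0" by (intro tendsto_intros LIMSEQ_realpow_zero) auto
    then have "eventually (\<lambda>k. C * (1/2)^k < e) sequentially" using that by (intro order_tendstoD(2)) auto
    then show ?thesis by (auto simp: eventually_sequentially intro: less_imp_le)
  qed
  have "?I x H = ennreal z * emeasure M H" if H: "H \<in> sets F" for H
  proof (rule antisym)
    show "?I x H \<le> ennreal z * emeasure M H"
    proof (rule ennreal_le_epsilon)
      fix e :: real assume "0 < e"
      then obtain k where k: "C * (1/2)^k \<le> e" using small by blast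
      have "?I x H \<le> ?I (X k) H + ennreal (C * (1/2)^k)"
        using xk[of _ k] Xb(1)[of _ k] x01 by (intro lip XF xF H) auto
      also have "\<dots> \<le> ennreal z * emeasure M H + ennreal e"
        using X(1)[of k] H k unfolding good_def by (intro add_mono ennreal_leI) auto
      finally show "?I x H \<le> ennreal z * emeasure M H + ennreal e" .
    qed
    show "ennreal z * emeasure M H \<le> ?I x H"
    proof (rule ennreal_le_epsilon)
      fix e :: real assume "0 < e"
      then obtain k where k: "C * (1/2)^k \<le> e" using small by blast
      have "ennreal z * emeasure M H \<le> ?I (\<lambda>\<omega>. X k \<omega> + (1/2)^k) H"
        using X(1)[of k] H unfolding good_def by blast
      also have "\<dots> \<le> ?I x H + ennreal (C * (1/2)^k)"
      proof (rule lip[OF xF _ _ H])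
        show "(\<lambda>\<omega>. X k \<omega> + (1/2)^k) \<in> borel_measurable F" by measurable
        fix \<omega> assume \<omega>: "\<omega> \<in> space M"
        show "0 \<le> x \<omega> \<and> x \<omega> \<le> X k \<omega> + (1/2)^k \<and> X k \<omega> + (1/2)^k \<le> 1 \<and> X k \<omega> + (1/2)^k \<le> x \<omega> + (1/2)^k"
          using xk[OF \<omega>, of k] Xb[OF \<omega>, of k] by auto
      qed
      also have "\<dots> \<le> ?I x H + ennreal e" using k by (intro add_mono ennreal_leI) auto
      finally show "ennreal z * emeasure M H \<le> ?I x H + ennreal e" .
    qed
  qed
  with xF x01 show ?thesis by (rule that)
qed

section \<open>Stopping times of the canonical filtration\<close>

abbreviation \<F> :: "ennreal \<Rightarrow> (real \<Rightarrow> real) measure" where "\<F> \<equiv> canonical_filtration"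
abbreviation stopping :: "((real \<Rightarrow> real) \<Rightarrow> ennreal) \<Rightarrow> bool" where
  "stopping \<equiv> stopping_time canonical_filtration"
abbreviation \<F>at :: "((real \<Rightarrow> real) \<Rightarrow> ennreal) \<Rightarrow> (real \<Rightarrow> real) measure" where
  "\<F>at \<equiv> canonical.pre_sigma"

lemma eval_measurable_F:
  assumes "0 \<le> u" "ennreal u \<le> t"
  shows "(\<lambda>\<omega>. \<omega> u) \<in> borel_measurable (\<F> t)"
proof (rule measurableI)
  fix V :: "real set" assume "V \<in> sets borel"
  then show "(\<lambda>\<omega>. \<omega> u) -` V \<inter> space (\<F> t) \<in> sets (\<F> t)"
    unfolding sets_canonical_filtration space_canonical_filtration using assms by blast
qed auto

lemma measurable_F_mono:
  assumes "f \<in> borel_measurable (\<F> s)" "s \<le> t"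
  shows "f \<in> borel_measurable (\<F> t)"
  using assms canonical.sets_F_mono[OF assms(2)]
  by (auto simp: measurable_def space_canonical_filtration)

lemma stopping_sets:
  assumes "stopping \<tau>" "s \<le> t"
  shows "{\<omega>\<in>path_space. \<tau> \<omega> \<le> s} \<in> sets (\<F> t)"
  using canonical.stopping_time_le_const[OF assms] by (simp add: pred_def space_canonical_filtration)

lemma path_tendsto:
  assumes \<omega>: "\<omega> \<in> path_space" and x: "x \<longlonglongrightarrow> a" and nn: "\<And>n. 0 \<le> x n" "0 \<le> a"
  shows "(\<lambda>n. \<omega> (x n)) \<longlonglongrightarrow> \<omega> a"
proof -
  have c: "continuous_on {0..} \<omega>" using \<omega> by (simp add: path_space_def)
  show ?thesis
    by (rule continuous_on_tendsto_compose[OF c x]) (use nn in \<open>auto simp: eventually_sequentially\<close>)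
qed

text \<open>
  The grid divides \<open>[0, t]\<close> into \<open>m\<close> cells; the index selects the first grid point at or after \<open>r\<close>.
\<close>

definition grid_index :: "real \<Rightarrow> nat \<Rightarrow> ennreal \<Rightarrow> nat" where
  "grid_index t m r = (LEAST i. r \<le> ennreal (t * real i / real m))"

lemma grid_index_props:
  assumes r: "r \<le> ennreal t" and t: "0 \<le> t" and m: "0 < m"
  shows "grid_index t m r \<le> m"
    and "enn2real r \<le> t * real (grid_index t m r) / real m"
    and "t * real (grid_index t m r) / real m \<le> enn2real r + t / real m"
proof -
  let ?i = "grid_index t m r"
  have ex: "r \<le> ennreal (t * real m / real m)" using r m by simp
  show "?i \<le> m" unfolding grid_index_def by (rule Least_le[of "\<lambda>i. r \<le> ennreal (t * real i / real m)", OF ex])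
  have L: "r \<le> ennreal (t * real ?i / real m)"
    unfolding grid_index_def by (rule LeastI[of "\<lambda>i. r \<le> ennreal (t * real i / real m)", OF ex])
  show "enn2real r \<le> t * real ?i / real m"
    using enn2real_mono[OF L] t m by simp
  show "t * real ?i / real m \<le> enn2real r + t / real m"
  proof (cases ?i)
    case 0 then show ?thesis using t m by simp
  next
    case (Suc j)
    then have "\<not> r \<le> ennreal (t * real j / real m)"
      using not_less_Least[of j "\<lambda>i. r \<le> ennreal (t * real i / real m)"]
      unfolding grid_index_def by simp
    then have "ennreal (t * real j / real m) \<le> r" by simp
    moreover have "r < top" using r by (simp add: le_less_trans)
    ultimately have "t * real j / real m \<le> enn2real r"
      using enn2real_mono[of "ennreal (t * real j / real m)" r] t m by simp
    then show ?thesis unfolding Suc using m by (simp add: field_simps)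
  qed
qed

text \<open>
  The part of \<open>H\<close> on which \<open>\<tau>\<close> is rounded up to the \<open>i\<close>-th grid point. It is described by comparisons of \<open>\<tau>\<close> with
  grid points up to the \<open>i\<close>-th, so that membership is known at that point.
\<close>

definition grid_cell :: "((real \<Rightarrow> real) \<Rightarrow> ennreal) \<Rightarrow> (real \<Rightarrow> real) set \<Rightarrow> real \<Rightarrow> nat \<Rightarrow> nat \<Rightarrow> (real \<Rightarrow> real) set" where
  "grid_cell \<tau> H t m i = {\<omega>\<in>H. \<tau> \<omega> \<le> ennreal (t * real i / real m)} -
     (\<Union>j<i. {\<omega>\<in>path_space. \<tau> \<omega> \<le> ennreal (t * real j / real m)})"

lemma grid_cell_iff:
  assumes "H \<subseteq> path_space" "\<omega> \<in> H" "\<tau> \<omega> \<le> ennreal t" "0 < m"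
  shows "\<omega> \<in> grid_cell \<tau> H t m i \<longleftrightarrow> i = grid_index t m (\<tau> \<omega>)"
proof -
  let ?P = "\<lambda>i. \<tau> \<omega> \<le> ennreal (t * real i / real m)"
  have ex: "?P m" using assms by simp
  have "\<omega> \<in> grid_cell \<tau> H t m i \<longleftrightarrow> ?P i \<and> (\<forall>j<i. \<not> ?P j)"
    unfolding grid_cell_def using assms(1,2) by auto
  also have "\<dots> \<longleftrightarrow> i = grid_index t m (\<tau> \<omega>)"
    unfolding grid_index_def
  proof
    assume "?P i \<and> (\<forall>j<i. \<not> ?P j)"
    then show "i = (LEAST i. ?P i)" by (intro Least_equality[symmetric]) (auto simp: not_less[symmetric])
  next
    assume "i = (LEAST i. ?P i)"
    then show "?P i \<and> (\<forall>j<i. \<not> ?P j)" using LeastI[of ?P, OF ex] not_less_Least by blast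
  qed
  finally show ?thesis .
qed

lemma grid_cell_sets:
  assumes st: "stopping \<tau>" and H: "H \<in> sets (\<F>at \<tau>)" and t: "0 \<le> t"
  shows "grid_cell \<tau> H t m i \<in> sets (\<F> (ennreal (t * real i / real m)))"
proof -
  have 1: "{\<omega>\<in>H. \<tau> \<omega> \<le> ennreal (t * real i / real m)} \<in> sets (\<F> (ennreal (t * real i / real m)))"
    by (rule canonical.sets_pre_sigmaD[OF st H])
  have 2: "{\<omega>\<in>path_space. \<tau> \<omega> \<le> ennreal (t * real j / real m)} \<in> sets (\<F> (ennreal (t * real i / real m)))"
    if "j < i" for j
    by (rule stopping_sets[OF st])
       (use that t in \<open>auto intro!: ennreal_leI mult_left_mono divide_right_mono\<close>)
  show ?thesis unfolding grid_cell_def using 1 2 by (intro sets.Diff sets.finite_UN) auto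
qed

lemma pre_sigma_subset: "H \<in> sets (\<F>at \<tau>) \<Longrightarrow> H \<subseteq> path_space"
  using sets.sets_into_space[of H "\<F>at \<tau>"] by (simp add: canonical.space_pre_sigma)

lemma grid_cell_index_sum:
  assumes "H \<subseteq> path_space" "0 \<le> t" "0 < m" "\<omega> \<in> path_space"
  shows "(\<Sum>i\<le>m. indicator (grid_cell \<tau> H t m i) \<omega> * f i)
     = indicator {\<omega>\<in>H. \<tau> \<omega> \<le> ennreal t} \<omega> * (f (grid_index t m (\<tau> \<omega>)) :: real)"
proof (cases "\<omega> \<in> H \<and> \<tau> \<omega> \<le> ennreal t")
  case True
  then have "(\<Sum>i\<le>m. indicator (grid_cell \<tau> H t m i) \<omega> * f i)
    = (\<Sum>i\<le>m. if i = grid_index t m (\<tau> \<omega>) then f i else 0)"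
    using grid_cell_iff[of H \<omega> \<tau> t m] assms by (intro sum.cong) (auto simp: indicator_def)
  also have "\<dots> = f (grid_index t m (\<tau> \<omega>))"
    using grid_index_props(1)[of "\<tau> \<omega>" t m] True assms by simp
  finally show ?thesis using True by simp
next
  case False
  have "\<omega> \<notin> grid_cell \<tau> H t m i" if "i \<le> m" for i
  proof
    assume "\<omega> \<in> grid_cell \<tau> H t m i"
    then have "\<omega> \<in> H" "\<tau> \<omega> \<le> ennreal (t * real i / real m)" by (auto simp: grid_cell_def)
    moreover have "t * real i / real m \<le> t"
      using that assms by (simp add: divide_le_eq mult_left_mono)
    ultimately show False using False by (meson ennreal_leI order_trans)
  qed
  then show ?thesis using False by (auto simp: indicator_def intro!: sum.neutral)
qed

lemma grid_value_tendsto: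
  assumes \<omega>: "\<omega> \<in> path_space" and t: "0 \<le> t" and r: "r \<le> ennreal t"
  shows "(\<lambda>m. \<omega> (t * real (grid_index t (Suc m) r) / real (Suc m))) \<longlonglongrightarrow> \<omega> (enn2real r)"
proof (rule path_tendsto[OF \<omega>])
  have "(\<lambda>m. t / real (Suc m)) \<longlonglongrightarrow> 0"
    by (rule LIMSEQ_Suc[OF lim_const_over_n])
  then have "(\<lambda>m. enn2real r + t / real (Suc m)) \<longlonglongrightarrow> enn2real r + 0"
    by (intro tendsto_intros)
  then have lim: "(\<lambda>m. enn2real r + t / real (Suc m)) \<longlonglongrightarrow> enn2real r" by simp
  show "(\<lambda>m. t * real (grid_index t (Suc m) r) / real (Suc m)) \<longlonglongrightarrow> enn2real r"
    by (rule tendsto_sandwich[OF _ _ tendsto_const lim])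
       (use grid_index_props[OF r t] in \<open>auto simp del: of_nat_Suc\<close>)
qed (use t in auto)

text \<open>
  Rounding \<open>\<tau>\<close> up to a grid on \<open>[0, t]\<close> gives finite combinations of values of the path up to time \<open>t\<close>,
  and continuity of the path lets the mesh tend to 0.
\<close>

lemma at_time_measurable_before:
  assumes st: "stopping \<tau>" and H: "H \<in> sets (\<F>at \<tau>)" and t: "0 \<le> t"
  shows "(\<lambda>\<omega>. indicator {\<omega>\<in>H. \<tau> \<omega> \<le> ennreal t} \<omega> * at_time \<tau> \<omega>) \<in> borel_measurable (\<F> (ennreal t))"
proof (rule borel_measurable_LIMSEQ_real)
  let ?Z = "\<lambda>m \<omega>. \<Sum>i\<le>Suc m. indicator (grid_cell \<tau> H t (Suc m) i) \<omega> * \<omega> (t * real i / real (Suc m))"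
  fix m
  show "?Z m \<in> borel_measurable (\<F> (ennreal t))"
  proof (rule borel_measurable_sum)
    fix i assume i: "i \<in> {..Suc m}"
    then have le: "ennreal (t * real i / real (Suc m)) \<le> ennreal t"
      using t by (intro ennreal_leI) (simp add: divide_le_eq mult_left_mono del: of_nat_Suc)
    have [measurable]: "grid_cell \<tau> H t (Suc m) i \<in> sets (\<F> (ennreal t))"
      using grid_cell_sets[OF st H t] canonical.sets_F_mono[OF le] by blast
    have [measurable]: "(\<lambda>\<omega>. \<omega> (t * real i / real (Suc m))) \<in> borel_measurable (\<F> (ennreal t))"
      using t le by (intro eval_measurable_F) auto
    show "(\<lambda>\<omega>. indicator (grid_cell \<tau> H t (Suc m) i) \<omega> * \<omega> (t * real i / real (Suc m)))
        \<in> borel_measurable (\<F> (ennreal t))" by measurable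
  qed
next
  fix \<omega> assume "\<omega> \<in> space (\<F> (ennreal t))"
  then have \<omega>: "\<omega> \<in> path_space" by (simp add: space_canonical_filtration)
  let ?Z = "\<lambda>m \<omega>. \<Sum>i\<le>Suc m. indicator (grid_cell \<tau> H t (Suc m) i) \<omega> * \<omega> (t * real i / real (Suc m))"
  have "?Z m \<omega> = indicator {\<omega>\<in>H. \<tau> \<omega> \<le> ennreal t} \<omega> * \<omega> (t * real (grid_index t (Suc m) (\<tau> \<omega>)) / real (Suc m))" for m
    by (rule grid_cell_index_sum) (use pre_sigma_subset[OF H] t \<omega> in auto)
  moreover have "(\<lambda>m. indicator {\<omega>\<in>H. \<tau> \<omega> \<le> ennreal t} \<omega> * \<omega> (t * real (grid_index t (Suc m) (\<tau> \<omega>)) / real (Suc m)))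
     \<longlonglongrightarrow> indicator {\<omega>\<in>H. \<tau> \<omega> \<le> ennreal t} \<omega> * at_time \<tau> \<omega>"
    using grid_value_tendsto[OF \<omega> t, of "\<tau> \<omega>"]
    by (cases "\<tau> \<omega> \<le> ennreal t") (auto simp: at_time_def indicator_def)
  ultimately show "(\<lambda>m. ?Z m \<omega>) \<longlonglongrightarrow> indicator {\<omega>\<in>H. \<tau> \<omega> \<le> ennreal t} \<omega> * at_time \<tau> \<omega>"
    by simp
qed

lemma path_space_pre_sigma: "path_space \<in> sets (\<F>at \<tau>)"
  using sets.top[of "\<F>at \<tau>"] by (simp add: canonical.space_pre_sigma)

text \<open>Membership in the \<open>\<sigma>\<close>-field prior to \<open>\<tau>\<close> may be tested at finite times only: at index
  \<open>\<infinity>\<close> it is enough to know that the event belongs to the \<open>\<sigma>\<close>-field of the whole path.\<close>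

lemma pre_sigmaI:
  assumes st: "stopping \<tau>" and inf: "A \<in> sets (\<F> \<infinity>)"
    and fin: "\<And>t. 0 \<le> t \<Longrightarrow> {\<omega>\<in>A. \<tau> \<omega> \<le> ennreal t} \<in> sets (\<F> (ennreal t))"
  shows "A \<in> sets (\<F>at \<tau>)"
proof (rule canonical.sets_pre_sigmaI[OF st])
  fix t show "{\<omega> \<in> A. \<tau> \<omega> \<le> t} \<in> sets (\<F> t)"
  proof (cases t rule: ennreal_cases)
    case (real r) then show ?thesis using fin[of r] by simp
  next
    case top then show ?thesis using inf by simp
  qed
qed

lemma at_time_measurable:
  assumes st: "stopping \<tau>"
  shows "at_time \<tau> \<in> borel_measurable (\<F>at \<tau>)"
proof (rule measurableI)
  fix V :: "real set" assume V: "V \<in> sets borel"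
  let ?A = "at_time \<tau> -` V \<inter> space (\<F>at \<tau>)"
  have fin: "{\<omega>\<in>?A. \<tau> \<omega> \<le> ennreal t} \<in> sets (\<F> (ennreal t))" if t: "0 \<le> t" for t
  proof -
    let ?f = "\<lambda>\<omega>. indicator {\<omega>\<in>path_space. \<tau> \<omega> \<le> ennreal t} \<omega> * at_time \<tau> \<omega>"
    have "?f -` V \<inter> space (\<F> (ennreal t)) \<in> sets (\<F> (ennreal t))"
      by (rule measurable_sets[OF at_time_measurable_before[OF st path_space_pre_sigma t] V])
    then have "{\<omega>\<in>path_space. \<tau> \<omega> \<le> ennreal t} \<inter> (?f -` V \<inter> path_space) \<in> sets (\<F> (ennreal t))"
      using stopping_sets[OF st order_refl, of "ennreal t"] by (auto simp: space_canonical_filtration)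
    also have "{\<omega>\<in>path_space. \<tau> \<omega> \<le> ennreal t} \<inter> (?f -` V \<inter> path_space) = {\<omega>\<in>?A. \<tau> \<omega> \<le> ennreal t}"
      by (auto simp: canonical.space_pre_sigma)
    finally show ?thesis .
  qed
  show "?A \<in> sets (\<F>at \<tau>)"
  proof (rule pre_sigmaI[OF st _ fin])
    have 1: "{\<omega>\<in>?A. \<tau> \<omega> \<le> ennreal (real n)} \<in> sets (\<F> \<infinity>)" for n :: nat
      using fin[of n] canonical.sets_F_mono[of "ennreal n" \<infinity>] by auto
    have 2: "{\<omega>\<in>path_space. \<tau> \<omega> \<le> ennreal (real n)} \<in> sets (\<F> \<infinity>)" for n :: nat
      by (rule stopping_sets[OF st]) simp
    have 3: "(\<lambda>\<omega>. \<omega> 0) -` V \<inter> space (\<F> \<infinity>) \<in> sets (\<F> \<infinity>)"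
      by (rule measurable_sets[OF eval_measurable_F V]) auto
    \<comment> \<open>where \<open>\<tau> = \<infinity>\<close> the value at \<open>\<tau>\<close> is by convention the value at time 0\<close>
    have "?A = (\<Union>n. {\<omega>\<in>?A. \<tau> \<omega> \<le> ennreal (real n)}) \<union>
        (((\<lambda>\<omega>. \<omega> 0) -` V \<inter> space (\<F> \<infinity>)) - (\<Union>n. {\<omega>\<in>path_space. \<tau> \<omega> \<le> ennreal (real n)}))"
      (is "_ = ?R")
    proof (intro set_eqI)
      fix \<omega>
      show "\<omega> \<in> ?A \<longleftrightarrow> \<omega> \<in> ?R"
      proof (cases "\<tau> \<omega>" rule: ennreal_cases)
        case (real r)
        obtain n :: nat where "r \<le> real n" using real_arch_simple by blast
        then have "\<tau> \<omega> \<le> ennreal (real n)" using real by (simp add: ennreal_leI del: ennreal_of_nat_eq_real_of_nat)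
        then show ?thesis by (auto simp: canonical.space_pre_sigma space_canonical_filtration)
      next
        case top
        then have "\<not> \<tau> \<omega> \<le> ennreal (real n)" for n :: nat
          using ennreal_less_top[of "real n"] by (simp add: not_le)
        then show ?thesis using top
          by (auto simp: canonical.space_pre_sigma space_canonical_filtration at_time_def)
      qed
    qed
    also have "\<dots> \<in> sets (\<F> \<infinity>)" using 1 2 3 by (intro sets.Un sets.Diff sets.countable_UN) auto
    finally show "?A \<in> sets (\<F> \<infinity>)" .
  qed
qed auto

lemma measurable_before:
  assumes st: "stopping \<tau>" and f: "f \<in> borel_measurable (\<F>at \<tau>)"
  shows "(\<lambda>\<omega>. if \<tau> \<omega> \<le> t then f \<omega> else (0::real)) \<in> borel_measurable (\<F> t)"
proof (rule measurableI)
  fix V :: "real set" assume V: "V \<in> sets borel"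
  have "f -` V \<inter> space (\<F>at \<tau>) \<in> sets (\<F>at \<tau>)" using f V by (rule measurable_sets)
  from canonical.sets_pre_sigmaD[OF st this, of t]
  have 1: "{\<omega> \<in> path_space. f \<omega> \<in> V \<and> \<tau> \<omega> \<le> t} \<in> sets (\<F> t)"
    by (simp add: canonical.space_pre_sigma vimage_def Int_def conj_commute conj_left_commute)
  have 2: "{\<omega> \<in> path_space. \<tau> \<omega> \<le> t} \<in> sets (\<F> t)" by (rule stopping_sets[OF st order_refl])
  have "(\<lambda>\<omega>. if \<tau> \<omega> \<le> t then f \<omega> else 0) -` V \<inter> space (\<F> t) =
     {\<omega> \<in> path_space. f \<omega> \<in> V \<and> \<tau> \<omega> \<le> t} \<union> (if 0 \<in> V then path_space - {\<omega> \<in> path_space. \<tau> \<omega> \<le> t} else {})"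
    by (auto simp: space_canonical_filtration split: if_splits)
  also have "\<dots> \<in> sets (\<F> t)"
    using 1 2 sets.top[of "\<F> t"] by (auto simp: space_canonical_filtration)
  finally show "(\<lambda>\<omega>. if \<tau> \<omega> \<le> t then f \<omega> else 0) -` V \<inter> space (\<F> t) \<in> sets (\<F> t)" .
qed auto

lemma pre_sigma_measurable_mono:
  assumes "stopping \<sigma>" "stopping \<tau>" "\<And>\<omega>. \<omega> \<in> path_space \<Longrightarrow> \<sigma> \<omega> \<le> \<tau> \<omega>" "f \<in> borel_measurable (\<F>at \<sigma>)"
  shows "f \<in> borel_measurable (\<F>at \<tau>)"
  using assms(4) canonical.mono_pre_sigma[OF assms(1-3)]
  by (auto simp: measurable_def canonical.space_pre_sigma)

lemma F_le_pre_sigma: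
  assumes st: "stopping \<tau>" and le: "\<And>\<omega>. \<omega> \<in> path_space \<Longrightarrow> u \<le> \<tau> \<omega>"
    and f: "f \<in> borel_measurable (\<F> u)"
  shows "f \<in> borel_measurable (\<F>at \<tau>)"
proof -
  have "sets (\<F> u) \<subseteq> sets (\<F>at \<tau>)"
  proof
    fix A assume A: "A \<in> sets (\<F> u)"
    then have sub: "A \<subseteq> path_space" using sets.sets_into_space[OF A] by (simp add: space_canonical_filtration)
    show "A \<in> sets (\<F>at \<tau>)"
    proof (rule canonical.sets_pre_sigmaI[OF st])
      fix t show "{\<omega> \<in> A. \<tau> \<omega> \<le> t} \<in> sets (\<F> t)"
      proof (cases "u \<le> t")
        case True
        have "A \<inter> {\<omega>\<in>path_space. \<tau> \<omega> \<le> t} \<in> sets (\<F> t)"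
          using A canonical.sets_F_mono[OF True] stopping_sets[OF st order_refl, of t] by blast
        also have "A \<inter> {\<omega>\<in>path_space. \<tau> \<omega> \<le> t} = {\<omega> \<in> A. \<tau> \<omega> \<le> t}" using sub by auto
        finally show ?thesis .
      next
        case False
        then have "{\<omega> \<in> A. \<tau> \<omega> \<le> t} = {}" using le sub by fastforce
        then show ?thesis by (simp only: sets.empty_sets)
      qed
    qed
  qed
  then show ?thesis using f
    by (auto simp: measurable_def canonical.space_pre_sigma space_canonical_filtration)
qed

subsection \<open>First hitting times\<close>

text \<open>
  The target is the set where a function that is continuous along the path is nonpositive. Being
  closed, it is reached at the infimum.
\<close>

definition first_hit ::
  "((real \<Rightarrow> real) \<Rightarrow> ennreal) \<Rightarrow> (real \<Rightarrow> (real \<Rightarrow> real) \<Rightarrow> real) \<Rightarrow> (real \<Rightarrow> real) \<Rightarrow> ennreal" where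
  "first_hit \<theta> g \<omega> = Inf {ennreal t | t. 0 \<le> t \<and> \<theta> \<omega> \<le> ennreal t \<and> g t \<omega> \<le> 0}"

lemma first_hit_ge: "\<theta> \<omega> \<le> first_hit \<theta> g \<omega>"
  unfolding first_hit_def by (rule Inf_greatest) auto

lemma first_hit_before:
  assumes "0 \<le> t" "\<theta> \<omega> \<le> ennreal t" "ennreal t < first_hit \<theta> g \<omega>"
  shows "0 < g t \<omega>"
proof (rule ccontr)
  assume "\<not> 0 < g t \<omega>"
  then have "first_hit \<theta> g \<omega> \<le> ennreal t"
    unfolding first_hit_def using assms by (intro Inf_lower) auto
  then show False using assms by simp
qed

lemma first_hit_attained:
  assumes c: "continuous_on {t. 0 \<le> t \<and> \<theta> \<omega> \<le> ennreal t} (\<lambda>t. g t \<omega>)"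
    and fin: "first_hit \<theta> g \<omega> < \<infinity>"
  shows "g (enn2real (first_hit \<theta> g \<omega>)) \<omega> \<le> 0"
proof -
  define a where "a = enn2real (\<theta> \<omega>)"
  have th: "\<theta> \<omega> = ennreal a" "0 \<le> a"
    using le_less_trans[OF first_hit_ge fin] unfolding a_def by auto
  define r where "r = enn2real (first_hit \<theta> g \<omega>)"
  have r: "first_hit \<theta> g \<omega> = ennreal r" "0 \<le> r" using fin unfolding r_def by auto
  have ar: "a \<le> r" using first_hit_ge[of \<theta> \<omega> g] r th by simp
  have ex: "\<exists>t. r \<le> t \<and> t < r + 1 / real (Suc n) \<and> g t \<omega> \<le> 0" for n
  proof -
    have "first_hit \<theta> g \<omega> < ennreal (r + 1 / real (Suc n))" using r by (simp add: ennreal_less_iff)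
    then obtain t where t: "0 \<le> t" "\<theta> \<omega> \<le> ennreal t" "g t \<omega> \<le> 0" "ennreal t < ennreal (r + 1 / real (Suc n))"
      unfolding first_hit_def Inf_less_iff by auto
    moreover have "ennreal r \<le> ennreal t" unfolding r(1)[symmetric] first_hit_def using t
      by (intro Inf_lower) auto
    ultimately show ?thesis by (intro exI[of _ t]) (auto simp: ennreal_less_iff)
  qed
  obtain x where x: "\<And>n. r \<le> x n" "\<And>n. x n < r + 1 / real (Suc n)" "\<And>n. g (x n) \<omega> \<le> 0"
    using ex by metis
  have "(\<lambda>n. r + 1 / real (Suc n)) \<longlonglongrightarrow> r + 0"
    by (intro tendsto_intros LIMSEQ_Suc[OF lim_1_over_n])
  then have lim0: "(\<lambda>n. r + 1 / real (Suc n)) \<longlonglongrightarrow> r" by simp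
  have lim: "x \<longlonglongrightarrow> r"
    by (rule tendsto_sandwich[OF _ _ tendsto_const lim0])
       (use x(1) x(2)[THEN less_imp_le] in \<open>auto simp del: of_nat_Suc\<close>)
  have "0 \<le> x n \<and> \<theta> \<omega> \<le> ennreal (x n)" for n
    using x(1)[of n] ar th by (auto intro!: ennreal_leI)
  then have "(\<lambda>n. g (x n) \<omega>) \<longlonglongrightarrow> g r \<omega>"
    using ar th by (intro continuous_on_tendsto_compose[OF c lim]) (auto intro!: ennreal_leI)
  then show ?thesis unfolding r_def[symmetric]
    using x(3) by (intro LIMSEQ_le_const2) auto
qed

text \<open>
  On the compact interval from \<open>\<theta>\<close> to \<open>T\<close> the target is reached iff every positive bound is
  undercut by \<open>g\<close> at a rational time or at \<open>T\<close>. The point \<open>T\<close> must be added because rational times are used as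
  approximations from the right, to stay after \<open>\<theta>\<close>.
\<close>

lemma first_hit_stopping:
  assumes st: "stopping \<theta>"
    and c: "\<And>\<omega>. \<omega> \<in> path_space \<Longrightarrow> continuous_on {t. 0 \<le> t \<and> \<theta> \<omega> \<le> ennreal t} (\<lambda>t. g t \<omega>)"
    and g: "\<And>t. 0 \<le> t \<Longrightarrow> (\<lambda>\<omega>. if \<theta> \<omega> \<le> ennreal t then g t \<omega> else 0) \<in> borel_measurable (\<F> (ennreal t))"
  shows "stopping (first_hit \<theta> g)"
proof (rule stopping_timeI)
  fix t :: ennreal
  have space: "space (\<F> t) = path_space" for t by (rule space_canonical_filtration)
  show "Measurable.pred (\<F> t) (\<lambda>\<omega>. first_hit \<theta> g \<omega> \<le> t)"
  proof (cases t rule: ennreal_cases)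
    case top
    then have "(\<lambda>\<omega>. first_hit \<theta> g \<omega> \<le> t) = (\<lambda>_. True)" by auto
    then show ?thesis by (simp only: Measurable.pred_def) (simp add: sets.top)
  next
    case (real T)
    let ?Q = "insert T {q\<in>\<rat>. 0 \<le> q \<and> q \<le> T}"
    have Q: "countable ?Q" by (auto intro: countable_subset[OF _ countable_rat])
    let ?E = "\<lambda>m q. {\<omega>\<in>path_space. \<theta> \<omega> \<le> ennreal q \<and> g q \<omega> < 1 / real (Suc m)}"
    have E: "?E m q \<in> sets (\<F> t)" if "q \<in> ?Q" for m q
    proof -
      have q: "0 \<le> q" "ennreal q \<le> t" using that real by (auto intro: ennreal_leI)
      have "{\<omega>\<in>path_space. \<theta> \<omega> \<le> ennreal q} \<in> sets (\<F> t)" by (rule stopping_sets[OF st q(2)])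
      moreover have "(\<lambda>\<omega>. if \<theta> \<omega> \<le> ennreal q then g q \<omega> else 0) \<in> borel_measurable (\<F> t)"
        by (rule measurable_F_mono[OF g[OF q(1)] q(2)])
      then have "{\<omega>\<in>space (\<F> t). (if \<theta> \<omega> \<le> ennreal q then g q \<omega> else 0) < 1 / real (Suc m)} \<in> sets (\<F> t)"
        by measurable
      ultimately have "{\<omega>\<in>path_space. \<theta> \<omega> \<le> ennreal q} \<inter>
          {\<omega>\<in>path_space. (if \<theta> \<omega> \<le> ennreal q then g q \<omega> else 0) < 1 / real (Suc m)} \<in> sets (\<F> t)"
        unfolding space by (rule sets.Int)
      also have "{\<omega>\<in>path_space. \<theta> \<omega> \<le> ennreal q} \<inter>
          {\<omega>\<in>path_space. (if \<theta> \<omega> \<le> ennreal q then g q \<omega> else 0) < 1 / real (Suc m)} = ?E m q" by auto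
      finally show ?thesis .
    qed
    have "{\<omega>\<in>path_space. first_hit \<theta> g \<omega> \<le> t} = (\<Inter>m. \<Union>q\<in>?Q. ?E m q)"
    proof (intro set_eqI iffI)
      fix \<omega> assume "\<omega> \<in> {\<omega>\<in>path_space. first_hit \<theta> g \<omega> \<le> t}"
      then have \<omega>: "\<omega> \<in> path_space" and le: "first_hit \<theta> g \<omega> \<le> ennreal T" using real by auto
      define r where "r = enn2real (first_hit \<theta> g \<omega>)"
      have fin: "first_hit \<theta> g \<omega> < \<infinity>" using le by (simp add: le_less_trans)
      then have r: "first_hit \<theta> g \<omega> = ennreal r" "0 \<le> r" "r \<le> T"
        using le real unfolding r_def by (auto simp: enn2real_leI)
      have gr: "g r \<omega> \<le> 0" unfolding r_def by (rule first_hit_attained[OF c[OF \<omega>] fin])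
      have thr: "\<theta> \<omega> \<le> ennreal r" using first_hit_ge[of \<theta> \<omega> g] r by simp
      show "\<omega> \<in> (\<Inter>m. \<Union>q\<in>?Q. ?E m q)"
      proof (intro InterI, clarify)
        fix m
        show "\<omega> \<in> (\<Union>q\<in>?Q. ?E m q)"
        proof (cases "r = T")
          case True then show ?thesis using gr thr \<omega> by (auto intro!: bexI[of _ T] intro: le_less_trans)
        next
          case False
          then have rT: "r < T" using r by simp
          have "r \<in> {t. 0 \<le> t \<and> \<theta> \<omega> \<le> ennreal t}" using r thr by simp
          from c[OF \<omega>, unfolded continuous_on_iff, rule_format, OF this, of "1 / real (Suc m)"]
          obtain d where d: "d > 0" "\<And>x. 0 \<le> x \<Longrightarrow> \<theta> \<omega> \<le> ennreal x \<Longrightarrow> dist x r < d \<Longrightarrow> dist (g x \<omega>) (g r \<omega>) < 1 / real (Suc m)"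
            by (auto simp del: of_nat_Suc)
          obtain q where q: "q \<in> \<rat>" "r < q" "q < min T (r + d)"
            using Rats_dense_in_real[of r "min T (r + d)"] rT d(1) by auto
          have "\<theta> \<omega> \<le> ennreal q" using thr q(2) by (meson ennreal_leI less_imp_le order_trans)
          moreover have "g q \<omega> < 1 / real (Suc m)"
            using d(2)[of q] q r calculation gr by (auto simp: dist_real_def)
          ultimately show ?thesis using q r \<omega> by (auto intro!: bexI[of _ q])
        qed
      qed
    next
      fix \<omega> assume *: "\<omega> \<in> (\<Inter>m. \<Union>q\<in>?Q. ?E m q)"
      then have "\<forall>m. \<exists>q. q \<in> ?Q \<and> \<omega> \<in> ?E m q" by blast
      from choice[OF this] obtain x where x0: "\<forall>m. x m \<in> ?Q \<and> \<omega> \<in> ?E m (x m)" by (rule exE)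
      have x: "x m \<in> ?Q" "\<omega> \<in> ?E m (x m)" for m using spec[OF x0, of m] by (rule conjunct1, rule conjunct2)
      have \<omega>: "\<omega> \<in> path_space" using x(2)[of 0] by simp
      have x3: "x m \<in> {0..T}" for m using x(1)[of m] real(1) by auto
      have th: "\<theta> \<omega> < \<infinity>" using x(2)[of 0] by (auto intro: le_less_trans)
      define a where "a = enn2real (\<theta> \<omega>)"
      have a: "\<theta> \<omega> = ennreal a" "0 \<le> a" using th unfolding a_def by auto
      have xa: "\<And>m. x m \<in> {a..T}" using x(2) x3 a by auto
      obtain l f where l: "l \<in> {a..T}" "strict_mono (f :: nat \<Rightarrow> nat)" "(x \<circ> f) \<longlonglongrightarrow> l"
        using compact_Icc[unfolded compact_def, rule_format, of x a T] xa by blast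
      have dom: "0 \<le> y \<and> \<theta> \<omega> \<le> ennreal y" if "y \<in> {a..T}" for y
        using that a by (auto intro!: ennreal_leI)
      have "(\<lambda>n. g ((x \<circ> f) n) \<omega>) \<longlonglongrightarrow> g l \<omega>"
        by (rule continuous_on_tendsto_compose[OF c[OF \<omega>] l(3)])
           (use dom[OF l(1)] dom[OF xa] in simp_all)
      moreover have "(\<lambda>n. 1 / real (Suc (f n))) \<longlonglongrightarrow> 0"
        using LIMSEQ_subseq_LIMSEQ[OF LIMSEQ_Suc[OF lim_1_over_n] l(2)] by (simp add: o_def)
      moreover have "g ((x \<circ> f) n) \<omega> \<le> 1 / real (Suc (f n))" for n
        using x(2)[of "f n"] by (simp add: less_imp_le)
      ultimately have "g l \<omega> \<le> 0" by (intro LIMSEQ_le) auto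
      then have "first_hit \<theta> g \<omega> \<le> ennreal l"
        unfolding first_hit_def using l(1) a by (intro Inf_lower) auto
      also have "\<dots> \<le> t" using l(1) real by (auto intro: ennreal_leI)
      finally show "\<omega> \<in> {\<omega>\<in>path_space. first_hit \<theta> g \<omega> \<le> t}" using \<omega> by simp
    qed
    also have "\<dots> \<in> sets (\<F> t)"
    proof (rule sets.countable_INT)
      have "(\<Union>q\<in>?Q. ?E m q) \<in> sets (\<F> t)" for m by (rule sets.countable_UN'[OF Q], rule image_subsetI, rule E)
      then show "range (\<lambda>m. \<Union>q\<in>?Q. ?E m q) \<subseteq> sets (\<F> t)" by blast
    qed simp
    finally show ?thesis by (simp add: pred_def space)
  qed
qed

section \<open>Optional stopping\<close>

lemma (in prob_space) bounded_convergence: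
  fixes s :: "nat \<Rightarrow> 'a \<Rightarrow> real"
  assumes "f \<in> borel_measurable M" "\<And>i. s i \<in> borel_measurable M"
    and "AE x in M. (\<lambda>i. s i x) \<longlonglongrightarrow> f x" "\<And>i. AE x in M. \<bar>s i x\<bar> \<le> C"
  shows "(\<lambda>i. \<integral>x. s i x \<partial>M) \<longlonglongrightarrow> (\<integral>x. f x \<partial>M)" "integrable M f"
  using integral_dominated_convergence[of f M s "\<lambda>_. C"] integrable_dominated_convergence[of f M s "\<lambda>_. C"] assms
  by auto

lemma (in finite_measure) integrable_bounded:
  fixes f :: "'a \<Rightarrow> real"
  assumes "f \<in> borel_measurable M" "AE x in M. \<bar>f x\<bar> \<le> C"
  shows "integrable M f"
  using integrable_const_bound[of f C] assms by simp

locale positive_path_martingale = prob_space P for P :: "(real \<Rightarrow> real) measure" +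
  assumes sets_P: "sets P = sets path_borel"
    and martingale: "is_martingale P canonical_filtration (\<lambda>t \<omega>. \<omega> t)"
    and positive: "AE \<omega> in P. \<forall>t\<ge>0. 0 < \<omega> t"
begin

lemma space_P: "space P = path_space"
  using sets_eq_imp_space_eq[OF sets_P] by (simp add: space_path_borel)

lemma subalgebra_F: "subalgebra P (\<F> t)"
  unfolding subalgebra_def using sets_canonical_filtration_subset[of t]
  by (simp add: sets_P space_P space_canonical_filtration)

lemma subalgebra_at: "stopping \<tau> \<Longrightarrow> subalgebra P (\<F>at \<tau>)"
  by (rule subalgebra_pre_sigma[OF _ sets_P])

lemma cond_exp_F: "sigma_finite_subalgebra P (\<F> t)"
proof -
  interpret finite_measure_subalgebra P "\<F> t" by unfold_locales (rule subalgebra_F)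
  show ?thesis by (rule sigma_finite_subalgebra_axioms)
qed

lemma cond_exp_at:
  assumes "stopping \<tau>"
  shows "sigma_finite_subalgebra P (\<F>at \<tau>)"
proof -
  interpret finite_measure_subalgebra P "\<F>at \<tau>" by unfold_locales (rule subalgebra_at[OF assms])
  show ?thesis by (rule sigma_finite_subalgebra_axioms)
qed

lemma F_measurable_P: "f \<in> borel_measurable (\<F> t) \<Longrightarrow> f \<in> borel_measurable P"
  by (rule measurable_from_subalg[OF subalgebra_F])

lemma at_measurable_P: "stopping \<tau> \<Longrightarrow> f \<in> borel_measurable (\<F>at \<tau>) \<Longrightarrow> f \<in> borel_measurable P"
  by (rule measurable_from_subalg[OF subalgebra_at])

lemma eval_measurable_P: "0 \<le> t \<Longrightarrow> (\<lambda>\<omega>. \<omega> t) \<in> borel_measurable P"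
  by (rule F_measurable_P[OF eval_measurable_F[of t "ennreal t"]]) auto

lemma integrable_eval: "0 \<le> t \<Longrightarrow> integrable P (\<lambda>\<omega>. \<omega> t)"
  using martingale unfolding is_martingale_def by blast

lemma stopping_measurable_P: "stopping \<tau> \<Longrightarrow> \<tau> \<in> borel_measurable P"
  using sets_canonical_filtration_subset
  by (intro measurable_stopping_time[of canonical_filtration]) (auto simp: sets_P space_P space_canonical_filtration)

lemma integrable_bounded_mult_eval:
  assumes "W \<in> borel_measurable P" "\<And>\<omega>. \<bar>W \<omega>\<bar> \<le> C" "0 \<le> t"
  shows "integrable P (\<lambda>\<omega>. W \<omega> * \<omega> t)"
proof (rule Bochner_Integration.integrable_bound[OF integrable_mult_right[OF integrable_eval[OF assms(3)], of C]])
  show "(\<lambda>\<omega>. W \<omega> * \<omega> t) \<in> borel_measurable P"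
    using assms(1) eval_measurable_P[OF assms(3)] by measurable
  have "\<bar>W \<omega>\<bar> \<le> \<bar>C\<bar>" for \<omega> using assms(2)[of \<omega>] by linarith
  then show "AE \<omega> in P. norm (W \<omega> * \<omega> t) \<le> norm (C * \<omega> t)"
    unfolding real_norm_def abs_mult by (intro AE_I2 mult_right_mono) auto
qed

lemma martingale_test:
  assumes W: "W \<in> borel_measurable (\<F> (ennreal u))" "\<And>\<omega>. \<bar>W \<omega>\<bar> \<le> C" and u: "0 \<le> u" "u \<le> t"
  shows "(\<integral>\<omega>. W \<omega> * \<omega> t \<partial>P) = (\<integral>\<omega>. W \<omega> * \<omega> u \<partial>P)"
proof -
  interpret sigma_finite_subalgebra P "\<F> (ennreal u)" by (rule cond_exp_F)
  have t: "0 \<le> t" using u by simp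
  have WP [measurable]: "W \<in> borel_measurable P" by (rule F_measurable_P[OF W(1)])
  have [measurable]: "(\<lambda>\<omega>. \<omega> u) \<in> borel_measurable P" by (rule eval_measurable_P[OF u(1)])
  have "AE \<omega> in P. real_cond_exp P (\<F> (ennreal u)) (\<lambda>\<omega>. \<omega> t) \<omega> = \<omega> u"
    using martingale u unfolding is_martingale_def by blast
  then have "(\<integral>\<omega>. W \<omega> * \<omega> u \<partial>P) = (\<integral>\<omega>. W \<omega> * real_cond_exp P (\<F> (ennreal u)) (\<lambda>\<omega>. \<omega> t) \<omega> \<partial>P)"
    by (intro integral_cong_AE) auto
  also have "\<dots> = (\<integral>\<omega>. W \<omega> * \<omega> t \<partial>P)"
    by (rule real_cond_exp_intg(2)[OF integrable_bounded_mult_eval[OF WP W(2) t] W(1) eval_measurable_P[OF t]])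
  finally show ?thesis by simp
qed

text \<open>
  For a stopping time rounded up to a grid, optional stopping is the martingale property summed over the
  cells. The factor \<open>\<phi>\<close> of the stopped value is later used for truncation.
\<close>

lemma grid_stopping:
  assumes st: "stopping \<tau>" and H: "H \<in> sets (\<F>at \<tau>)" and t: "0 \<le> t" and m: "0 < m"
    and \<phi>: "\<phi> \<in> borel_measurable borel" "\<And>z. \<bar>\<phi> z\<bar> \<le> C"
  defines "E \<equiv> {\<omega>\<in>H. \<tau> \<omega> \<le> ennreal t}"
    and "Z \<equiv> \<lambda>\<omega>. \<omega> (t * real (grid_index t m (\<tau> \<omega>)) / real m)"
  shows "(\<lambda>\<omega>. indicator E \<omega> * \<phi> (Z \<omega>)) \<in> borel_measurable P"
    and "(\<integral>\<omega>. indicator E \<omega> * \<phi> (Z \<omega>) * Z \<omega> \<partial>P) = (\<integral>\<omega>. indicator E \<omega> * \<phi> (Z \<omega>) * \<omega> t \<partial>P)"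
proof -
  note Hs = pre_sigma_subset[OF H]
  let ?g = "\<lambda>i. t * real i / real m"
  let ?W = "\<lambda>i \<omega>. indicator (grid_cell \<tau> H t m i) \<omega> * \<phi> (\<omega> (?g i))"
  have g: "0 \<le> ?g i" for i using t by simp
  have W: "?W i \<in> borel_measurable (\<F> (ennreal (?g i)))" for i
    using grid_cell_sets[OF st H t, of m i] \<phi>(1) eval_measurable_F[OF g[of i] order_refl] by measurable
  have C: "0 \<le> C" using \<phi>(2)[of 0] by linarith
  have Wb: "\<bar>?W i \<omega>\<bar> \<le> C" for i \<omega> using \<phi>(2)[of "\<omega> (?g i)"] C by (auto simp: indicator_def)
  have eq: "indicator E \<omega> * f (grid_index t m (\<tau> \<omega>)) = (\<Sum>i\<le>m. indicator (grid_cell \<tau> H t m i) \<omega> * f i)"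
    if "\<omega> \<in> space P" for f :: "nat \<Rightarrow> real" and \<omega>
    unfolding E_def using that by (intro grid_cell_index_sum[OF Hs t m, symmetric]) (simp add: space_P)
  have 1: "indicator E \<omega> * \<phi> (Z \<omega>) = (\<Sum>i\<le>m. ?W i \<omega>)" if "\<omega> \<in> space P" for \<omega>
    unfolding Z_def by (rule eq[OF that, of "\<lambda>i. \<phi> (\<omega> (?g i))"])
  show "(\<lambda>\<omega>. indicator E \<omega> * \<phi> (Z \<omega>)) \<in> borel_measurable P"
    by (subst measurable_cong[OF 1], assumption) (intro borel_measurable_sum F_measurable_P[OF W])
  have gt: "?g i \<le> t" if "i \<le> m" for i using that t m by (simp add: divide_le_eq mult_left_mono)
  have 2: "indicator E \<omega> * \<phi> (Z \<omega>) * Z \<omega> = (\<Sum>i\<le>m. ?W i \<omega> * \<omega> (?g i))" if "\<omega> \<in> space P" for \<omega>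
    using eq[OF that, of "\<lambda>i. \<phi> (\<omega> (?g i)) * \<omega> (?g i)"] unfolding Z_def by (simp add: mult.assoc)
  have 3: "indicator E \<omega> * \<phi> (Z \<omega>) * \<omega> t = (\<Sum>i\<le>m. ?W i \<omega> * \<omega> t)" if "\<omega> \<in> space P" for \<omega>
    by (simp only: 1[OF that] sum_distrib_right)
  have "(\<integral>\<omega>. indicator E \<omega> * \<phi> (Z \<omega>) * Z \<omega> \<partial>P) = (\<integral>\<omega>. (\<Sum>i\<le>m. ?W i \<omega> * \<omega> (?g i)) \<partial>P)"
    by (rule Bochner_Integration.integral_cong[OF refl 2])
  also have "\<dots> = (\<Sum>i\<le>m. \<integral>\<omega>. ?W i \<omega> * \<omega> (?g i) \<partial>P)"
    by (intro Bochner_Integration.integral_sum integrable_bounded_mult_eval[OF F_measurable_P[OF W] Wb g])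
  also have "\<dots> = (\<Sum>i\<le>m. \<integral>\<omega>. ?W i \<omega> * \<omega> t \<partial>P)"
    by (intro sum.cong refl martingale_test[OF W Wb g gt, symmetric]) simp
  also have "\<dots> = (\<integral>\<omega>. (\<Sum>i\<le>m. ?W i \<omega> * \<omega> t) \<partial>P)"
    by (intro Bochner_Integration.integral_sum[symmetric] integrable_bounded_mult_eval[OF F_measurable_P[OF W] Wb t])
  also have "\<dots> = (\<integral>\<omega>. indicator E \<omega> * \<phi> (Z \<omega>) * \<omega> t \<partial>P)"
    by (rule Bochner_Integration.integral_cong[OF refl 3[symmetric]])
  finally show "(\<integral>\<omega>. indicator E \<omega> * \<phi> (Z \<omega>) * Z \<omega> \<partial>P) = (\<integral>\<omega>. indicator E \<omega> * \<phi> (Z \<omega>) * \<omega> t \<partial>P)" .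
qed

text \<open>
  The value \<open>Z\<close> at the rounded stopping time converges to the value at \<open>\<tau>\<close> as the mesh tends to 0. The
  limit may be taken under the integral because the part of \<open>Z\<close> above a level has the same integral
  as \<open>B\<^sub>t\<close> on the event that \<open>Z\<close> is large, and this is small uniformly in the mesh since \<open>B\<^sub>t\<close> is integrable.
\<close>

lemma optional_stopping:
  assumes st: "stopping \<tau>" and H: "H \<in> sets (\<F>at \<tau>)" and t: "0 \<le> t"
  defines "E \<equiv> {\<omega>\<in>H. \<tau> \<omega> \<le> ennreal t}"
  shows "integrable P (\<lambda>\<omega>. indicator E \<omega> * at_time \<tau> \<omega>)"
    and "(\<integral>\<omega>. indicator E \<omega> * at_time \<tau> \<omega> \<partial>P) = (\<integral>\<omega>. indicator E \<omega> * \<omega> t \<partial>P)"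
proof -
  define Z where "Z = (\<lambda>m \<omega>. \<omega> (t * real (grid_index t (Suc m) (\<tau> \<omega>)) / real (Suc m)) :: real)"
  \<comment> \<open>a continuous substitute for the indicator of \<open>|z| \<le> M\<close>, so that limits pass through it\<close>
  define cut where "cut = (\<lambda>(M::nat) z. max 0 (min 1 (real M + 1 - \<bar>z\<bar>)) :: real)"
  have cut_meas [measurable]: "cut M \<in> borel_measurable borel" for M unfolding cut_def by measurable
  have cut01: "0 \<le> cut M z" "cut M z \<le> 1" for M z unfolding cut_def by auto
  have cut_b: "\<bar>cut M z\<bar> \<le> 1" "\<bar>1 - cut M z\<bar> \<le> 1" for M z using cut01[of M z] by auto
  have cut_z: "\<bar>cut M z * z\<bar> \<le> real M + 1" for M z
  proof (cases "\<bar>z\<bar> \<le> real M + 1")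
    case True then show ?thesis using cut01[of M z] mult_mono[of "\<bar>cut M z\<bar>" 1 "\<bar>z\<bar>" "real M + 1"] by (simp add: abs_mult)
  next
    case False then show ?thesis unfolding cut_def by simp
  qed
  have cut_cont: "isCont (cut M) z" for M z unfolding cut_def by (intro continuous_intros)
  have cut_mono: "cut M z \<le> cut N z" if "M \<le> N" for M N z using that unfolding cut_def by auto
  have cut_lim: "(\<lambda>M. cut M z) \<longlonglongrightarrow> 1" for z
  proof (rule tendsto_eventually)
    obtain N :: nat where "\<bar>z\<bar> \<le> real N" using real_arch_simple by blast
    then show "eventually (\<lambda>M. cut M z = 1) sequentially"
      unfolding eventually_sequentially cut_def by (intro exI[of _ N]) auto
  qed
  have [measurable]: "(\<lambda>\<omega>. \<omega> t) \<in> borel_measurable P" by (rule eval_measurable_P[OF t])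
  have E [measurable]: "E \<in> sets P"
    unfolding E_def using canonical.sets_pre_sigmaD[OF st H, of "ennreal t"] subalgebra_F
    unfolding subalgebra_def by blast
  have at [measurable]: "at_time \<tau> \<in> borel_measurable P" by (rule at_measurable_P[OF st at_time_measurable[OF st]])
  have Zlim: "(\<lambda>m. Z m \<omega>) \<longlonglongrightarrow> at_time \<tau> \<omega>" if "\<omega> \<in> E" for \<omega>
    unfolding Z_def at_time_def using that pre_sigma_subset[OF H] t
    by (intro grid_value_tendsto) (auto simp: E_def)
  have bt: "integrable P (\<lambda>\<omega>. indicator E \<omega> * \<omega> t)"
    by (rule integrable_bounded_mult_eval[of _ 1]) (use t in \<open>auto simp: indicator_def\<close>)
  have ident: "(\<integral>\<omega>. indicator E \<omega> * \<omega> t \<partial>P) =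
      (\<integral>\<omega>. indicator E \<omega> * (cut M (at_time \<tau> \<omega>) * at_time \<tau> \<omega>) \<partial>P) +
      (\<integral>\<omega>. indicator E \<omega> * (1 - cut M (at_time \<tau> \<omega>)) * \<omega> t \<partial>P)" for M
  proof -
    have meas1: "(\<lambda>\<omega>. indicator E \<omega> * (cut M (Z m \<omega>) * Z m \<omega>)) \<in> borel_measurable P" for m
      unfolding Z_def E_def
      by (rule grid_stopping(1)[OF st H t, of "Suc m" "\<lambda>z. cut M z * z" "real M + 1"]) (simp_all add: cut_z)
    have meas2: "(\<lambda>\<omega>. indicator E \<omega> * (1 - cut M (Z m \<omega>))) \<in> borel_measurable P" for m
      unfolding Z_def E_def
      by (rule grid_stopping(1)[OF st H t, of "Suc m" "\<lambda>z. 1 - cut M z" 1]) (simp_all add: cut_b)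
    have split: "(\<integral>\<omega>. indicator E \<omega> * \<omega> t \<partial>P) =
      (\<integral>\<omega>. indicator E \<omega> * (cut M (Z m \<omega>) * Z m \<omega>) \<partial>P) +
      (\<integral>\<omega>. indicator E \<omega> * (1 - cut M (Z m \<omega>)) * \<omega> t \<partial>P)" for m
    proof -
      have meas3: "(\<lambda>\<omega>. indicator E \<omega> * cut M (Z m \<omega>)) \<in> borel_measurable P"
        unfolding Z_def E_def
        by (rule grid_stopping(1)[OF st H t, of "Suc m" "cut M" 1]) (simp_all add: cut_b)
      have i1: "integrable P (\<lambda>\<omega>. indicator E \<omega> * cut M (Z m \<omega>) * \<omega> t)"
        by (rule integrable_bounded_mult_eval[OF meas3 _ t, of 1]) (auto simp: indicator_def cut_b)
      have i2: "integrable P (\<lambda>\<omega>. indicator E \<omega> * (1 - cut M (Z m \<omega>)) * \<omega> t)"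
        by (rule integrable_bounded_mult_eval[OF meas2[of m] _ t, of 1]) (auto simp: indicator_def cut_b)
      have "(\<integral>\<omega>. indicator E \<omega> * \<omega> t \<partial>P) =
        (\<integral>\<omega>. indicator E \<omega> * cut M (Z m \<omega>) * \<omega> t + indicator E \<omega> * (1 - cut M (Z m \<omega>)) * \<omega> t \<partial>P)"
        by (intro Bochner_Integration.integral_cong) (auto simp: algebra_simps)
      also have "\<dots> = (\<integral>\<omega>. indicator E \<omega> * cut M (Z m \<omega>) * \<omega> t \<partial>P) + (\<integral>\<omega>. indicator E \<omega> * (1 - cut M (Z m \<omega>)) * \<omega> t \<partial>P)"
        by (rule Bochner_Integration.integral_add[OF i1 i2])
      also have "(\<integral>\<omega>. indicator E \<omega> * cut M (Z m \<omega>) * \<omega> t \<partial>P) = (\<integral>\<omega>. indicator E \<omega> * cut M (Z m \<omega>) * Z m \<omega> \<partial>P)"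
        unfolding Z_def E_def
        by (rule grid_stopping(2)[OF st H t, of "Suc m" "cut M" 1, symmetric]) (simp_all add: cut_b)
      finally show ?thesis by (simp add: mult.assoc)
    qed
    have l1: "(\<lambda>m. \<integral>\<omega>. indicator E \<omega> * (cut M (Z m \<omega>) * Z m \<omega>) \<partial>P) \<longlonglongrightarrow>
        (\<integral>\<omega>. indicator E \<omega> * (cut M (at_time \<tau> \<omega>) * at_time \<tau> \<omega>) \<partial>P)"
    proof (rule bounded_convergence(1)[where C="real M + 1"])
      show "AE \<omega> in P. (\<lambda>m. indicator E \<omega> * (cut M (Z m \<omega>) * Z m \<omega>)) \<longlonglongrightarrow>
          indicator E \<omega> * (cut M (at_time \<tau> \<omega>) * at_time \<tau> \<omega>)"
      proof (rule AE_I2)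
        fix \<omega> show "(\<lambda>m. indicator E \<omega> * (cut M (Z m \<omega>) * Z m \<omega>)) \<longlonglongrightarrow>
          indicator E \<omega> * (cut M (at_time \<tau> \<omega>) * at_time \<tau> \<omega>)"
        proof (cases "\<omega> \<in> E")
          case True
          show ?thesis by (intro tendsto_intros isCont_tendsto_compose[OF cut_cont] Zlim True)
        qed simp
      qed
      show "AE \<omega> in P. \<bar>indicator E \<omega> * (cut M (Z i \<omega>) * Z i \<omega>)\<bar> \<le> real M + 1" for i
        using cut_z by (auto simp: indicator_def)
    qed (use meas1 in measurable)
    have l2: "(\<lambda>m. \<integral>\<omega>. indicator E \<omega> * (1 - cut M (Z m \<omega>)) * \<omega> t \<partial>P) \<longlonglongrightarrow>
        (\<integral>\<omega>. indicator E \<omega> * (1 - cut M (at_time \<tau> \<omega>)) * \<omega> t \<partial>P)"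
    proof (rule integral_dominated_convergence[where w="\<lambda>\<omega>. \<bar>\<omega> t\<bar>"])
      show "AE \<omega> in P. (\<lambda>m. indicator E \<omega> * (1 - cut M (Z m \<omega>)) * \<omega> t) \<longlonglongrightarrow>
          indicator E \<omega> * (1 - cut M (at_time \<tau> \<omega>)) * \<omega> t"
      proof (rule AE_I2)
        fix \<omega> show "(\<lambda>m. indicator E \<omega> * (1 - cut M (Z m \<omega>)) * \<omega> t) \<longlonglongrightarrow>
          indicator E \<omega> * (1 - cut M (at_time \<tau> \<omega>)) * \<omega> t"
        proof (cases "\<omega> \<in> E")
          case True
          show ?thesis by (intro tendsto_intros isCont_tendsto_compose[OF cut_cont] Zlim True)
        qed simp
      qed
      show "AE \<omega> in P. norm (indicator E \<omega> * (1 - cut M (Z i \<omega>)) * \<omega> t) \<le> \<bar>\<omega> t\<bar>" for i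
        using mult_right_mono[OF cut_b(2)] by (auto simp: indicator_def abs_mult)
      show "integrable P (\<lambda>\<omega>. \<bar>\<omega> t\<bar>)" using integrable_eval[OF t] by simp
    qed (use meas2 in measurable)
    have "(\<lambda>m. \<integral>\<omega>. indicator E \<omega> * \<omega> t \<partial>P) \<longlonglongrightarrow>
      (\<integral>\<omega>. indicator E \<omega> * (cut M (at_time \<tau> \<omega>) * at_time \<tau> \<omega>) \<partial>P) +
      (\<integral>\<omega>. indicator E \<omega> * (1 - cut M (at_time \<tau> \<omega>)) * \<omega> t \<partial>P)"
      using tendsto_add[OF l1 l2] unfolding split[symmetric] .
    then show ?thesis by (simp add: LIMSEQ_const_iff)
  qed
  have "(\<lambda>M. \<integral>\<omega>. indicator E \<omega> * (1 - cut M (at_time \<tau> \<omega>)) * \<omega> t \<partial>P) \<longlonglongrightarrow> (\<integral>\<omega>. 0 \<partial>P)"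
  proof (rule integral_dominated_convergence[where w="\<lambda>\<omega>. \<bar>\<omega> t\<bar>"])
    show "AE \<omega> in P. (\<lambda>M. indicator E \<omega> * (1 - cut M (at_time \<tau> \<omega>)) * \<omega> t) \<longlonglongrightarrow> 0"
    proof (rule AE_I2)
      fix \<omega>
      have "(\<lambda>M. indicator E \<omega> * (1 - cut M (at_time \<tau> \<omega>)) * \<omega> t) \<longlonglongrightarrow> indicator E \<omega> * (1 - 1) * \<omega> t"
        by (intro tendsto_intros cut_lim)
      then show "(\<lambda>M. indicator E \<omega> * (1 - cut M (at_time \<tau> \<omega>)) * \<omega> t) \<longlonglongrightarrow> 0" by simp
    qed
    show "AE \<omega> in P. norm (indicator E \<omega> * (1 - cut M (at_time \<tau> \<omega>)) * \<omega> t) \<le> \<bar>\<omega> t\<bar>" for M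
      using mult_right_mono[OF cut_b(2)] by (auto simp: indicator_def abs_mult)
    show "integrable P (\<lambda>\<omega>. \<bar>\<omega> t\<bar>)" using integrable_eval[OF t] by simp
  qed measurable
  then have l3: "(\<lambda>M. \<integral>\<omega>. indicator E \<omega> * (1 - cut M (at_time \<tau> \<omega>)) * \<omega> t \<partial>P) \<longlonglongrightarrow> 0" by simp
  have "(\<lambda>M. (\<integral>\<omega>. indicator E \<omega> * \<omega> t \<partial>P) - (\<integral>\<omega>. indicator E \<omega> * (1 - cut M (at_time \<tau> \<omega>)) * \<omega> t \<partial>P))
      \<longlonglongrightarrow> (\<integral>\<omega>. indicator E \<omega> * \<omega> t \<partial>P) - 0" by (intro tendsto_diff tendsto_const l3)
  then have l4: "(\<lambda>M. \<integral>\<omega>. indicator E \<omega> * (cut M (at_time \<tau> \<omega>) * at_time \<tau> \<omega>) \<partial>P)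
      \<longlonglongrightarrow> (\<integral>\<omega>. indicator E \<omega> * \<omega> t \<partial>P)"
    unfolding eq_diff_eq[THEN iffD2, OF ident[symmetric], symmetric] by simp
  have pos: "AE \<omega> in P. 0 \<le> at_time \<tau> \<omega>"
    using positive by eventually_elim (auto simp: at_time_def intro: less_imp_le)
  have m1: "integrable P (\<lambda>\<omega>. indicator E \<omega> * (cut M (at_time \<tau> \<omega>) * at_time \<tau> \<omega>))" for M
      by (rule integrable_bounded[where C="real M + 1"]) (use cut_z in \<open>auto simp: indicator_def\<close>)
  have m2: "AE \<omega> in P. mono (\<lambda>M. indicator E \<omega> * (cut M (at_time \<tau> \<omega>) * at_time \<tau> \<omega>))"
      using pos by eventually_elim (auto simp: mono_def intro!: mult_left_mono mult_right_mono cut_mono)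
  have m3: "AE \<omega> in P. 0 \<le> indicator E \<omega> * (cut M (at_time \<tau> \<omega>) * at_time \<tau> \<omega>)" for M
      using pos by eventually_elim (auto intro!: mult_nonneg_nonneg cut01)
  have m4: "AE \<omega> in P. (\<lambda>M. indicator E \<omega> * (cut M (at_time \<tau> \<omega>) * at_time \<tau> \<omega>)) \<longlonglongrightarrow> indicator E \<omega> * at_time \<tau> \<omega>"
    proof (rule AE_I2)
      fix \<omega>
      have "(\<lambda>M. indicator E \<omega> * (cut M (at_time \<tau> \<omega>) * at_time \<tau> \<omega>)) \<longlonglongrightarrow> indicator E \<omega> * (1 * at_time \<tau> \<omega>)"
        by (intro tendsto_intros cut_lim)
      then show "(\<lambda>M. indicator E \<omega> * (cut M (at_time \<tau> \<omega>) * at_time \<tau> \<omega>)) \<longlonglongrightarrow> indicator E \<omega> * at_time \<tau> \<omega>" by simp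
    qed
  have m5: "(\<lambda>\<omega>. indicator E \<omega> * at_time \<tau> \<omega>) \<in> borel_measurable P" by measurable
  show "integrable P (\<lambda>\<omega>. indicator E \<omega> * at_time \<tau> \<omega>)"
    and "(\<integral>\<omega>. indicator E \<omega> * at_time \<tau> \<omega> \<partial>P) = (\<integral>\<omega>. indicator E \<omega> * \<omega> t \<partial>P)"
    using integral_monotone_convergence_nonneg[OF m1 m2 m3 m4 l4 m5] by blast+
qed

end

section \<open>Increments between two stopping times\<close>

abbreviation stopped :: "((real \<Rightarrow> real) \<Rightarrow> ennreal) \<Rightarrow> real \<Rightarrow> (real \<Rightarrow> real) \<Rightarrow> real" where
  "stopped \<tau> t \<equiv> at_time (\<lambda>\<omega>. min (\<tau> \<omega>) (ennreal t))"

lemma stopped_simps: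
  "ennreal t \<le> \<tau> \<omega> \<Longrightarrow> 0 \<le> t \<Longrightarrow> stopped \<tau> t \<omega> = \<omega> t"
  "\<tau> \<omega> \<le> ennreal t \<Longrightarrow> stopped \<tau> t \<omega> = at_time \<tau> \<omega>"
  by (auto simp: at_time_def min_absorb1 min_absorb2)

lemma stopped_measurable:
  assumes st: "stopping \<tau>"
  shows "stopped \<tau> t \<in> borel_measurable (\<F> (ennreal t))"
proof -
  let ?m = "\<lambda>\<omega>. min (\<tau> \<omega>) (ennreal t)"
  have m: "stopping ?m" using st stopping_time_const by (rule stopping_time_min)
  have "sets (\<F>at ?m) \<subseteq> sets (\<F> (ennreal t))"
    using canonical.sets_pre_sigmaD[OF m, of _ "ennreal t"] by auto
  then show ?thesis using at_time_measurable[OF m]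
    by (auto simp: measurable_def canonical.space_pre_sigma space_canonical_filtration)
qed

text \<open>
  The path is frozen before \<open>\<sigma>\<close> and after \<open>\<tau>\<close>. Up to time \<open>\<sigma>\<close> the difference is 0, so the value at time \<open>t\<close> is
  known at time \<open>t\<close> even if the weight \<open>V\<close> is only known at time \<open>\<sigma>\<close>.
\<close>

definition increment ::
  "((real \<Rightarrow> real) \<Rightarrow> real) \<Rightarrow> ((real \<Rightarrow> real) \<Rightarrow> ennreal) \<Rightarrow> ((real \<Rightarrow> real) \<Rightarrow> ennreal) \<Rightarrow> real \<Rightarrow> (real \<Rightarrow> real) \<Rightarrow> real" where
  "increment V \<sigma> \<tau> t \<omega> = V \<omega> * (stopped \<tau> t \<omega> - stopped \<sigma> t \<omega>)"

lemma increment_adapted: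
  assumes \<sigma>: "stopping \<sigma>" and \<tau>: "stopping \<tau>"
    and le: "\<And>\<omega>. \<omega> \<in> path_space \<Longrightarrow> \<sigma> \<omega> \<le> \<tau> \<omega>"
    and V: "V \<in> borel_measurable (\<F>at \<sigma>)" and t: "0 \<le> t"
  shows "increment V \<sigma> \<tau> t \<in> borel_measurable (\<F> (ennreal t))"
proof -
  note [measurable] = measurable_before[OF \<sigma> V, of "ennreal t"] stopped_measurable[OF \<sigma>, of t] stopped_measurable[OF \<tau>, of t]
  have "(\<lambda>\<omega>. (if \<sigma> \<omega> \<le> ennreal t then V \<omega> else 0) * (stopped \<tau> t \<omega> - stopped \<sigma> t \<omega>)) \<in> borel_measurable (\<F> (ennreal t))"
    by measurable
  moreover have "(if \<sigma> \<omega> \<le> ennreal t then V \<omega> else 0) * (stopped \<tau> t \<omega> - stopped \<sigma> t \<omega>) = increment V \<sigma> \<tau> t \<omega>"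
    if "\<omega> \<in> space (\<F> (ennreal t))" for \<omega>
  proof -
    have "\<sigma> \<omega> \<le> \<tau> \<omega>" using le that by (simp add: space_canonical_filtration)
    then show ?thesis unfolding increment_def using t
      by (cases "\<sigma> \<omega> \<le> ennreal t") (auto simp: stopped_simps)
  qed
  ultimately show ?thesis by (rule measurable_cong[THEN iffD1, rotated])
qed

text \<open>
  Postponing both stopping times to \<open>u\<close> removes the part of the increment before time \<open>u\<close>. Conditioning
  on the past of \<open>u\<close> is thereby reduced to conditioning on the past of a stopping time.
\<close>

lemma increment_diff:
  assumes "\<sigma> \<omega> \<le> \<tau> \<omega>" "0 \<le> u" "u \<le> t"
  shows "increment V \<sigma> \<tau> t \<omega> - increment V \<sigma> \<tau> u \<omega> =
    increment V (\<lambda>\<omega>. max (\<sigma> \<omega>) (ennreal u)) (\<lambda>\<omega>. max (\<tau> \<omega>) (ennreal u)) t \<omega>"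
proof -
  have ut: "ennreal u \<le> ennreal t" using assms by (simp add: ennreal_leI)
  consider "\<tau> \<omega> \<le> ennreal u" | "\<sigma> \<omega> \<le> ennreal u" "ennreal u < \<tau> \<omega>" | "ennreal u < \<sigma> \<omega>"
    by fastforce
  then show ?thesis
  proof cases
    case 1
    then have "\<sigma> \<omega> \<le> ennreal u" "\<sigma> \<omega> \<le> ennreal t" "\<tau> \<omega> \<le> ennreal t"
      using assms(1) ut by (meson order_trans)+
    with 1 show ?thesis unfolding increment_def by (simp add: at_time_def min_absorb1 max_absorb2)
  next
    case 2
    then have "\<sigma> \<omega> \<le> ennreal t" using ut by auto
    with 2 ut assms show ?thesis unfolding increment_def
      by (simp add: at_time_def min_absorb1 min_absorb2 max_absorb1 max_absorb2 algebra_simps)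
  next
    case 3
    then have "ennreal u < \<tau> \<omega>" using assms by auto
    with 3 ut assms show ?thesis unfolding increment_def
      by (simp add: at_time_def min_absorb1 min_absorb2 max_absorb1 max_absorb2 algebra_simps)
  qed
qed

context positive_path_martingale
begin

lemma stopped_optional:
  assumes \<sigma>: "stopping \<sigma>" and \<tau>: "stopping \<tau>"
    and le: "\<And>\<omega>. \<omega> \<in> path_space \<Longrightarrow> \<sigma> \<omega> \<le> \<tau> \<omega>"
    and H: "H \<in> sets (\<F>at \<sigma>)" and t: "0 \<le> t"
  defines "E \<equiv> {\<omega>\<in>H. \<sigma> \<omega> \<le> ennreal t}"
  shows "integrable P (\<lambda>\<omega>. indicator E \<omega> * (stopped \<tau> t \<omega> - stopped \<sigma> t \<omega>))"
    and "(\<integral>\<omega>. indicator E \<omega> * (stopped \<tau> t \<omega> - stopped \<sigma> t \<omega>) \<partial>P) = 0"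
proof -
  have H\<tau>: "H \<in> sets (\<F>at \<tau>)" using canonical.mono_pre_sigma[OF \<sigma> \<tau> le] H by blast
  define E' where "E' = {\<omega>\<in>H. \<tau> \<omega> \<le> ennreal t}"
  have Hp: "H \<subseteq> path_space" by (rule pre_sigma_subset[OF H])
  have E'E: "E' \<subseteq> E" unfolding E_def E'_def using le Hp by (auto intro: order_trans)
  have "E \<in> sets (\<F> (ennreal t))" "E' \<in> sets (\<F> (ennreal t))"
    unfolding E_def E'_def using canonical.sets_pre_sigmaD[OF \<sigma> H, of "ennreal t"]
      canonical.sets_pre_sigmaD[OF \<tau> H\<tau>, of "ennreal t"] by auto
  then have [measurable]: "E \<in> sets P" "E' \<in> sets P"
    using subalgebra_F unfolding subalgebra_def by blast+
  have i1: "integrable P (\<lambda>\<omega>. indicator A \<omega> * \<omega> t)" if "A \<in> sets P" for A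
    by (rule integrable_bounded_mult_eval[of _ 1]) (use t that in \<open>auto simp: indicator_def\<close>)
  note os\<tau> = optional_stopping[OF \<tau> H\<tau> t, folded E'_def]
  note os\<sigma> = optional_stopping[OF \<sigma> H t, folded E_def]
  have eq: "indicator E \<omega> * (stopped \<tau> t \<omega> - stopped \<sigma> t \<omega>) =
      (indicator E' \<omega> * at_time \<tau> \<omega> - indicator E' \<omega> * \<omega> t) + (indicator E \<omega> * \<omega> t - indicator E \<omega> * at_time \<sigma> \<omega>)" for \<omega>
  proof (cases "\<omega> \<in> E")
    case False then show ?thesis using E'E by (auto simp: indicator_def)
  next
    case True
    show ?thesis
    proof (cases "\<omega> \<in> E'")
      case True with \<open>\<omega> \<in> E\<close> show ?thesis by (auto simp: E_def E'_def stopped_simps)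
    next
      case False
      then have "ennreal t \<le> \<tau> \<omega>" using \<open>\<omega> \<in> E\<close> by (auto simp: E_def E'_def)
      then show ?thesis using False \<open>\<omega> \<in> E\<close> t by (auto simp: E_def stopped_simps)
    qed
  qed
  note ints = os\<tau>(1) os\<sigma>(1) i1[of E] i1[of E']
  show "integrable P (\<lambda>\<omega>. indicator E \<omega> * (stopped \<tau> t \<omega> - stopped \<sigma> t \<omega>))"
    unfolding eq using ints by (intro Bochner_Integration.integrable_add Bochner_Integration.integrable_diff) auto
  show "(\<integral>\<omega>. indicator E \<omega> * (stopped \<tau> t \<omega> - stopped \<sigma> t \<omega>) \<partial>P) = 0"
    unfolding eq using ints os\<tau>(2) os\<sigma>(2) by simp
qed

text \<open>
  Optional stopping gives the statement for weights that are indicators; conditional expectation extends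
  it to all weights for which the increment is integrable.
\<close>

lemma increment_integral_zero:
  assumes \<sigma>: "stopping \<sigma>" and \<tau>: "stopping \<tau>"
    and le: "\<And>\<omega>. \<omega> \<in> path_space \<Longrightarrow> \<sigma> \<omega> \<le> \<tau> \<omega>"
    and V: "V \<in> borel_measurable (\<F>at \<sigma>)" and t: "0 \<le> t"
    and int: "integrable P (increment V \<sigma> \<tau> t)"
  shows "(\<integral>\<omega>. increment V \<sigma> \<tau> t \<omega> \<partial>P) = 0"
proof -
  interpret cs: sigma_finite_subalgebra P "\<F>at \<sigma>" by (rule cond_exp_at[OF \<sigma>])
  let ?X = "\<lambda>\<omega>. stopped \<tau> t \<omega> - stopped \<sigma> t \<omega>"
  have [measurable]: "?X \<in> borel_measurable P"
    using F_measurable_P[OF stopped_measurable[OF \<sigma>]] F_measurable_P[OF stopped_measurable[OF \<tau>]] by measurable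
  have X: "indicator {\<omega>\<in>H. \<sigma> \<omega> \<le> ennreal t} \<omega> * ?X \<omega> = indicator H \<omega> * ?X \<omega>" if "H \<subseteq> path_space" for H \<omega>
  proof (cases "\<omega> \<in> H \<and> \<not> \<sigma> \<omega> \<le> ennreal t")
    case True
    then have "ennreal t \<le> \<sigma> \<omega>" "ennreal t \<le> \<tau> \<omega>" using le[of \<omega>] that by auto
    then show ?thesis using t by (simp add: stopped_simps)
  qed (auto simp: indicator_def)
  have "integrable P (\<lambda>\<omega>. indicator path_space \<omega> * ?X \<omega>)"
    using stopped_optional(1)[OF \<sigma> \<tau> le path_space_pre_sigma t] unfolding X[OF order_refl] .
  then have Xint: "integrable P ?X"
    by (rule Bochner_Integration.integrable_cong[THEN iffD1, rotated -1]) (auto simp: space_P)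
  have "AE \<omega> in P. real_cond_exp P (\<F>at \<sigma>) ?X \<omega> = 0"
  proof (rule cs.real_cond_exp_charact)
    fix A assume A: "A \<in> sets (\<F>at \<sigma>)"
    have "(\<integral>\<omega>. indicator A \<omega> * ?X \<omega> \<partial>P) = 0"
      using stopped_optional(2)[OF \<sigma> \<tau> le A t] unfolding X[OF pre_sigma_subset[OF A]] .
    then show "(\<integral>\<omega>\<in>A. ?X \<omega> \<partial>P) = (\<integral>\<omega>\<in>A. 0 \<partial>P)" by (simp add: set_lebesgue_integral_def)
  qed (use Xint in auto)
  then have "(\<integral>\<omega>. V \<omega> * real_cond_exp P (\<F>at \<sigma>) ?X \<omega> \<partial>P) = (\<integral>\<omega>. 0 \<partial>P)"
    using at_measurable_P[OF \<sigma> V] by (intro integral_cong_AE) auto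
  moreover have "(\<integral>\<omega>. V \<omega> * real_cond_exp P (\<F>at \<sigma>) ?X \<omega> \<partial>P) = (\<integral>\<omega>. V \<omega> * ?X \<omega> \<partial>P)"
    using int V unfolding increment_def by (intro cs.real_cond_exp_intg(2)) auto
  ultimately show ?thesis unfolding increment_def by simp
qed

text \<open>
  By \<open>increment_diff\<close> the tested difference is a single increment between two later stopping times, with
  a weight that is known at the first of them.
\<close>

lemma increment_martingale:
  assumes \<sigma>: "stopping \<sigma>" and \<tau>: "stopping \<tau>"
    and le: "\<And>\<omega>. \<omega> \<in> path_space \<Longrightarrow> \<sigma> \<omega> \<le> \<tau> \<omega>"
    and V: "V \<in> borel_measurable (\<F>at \<sigma>)" and ut: "0 \<le> u" "u \<le> t"
    and bd: "\<And>t. 0 \<le> t \<Longrightarrow> AE \<omega> in P. \<bar>increment V \<sigma> \<tau> t \<omega>\<bar> \<le> K"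
    and W: "W \<in> borel_measurable (\<F> (ennreal u))" "AE \<omega> in P. \<bar>W \<omega>\<bar> \<le> C"
  shows "(\<integral>\<omega>. W \<omega> * (increment V \<sigma> \<tau> t \<omega> - increment V \<sigma> \<tau> u \<omega>) \<partial>P) = 0"
proof -
  let ?s = "\<lambda>\<omega>. max (\<sigma> \<omega>) (ennreal u)" and ?t = "\<lambda>\<omega>. max (\<tau> \<omega>) (ennreal u)"
  have s: "stopping ?s" and t: "stopping ?t"
    using \<sigma> \<tau> stopping_time_const by (auto intro!: stopping_time_max)
  have st: "?s \<omega> \<le> ?t \<omega>" if "\<omega> \<in> path_space" for \<omega> using le[OF that] by (auto simp: max_def)
  have [measurable]: "V \<in> borel_measurable (\<F>at ?s)"
    by (rule pre_sigma_measurable_mono[OF \<sigma> s _ V]) simp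
  have [measurable]: "W \<in> borel_measurable (\<F>at ?s)"
    by (rule F_le_pre_sigma[OF s _ W(1)]) simp
  have WV: "(\<lambda>\<omega>. W \<omega> * V \<omega>) \<in> borel_measurable (\<F>at ?s)" by measurable
  have t0: "0 \<le> t" using ut by simp
  have eq: "W \<omega> * (increment V \<sigma> \<tau> t \<omega> - increment V \<sigma> \<tau> u \<omega>) = increment (\<lambda>\<omega>. W \<omega> * V \<omega>) ?s ?t t \<omega>"
    if "\<omega> \<in> space P" for \<omega>
    using increment_diff[of \<sigma> \<omega> \<tau> u t V] le[of \<omega>] that ut by (simp add: space_P increment_def)
  have [measurable]: "W \<in> borel_measurable P" by (rule F_measurable_P[OF W(1)])
  have [measurable]: "increment V \<sigma> \<tau> t \<in> borel_measurable P" if "0 \<le> t" for t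
    by (rule F_measurable_P[OF increment_adapted[OF \<sigma> \<tau> le V that]])
  have int: "integrable P (\<lambda>\<omega>. W \<omega> * (increment V \<sigma> \<tau> t \<omega> - increment V \<sigma> \<tau> u \<omega>))"
  proof (rule integrable_bounded[where C="C * (2 * K)"])
    show "(\<lambda>\<omega>. W \<omega> * (increment V \<sigma> \<tau> t \<omega> - increment V \<sigma> \<tau> u \<omega>)) \<in> borel_measurable P"
      using ut t0 by measurable
    show "AE \<omega> in P. \<bar>W \<omega> * (increment V \<sigma> \<tau> t \<omega> - increment V \<sigma> \<tau> u \<omega>)\<bar> \<le> C * (2 * K)"
      using W(2) bd[OF t0] bd[OF ut(1)]
    proof eventually_elim
      case (elim \<omega>)
      then have "\<bar>increment V \<sigma> \<tau> t \<omega> - increment V \<sigma> \<tau> u \<omega>\<bar> \<le> 2 * K" by linarith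
      then show ?case unfolding abs_mult using elim(1) by (intro mult_mono) auto
    qed
  qed
  have "integrable P (increment (\<lambda>\<omega>. W \<omega> * V \<omega>) ?s ?t t)"
    using int by (rule Bochner_Integration.integrable_cong[THEN iffD1, rotated -1]) (auto simp: eq)
  from increment_integral_zero[OF s t st WV t0 this]
  show ?thesis using eq by (simp cong: Bochner_Integration.integral_cong)
qed

end

section \<open>The energy of an increment\<close>

text \<open>
  Fubini for a property that need not be measurable: it is replaced by the complement of a
  measurable null set.
\<close>

lemma (in prob_space) AE_pair_swap:
  assumes M1: "sigma_finite_measure M1" and ae: "AE (t, \<omega>) in M1 \<Otimes>\<^sub>M M. Q t \<omega>"
  shows "AE \<omega> in M. AE t in M1. Q t \<omega>"
proof -
  interpret M1: sigma_finite_measure M1 by (rule M1)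
  interpret pair_sigma_finite M1 M ..
  obtain N where N: "N \<in> null_sets (M1 \<Otimes>\<^sub>M M)" "{x \<in> space (M1 \<Otimes>\<^sub>M M). \<not> (case x of (t, \<omega>) \<Rightarrow> Q t \<omega>)} \<subseteq> N"
    using ae unfolding eventually_ae_filter by blast
  then have [measurable]: "N \<in> sets (M1 \<Otimes>\<^sub>M M)" by auto
  have "AE x in M1 \<Otimes>\<^sub>M M. x \<notin> N" using N(1) by (rule AE_not_in)
  then have "AE t in M1. AE \<omega> in M. (t, \<omega>) \<notin> N" by (rule AE_pair)
  moreover have "{x \<in> space (M1 \<Otimes>\<^sub>M M). (fst x, snd x) \<notin> N} \<in> sets (M1 \<Otimes>\<^sub>M M)" by simp
  ultimately have "AE \<omega> in M. AE t in M1. (t, \<omega>) \<notin> N"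
    using AE_commute[of "\<lambda>t \<omega>. (t, \<omega>) \<notin> N"] by simp
  with AE_space show ?thesis
  proof eventually_elim
    case (elim \<omega>)
    from elim(2) AE_space show ?case
      by eventually_elim (use elim(1) N(2) in \<open>auto simp: space_pair_measure\<close>)
  qed
qed

lemma enn2real_min: "ennreal (enn2real (min x (ennreal t))) = min x (ennreal t)"
  by (simp add: min_less_iff_disj)

lemma increment_as_clip:
  assumes "\<sigma> \<omega> \<le> \<tau> \<omega>" "0 \<le> t" "t \<le> real N"
  defines "a \<equiv> enn2real (min (\<sigma> \<omega>) (ennreal (real N)))" and "b \<equiv> enn2real (min (\<tau> \<omega>) (ennreal (real N)))"
  shows "increment V \<sigma> \<tau> t \<omega> = V \<omega> * (\<omega> (clip a b t) - \<omega> a)"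
proof -
  have a: "ennreal a = min (\<sigma> \<omega>) (ennreal (real N))" "0 \<le> a" unfolding a_def enn2real_min by auto
  have b: "ennreal b = min (\<tau> \<omega>) (ennreal (real N))" "0 \<le> b" unfolding b_def enn2real_min by auto
  have "ennreal a \<le> ennreal b" unfolding a b using assms(1) by (intro min.mono) auto
  then have ab: "a \<le> b" by (simp only: ennreal_le_iff[OF b(2)])
  have min_eq: "enn2real (min x (ennreal t)) = min (enn2real (min x (ennreal (real N)))) t" for x
  proof (cases "x \<le> ennreal (real N)")
    case True
    then have "x < top" using le_less_trans[OF True ennreal_less_top] by simp
    then obtain r where "x = ennreal r" "0 \<le> r" by (cases x) auto
    then show ?thesis using True assms(2,3) by (simp add: min_def)
  next
    case False
    then have "ennreal t \<le> x" using assms(3) ennreal_leI[of t "real N"] by (meson le_cases order_trans)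
    then show ?thesis using False assms(2,3) by (simp add: min_absorb2 not_le)
  qed
  have "stopped \<tau> t \<omega> = \<omega> (min b t)" "stopped \<sigma> t \<omega> = \<omega> (min a t)"
    unfolding at_time_def min_eq a_def b_def by auto
  moreover have "\<omega> (min b t) - \<omega> (min a t) = \<omega> (clip a b t) - \<omega> a"
  proof (cases "t \<le> a")
    case True then show ?thesis using ab by (simp add: clip_def min_def max_def)
  next
    case False then show ?thesis using ab by (auto simp: clip_def min_def max_def)
  qed
  ultimately show ?thesis unfolding increment_def by simp
qed

locale bounded_volatility = positive_path_martingale P for P :: "(real \<Rightarrow> real) measure" +
  fixes lo hi :: real and A :: "real \<Rightarrow> (real \<Rightarrow> real) \<Rightarrow> real"
  assumes lo: "0 < lo" and lo_hi: "lo \<le> hi"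
    and qv: "is_quadratic_variation P (\<lambda>t \<omega>. \<omega> t) A"
    and ac: "AE \<omega> in P. \<forall>b\<ge>0. absolutely_continuous_on 0 b (\<lambda>t. A t \<omega>)"
    and vol: "AE (t, \<omega>) in restrict_space lborel {0..} \<Otimes>\<^sub>M P.
           \<exists>D. ((\<lambda>u. A u \<omega>) has_real_derivative D) (at t within {0..}) \<and> sqrt D / \<omega> t \<in> {lo..hi}"
begin

text \<open>
  For almost every path the bounds hold for all time intervals at once, so random ones are allowed.
\<close>

lemma quadratic_variation_bounds:
  "AE \<omega> in P. \<forall>a b m M. 0 \<le> a \<and> a \<le> b \<and> 0 \<le> m \<and> (\<forall>t\<in>{a..b}. m \<le> \<omega> t \<and> \<omega> t \<le> M) \<longrightarrow>
     (lo * m)\<^sup>2 * (b - a) \<le> A b \<omega> - A a \<omega> \<and> A b \<omega> - A a \<omega> \<le> (hi * M)\<^sup>2 * (b - a)"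
proof -
  have sf: "sigma_finite_measure (restrict_space lborel {0::real..})"
    by (rule sigma_finite_measure_restrict_space) (auto intro: sigma_finite_lborel)
  have "AE \<omega> in P. AE t in restrict_space lborel {0..}.
      \<exists>D. ((\<lambda>u. A u \<omega>) has_real_derivative D) (at t within {0..}) \<and> sqrt D / \<omega> t \<in> {lo..hi}"
    by (rule AE_pair_swap[OF sf vol])
  then show ?thesis using ac positive
  proof eventually_elim
    case (elim \<omega>)
    have der: "AE t in lborel. 0 \<le> t \<longrightarrow>
        (\<exists>D. ((\<lambda>u. A u \<omega>) has_real_derivative D) (at t within {0..}) \<and> sqrt D / \<omega> t \<in> {lo..hi})"
      using elim(1) by (subst (asm) AE_restrict_space_iff) auto
    show ?case
    proof (intro allI impI, elim conjE)
      fix a b m M assume ab: "0 \<le> a" "a \<le> b" and m: "0 \<le> m" and mM: "\<forall>t\<in>{a..b}. m \<le> \<omega> t \<and> \<omega> t \<le> M"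
      have acb: "absolutely_continuous_on 0 b (\<lambda>t. A t \<omega>)" using elim(2) ab by auto
      have "AE t in lborel. a \<le> t \<and> t \<le> b \<longrightarrow>
        (\<exists>D. ((\<lambda>u. A u \<omega>) has_real_derivative D) (at t within {0..}) \<and> (lo * m)\<^sup>2 \<le> D \<and> D \<le> (hi * M)\<^sup>2)"
        using der
      proof eventually_elim
        case (elim t)
        show ?case
        proof
          assume t: "a \<le> t \<and> t \<le> b"
          then obtain D where D: "((\<lambda>u. A u \<omega>) has_real_derivative D) (at t within {0..})"
            "lo \<le> sqrt D / \<omega> t" "sqrt D / \<omega> t \<le> hi" using elim ab by auto
          have w: "0 < \<omega> t" using \<open>\<forall>t\<ge>0. 0 < \<omega> t\<close> t ab by auto
          have mt: "m \<le> \<omega> t" "\<omega> t \<le> M" using mM t by auto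
          have l: "lo * \<omega> t \<le> sqrt D" "sqrt D \<le> hi * \<omega> t" using D(2,3) w by (auto simp: pos_le_divide_eq pos_divide_le_eq)
          have "0 < lo * \<omega> t" using w lo by simp
          then have sq: "0 < sqrt D" using l by linarith
          then have D2: "(sqrt D)\<^sup>2 = D" by simp
          have "lo * m \<le> lo * \<omega> t" "hi * \<omega> t \<le> hi * M" using mt lo lo_hi by (auto intro!: mult_left_mono)
          then have "lo * m \<le> sqrt D" "sqrt D \<le> hi * M" using l by linarith+
          moreover have "0 \<le> lo * m" using lo m by simp
          ultimately have "(lo * m)\<^sup>2 \<le> (sqrt D)\<^sup>2" "(sqrt D)\<^sup>2 \<le> (hi * M)\<^sup>2"
            using less_imp_le[OF sq] by - (rule power_mono; assumption)+
          then show "\<exists>D. ((\<lambda>u. A u \<omega>) has_real_derivative D) (at t within {0..}) \<and> (lo * m)\<^sup>2 \<le> D \<and> D \<le> (hi * M)\<^sup>2"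
            unfolding D2 using D(1) by blast
        qed
      qed
      from absolutely_continuous_growth_bounds[OF acb ab this]
      show "(lo * m)\<^sup>2 * (b - a) \<le> A b \<omega> - A a \<omega> \<and> A b \<omega> - A a \<omega> \<le> (hi * M)\<^sup>2 * (b - a)" by blast
    qed
  qed
qed

text \<open>
  The quadratic variation at random times need not be measurable, since its paths are continuous only
  almost surely. Hence the measurable version \<open>L\<close>, which is the limit of sums of squares along dyadic
  grids.
\<close>

lemma increment_energy:
  assumes \<sigma>: "stopping \<sigma>" and \<tau>: "stopping \<tau>"
    and le: "\<And>\<omega>. \<omega> \<in> path_space \<Longrightarrow> \<sigma> \<omega> \<le> \<tau> \<omega>"
    and V: "V \<in> borel_measurable (\<F>at \<sigma>)"
    and bd: "\<And>t. 0 \<le> t \<Longrightarrow> AE \<omega> in P. \<bar>increment V \<sigma> \<tau> t \<omega>\<bar> \<le> K"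
  fixes N :: nat
  obtains L where "integrable P L" "(\<integral>\<omega>. L \<omega> \<partial>P) = (\<integral>\<omega>. (increment V \<sigma> \<tau> N \<omega>)\<^sup>2 \<partial>P)"
    "AE \<omega> in P. L \<omega> = (V \<omega>)\<^sup>2 * (A (enn2real (min (\<tau> \<omega>) (ennreal (real N)))) \<omega> - A (enn2real (min (\<sigma> \<omega>) (ennreal (real N)))) \<omega>)"
proof -
  obtain \<kappa> where \<kappa>: "\<And>m. m \<le> \<kappa> m"
    "AE \<omega> in P. \<forall>j l. (\<lambda>m. dyadic_sq \<omega> (\<kappa> m) (real j / 2 ^ l)) \<longlonglongrightarrow> A (real j / 2 ^ l) \<omega>"
    using quadratic_variation_subsequence[OF qv eval_measurable_P] by auto
  define Y where "Y = (\<lambda>k i. increment V \<sigma> \<tau> (real i / 2 ^ k))"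
  have mart: "bounded_discrete_martingale P (\<lambda>i. \<F> (ennreal (real i / 2 ^ k))) (Y k) K" for k
  proof (unfold_locales)
    fix i j :: nat and W :: "(real \<Rightarrow> real) \<Rightarrow> real" and C :: real
    assume ij: "i \<le> j" and W: "W \<in> borel_measurable (\<F> (ennreal (real i / 2 ^ k)))" "AE x in P. \<bar>W x\<bar> \<le> C"
    then have "real i / 2 ^ k \<le> real j / 2 ^ k" by (intro divide_right_mono) auto
    then show "(\<integral>x. W x * (Y k j x - Y k i x) \<partial>P) = 0"
      unfolding Y_def by (intro increment_martingale[OF \<sigma> \<tau> le V _ _ bd W]) auto
  next
    fix i j :: nat assume ij: "i \<le> j"
    then show "sets (\<F> (ennreal (real i / 2 ^ k))) \<subseteq> sets (\<F> (ennreal (real j / 2 ^ k)))"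
      by (intro canonical.sets_F_mono ennreal_leI divide_right_mono) auto
  next
    show "Y k i \<in> borel_measurable (\<F> (ennreal (real i / 2 ^ k)))" for i
      unfolding Y_def by (rule increment_adapted[OF \<sigma> \<tau> le V]) auto
    show "AE x in P. \<bar>Y k i x\<bar> \<le> K" for i unfolding Y_def by (rule bd) auto
  qed (rule subalgebra_F)
  define S where "S = (\<lambda>m \<omega>. \<Sum>i\<in>{0..<N * 2 ^ \<kappa> m}. (Y (\<kappa> m) (Suc i) \<omega> - Y (\<kappa> m) i \<omega>)\<^sup>2)"
  have Y0: "Y k 0 \<omega> = 0" for k \<omega> by (simp add: Y_def increment_def at_time_def)
  have YN: "Y k (N * 2 ^ k) \<omega> = increment V \<sigma> \<tau> N \<omega>" for k \<omega> by (simp add: Y_def)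
  have bS: "ess_bounded (S m)" for m
    unfolding S_def by (rule bounded_discrete_martingale.ess_bounded_sq_sum[OF mart])
  have Sint: "integrable P (S m)" "integrable P (\<lambda>\<omega>. (S m \<omega>)\<^sup>2)" for m
    using bS by (auto intro!: ess_bounded_integrable ess_bounded_power)
  have Smean: "(\<integral>\<omega>. S m \<omega> \<partial>P) = (\<integral>\<omega>. (increment V \<sigma> \<tau> N \<omega>)\<^sup>2 \<partial>P)" for m
    using bounded_discrete_martingale.energy[OF mart, of "\<kappa> m" "N * 2 ^ \<kappa> m"] unfolding S_def YN Y0 by simp
  have S2: "(\<integral>\<omega>. (S m \<omega>)\<^sup>2 \<partial>P) \<le> 64 * K ^ 4" for m
    unfolding S_def by (rule bounded_discrete_martingale.sq_sum_second_moment[OF mart])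
  have Snn: "0 \<le> S m \<omega>" for m \<omega> unfolding S_def by (intro sum_nonneg) auto
  let ?G = "\<lambda>\<omega>. (V \<omega>)\<^sup>2 * (A (enn2real (min (\<tau> \<omega>) (ennreal (real N)))) \<omega> - A (enn2real (min (\<sigma> \<omega>) (ennreal (real N)))) \<omega>)"
  have "AE \<omega> in P. continuous_on {0..} (\<lambda>t. A t \<omega>)"
    using qv unfolding is_quadratic_variation_def by auto
  then have lim: "AE \<omega> in P. (\<lambda>m. S m \<omega>) \<longlonglongrightarrow> ?G \<omega>"
    using \<kappa>(2) AE_space
  proof eventually_elim
    case (elim \<omega>)
    have \<omega>: "\<omega> \<in> path_space" using elim(3) by (simp add: space_P)
    have cont: "continuous_on {0..} \<omega>" using \<omega> by (simp add: path_space_def)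
    define a where "a = enn2real (min (\<sigma> \<omega>) (ennreal (real N)))"
    define b where "b = enn2real (min (\<tau> \<omega>) (ennreal (real N)))"
    have a: "ennreal a = min (\<sigma> \<omega>) (ennreal (real N))" "0 \<le> a" unfolding a_def enn2real_min by auto
    have b: "ennreal b = min (\<tau> \<omega>) (ennreal (real N))" "0 \<le> b" unfolding b_def enn2real_min by auto
    have "ennreal a \<le> ennreal b" unfolding a b using le[OF \<omega>] by (intro min.mono) auto
    then have ab: "a \<le> b" by (simp only: ennreal_le_iff[OF b(2)])
    have "ennreal b \<le> ennreal (real N)" unfolding b by simp
    then have bN: "b \<le> real N" by (simp only: ennreal_le_iff[OF of_nat_0_le_iff])
    have Yt: "Y k i \<omega> = V \<omega> * (\<omega> (clip a b (real i / 2 ^ k)) - \<omega> a)" if "i \<le> N * 2 ^ k" for k i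
    proof -
      have "real i \<le> real (N * 2 ^ k)" using that by (simp only: of_nat_le_iff)
      then show ?thesis unfolding Y_def a_def b_def
        by (intro increment_as_clip[of \<sigma> \<omega> \<tau>] le \<omega>) (auto simp: pos_divide_le_eq)
    qed
    have "S m \<omega> = (V \<omega>)\<^sup>2 * (\<Sum>i<N * 2 ^ \<kappa> m. (\<omega> (clip a b (real (Suc i) / 2 ^ \<kappa> m)) - \<omega> (clip a b (real i / 2 ^ \<kappa> m)))\<^sup>2)" for m
    proof -
      have "S m \<omega> = (\<Sum>i<N * 2 ^ \<kappa> m. (V \<omega>)\<^sup>2 * (\<omega> (clip a b (real (Suc i) / 2 ^ \<kappa> m)) - \<omega> (clip a b (real i / 2 ^ \<kappa> m)))\<^sup>2)"
        unfolding S_def atLeast0LessThan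
      proof (rule sum.cong[OF refl])
        fix i assume "i \<in> {..<N * 2 ^ \<kappa> m}"
        then have i: "Suc i \<le> N * 2 ^ \<kappa> m" "i \<le> N * 2 ^ \<kappa> m" by auto
        show "(Y (\<kappa> m) (Suc i) \<omega> - Y (\<kappa> m) i \<omega>)\<^sup>2 = (V \<omega>)\<^sup>2 * (\<omega> (clip a b (real (Suc i) / 2 ^ \<kappa> m)) - \<omega> (clip a b (real i / 2 ^ \<kappa> m)))\<^sup>2"
          unfolding Yt[OF i(1)] Yt[OF i(2)] power_mult_distrib[symmetric] by (simp only: right_diff_distrib) simp
      qed
      then show ?thesis by (simp only: sum_distrib_left)
    qed
    moreover have "(\<lambda>m. (V \<omega>)\<^sup>2 * (\<Sum>i<N * 2 ^ \<kappa> m. (\<omega> (clip a b (real (Suc i) / 2 ^ \<kappa> m)) - \<omega> (clip a b (real i / 2 ^ \<kappa> m)))\<^sup>2))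
       \<longlonglongrightarrow> (V \<omega>)\<^sup>2 * (A b \<omega> - A a \<omega>)"
      by (intro tendsto_mult tendsto_const clipped_sq_tendsto[OF cont elim(1) _ \<kappa>(1) a(2) ab bN]) (use elim(2) in blast)
    ultimately show ?case unfolding a_def b_def by simp
  qed
  define L where "L = (\<lambda>\<omega>. lim (\<lambda>m. S m \<omega>))"
  have Lm: "L \<in> borel_measurable P"
    unfolding L_def by (rule borel_measurable_lim_metric) (use Sint(1) in \<open>rule borel_measurable_integrable\<close>)
  have LG: "AE \<omega> in P. L \<omega> = ?G \<omega>" using lim by eventually_elim (simp add: L_def limI)
  have limL: "AE \<omega> in P. (\<lambda>m. S m \<omega>) \<longlonglongrightarrow> L \<omega>" using lim LG by eventually_elim simp
  from L2_bounded_limit[OF Sint(1) Snn Sint(2) S2 Smean limL Lm] LG show ?thesis by (rule that)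
qed

end

section \<open>Duration and energy inside a corridor\<close>

text \<open>
  The expected duration is obtained by monotone convergence from bounded time horizons, also where \<open>t = \<infinity>\<close>.
\<close>

lemma ennreal_duration_SUP:
  fixes s t :: ennreal
  assumes "s \<le> t" "s < \<infinity>"
  shows "t - s = (SUP N::nat. ennreal (enn2real (min t (ennreal (real N))) - enn2real (min s (ennreal (real N)))))"
    and "incseq (\<lambda>N::nat. ennreal (enn2real (min t (ennreal (real N))) - enn2real (min s (ennreal (real N)))))"
proof -
  obtain a where a: "s = ennreal a" "0 \<le> a" using assms(2) by (cases s) auto
  have mins: "enn2real (min s (ennreal (real N))) = min a (real N)" for N
    using a by (simp add: min_def)
  let ?d = "\<lambda>N::nat. enn2real (min t (ennreal (real N))) - enn2real (min s (ennreal (real N)))"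
  have "incseq (\<lambda>N. ennreal (?d N)) \<and> (\<lambda>N. ennreal (?d N)) \<longlonglongrightarrow> t - s"
  proof (cases t)
    case (real b)
    then have ab: "a \<le> b" using assms(1) a by simp
    have d: "?d N = min b (real N) - min a (real N)" for N
      using real mins by (simp add: min_def)
    have "incseq ?d" unfolding d using ab by (intro monoI) auto
    moreover have "eventually (\<lambda>N. ennreal (?d N) = t - s) sequentially"
    proof -
      obtain N0 :: nat where "b \<le> real N0" using real_arch_simple by blast
      then show ?thesis unfolding eventually_sequentially d
        using real a ab by (intro exI[of _ N0]) (auto simp: ennreal_minus min_absorb1)
    qed
    ultimately show ?thesis by (auto intro: tendsto_eventually simp: mono_def ennreal_leI)
  next
    case top
    have d: "?d N = real N - min a (real N)" for N using top mins by simp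
    have "incseq ?d" unfolding d by (intro monoI) auto
    moreover have "(\<lambda>N. ennreal (?d N)) \<longlonglongrightarrow> \<infinity>"
    proof (unfold d infinity_ennreal_def ennreal_tendsto_top_eq_at_top)
      have "filterlim (\<lambda>N. - a + real N) at_top sequentially"
        by (rule filterlim_tendsto_add_at_top[OF tendsto_const filterlim_real_sequentially])
      then show "filterlim (\<lambda>N. real N - min a (real N)) at_top sequentially"
        by (rule filterlim_at_top_mono) (auto intro!: always_eventually)
    qed
    ultimately show ?thesis using top a by (auto simp: mono_def ennreal_leI)
  qed
  then show "incseq (\<lambda>N. ennreal (?d N))" "t - s = (SUP N. ennreal (?d N))"
    by (auto dest: LIMSEQ_SUP LIMSEQ_unique)
qed

context bounded_volatility
begin

definition ratio :: "((real \<Rightarrow> real) \<Rightarrow> ennreal) \<Rightarrow> ((real \<Rightarrow> real) \<Rightarrow> ennreal) \<Rightarrow> (real \<Rightarrow> real) \<Rightarrow> real" where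
  "ratio \<theta> \<tau> \<omega> = at_time \<tau> \<omega> / at_time \<theta> \<omega>"

lemma ratio_measurable:
  assumes "stopping \<theta>" "stopping \<tau>"
  shows "ratio \<theta> \<tau> \<in> borel_measurable P"
  using at_measurable_P[OF assms(1) at_time_measurable[OF assms(1)]]
    at_measurable_P[OF assms(2) at_time_measurable[OF assms(2)]]
  unfolding ratio_def by measurable

lemma at_time_positive: "AE \<omega> in P. 0 < at_time \<theta> \<omega>"
  using positive by eventually_elim (simp add: at_time_def)

text \<open>
  On the corridor the path is comparable to its value at \<open>\<theta>\<close>, and the volatility \<open>\<sigma>\<^sub>t B\<^sub>t\<close> of \<open>B\<close> is
  bounded above and below by multiples of that value.
\<close>

definition in_corridor where
  "in_corridor l u \<theta> \<sigma> \<tau> \<longleftrightarrow> (AE \<omega> in P. \<forall>t\<ge>0. \<sigma> \<omega> \<le> ennreal t \<and> ennreal t \<le> \<tau> \<omega> \<longrightarrow>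
     l * at_time \<theta> \<omega> \<le> \<omega> t \<and> \<omega> t \<le> u * at_time \<theta> \<omega>)"

context
  fixes \<theta> \<sigma> \<tau> :: "(real \<Rightarrow> real) \<Rightarrow> ennreal" and l u :: real
  assumes \<theta>: "stopping \<theta>" and \<sigma>: "stopping \<sigma>" and \<tau>: "stopping \<tau>"
    and le1: "\<And>\<omega>. \<omega> \<in> path_space \<Longrightarrow> \<theta> \<omega> \<le> \<sigma> \<omega>"
    and le2: "\<And>\<omega>. \<omega> \<in> path_space \<Longrightarrow> \<sigma> \<omega> \<le> \<tau> \<omega>"
    and l: "0 < l" and lu: "l \<le> u"
    and corridor: "in_corridor l u \<theta> \<sigma> \<tau>"
    and \<sigma>_finite: "AE \<omega> in P. \<sigma> \<omega> < \<infinity>"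
begin

abbreviation Y :: "((real \<Rightarrow> real) \<Rightarrow> real) \<Rightarrow> nat \<Rightarrow> (real \<Rightarrow> real) \<Rightarrow> real" where
  "Y W N \<equiv> increment (\<lambda>\<omega>. W \<omega> / at_time \<theta> \<omega>) \<sigma> \<tau> (real N)"

abbreviation dur :: "nat \<Rightarrow> (real \<Rightarrow> real) \<Rightarrow> real" where
  "dur N \<omega> \<equiv> enn2real (min (\<tau> \<omega>) (ennreal (real N))) - enn2real (min (\<sigma> \<omega>) (ennreal (real N)))"

lemma weight_measurable:
  assumes W: "W \<in> borel_measurable (\<F>at \<sigma>)"
  shows "(\<lambda>\<omega>. W \<omega> / at_time \<theta> \<omega>) \<in> borel_measurable (\<F>at \<sigma>)"
proof -
  have [measurable]: "at_time \<theta> \<in> borel_measurable (\<F>at \<sigma>)"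
    by (rule pre_sigma_measurable_mono[OF \<theta> \<sigma> le1 at_time_measurable[OF \<theta>]])
  show ?thesis using W by measurable
qed

lemma normalized_increment_bound:
  assumes W: "AE \<omega> in P. \<bar>W \<omega>\<bar> \<le> C" and t: "0 \<le> t"
  shows "AE \<omega> in P. \<bar>increment (\<lambda>\<omega>. W \<omega> / at_time \<theta> \<omega>) \<sigma> \<tau> t \<omega>\<bar> \<le> C * u"
  using W corridor[unfolded in_corridor_def] at_time_positive[of \<theta>] AE_space
proof eventually_elim
  case (elim \<omega>)
  have \<omega>: "\<omega> \<in> path_space" using elim(4) by (simp add: space_P)
  have C: "0 \<le> C" using elim(1) by linarith
  show ?case
  proof (cases "\<sigma> \<omega> \<le> ennreal t")
    case False
    then have "ennreal t \<le> \<sigma> \<omega>" "ennreal t \<le> \<tau> \<omega>" using le2[OF \<omega>] by auto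
    then show ?thesis using t C l lu by (simp add: increment_def stopped_simps)
  next
    case True
    have in_c: "l * at_time \<theta> \<omega> \<le> \<omega> (enn2real r) \<and> \<omega> (enn2real r) \<le> u * at_time \<theta> \<omega>"
      if "\<sigma> \<omega> \<le> r" "r \<le> \<tau> \<omega>" "r \<le> ennreal t" for r
    proof -
      have "ennreal (enn2real r) = r" using le_less_trans[OF that(3) ennreal_less_top] by simp
      then show ?thesis using elim(2) that by (metis enn2real_nonneg)
    qed
    have 1: "l * at_time \<theta> \<omega> \<le> stopped \<tau> t \<omega>" "stopped \<tau> t \<omega> \<le> u * at_time \<theta> \<omega>"
      using in_c[of "min (\<tau> \<omega>) (ennreal t)"] True le2[OF \<omega>] by (auto simp: at_time_def)
    have 2: "l * at_time \<theta> \<omega> \<le> stopped \<sigma> t \<omega>" "stopped \<sigma> t \<omega> \<le> u * at_time \<theta> \<omega>"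
      using in_c[of "min (\<sigma> \<omega>) (ennreal t)"] True le2[OF \<omega>] by (auto simp: at_time_def min_absorb1)
    have "0 < l * at_time \<theta> \<omega>" using l elim(3) by simp
    then have "\<bar>stopped \<tau> t \<omega> - stopped \<sigma> t \<omega>\<bar> \<le> u * at_time \<theta> \<omega>" using 1 2 by linarith
    then have "\<bar>W \<omega>\<bar> * \<bar>stopped \<tau> t \<omega> - stopped \<sigma> t \<omega>\<bar> \<le> C * (u * at_time \<theta> \<omega>)"
      using elim(1) by (intro mult_mono) (auto simp: C)
    then show ?thesis using elim(3) by (simp add: increment_def abs_mult pos_divide_le_eq mult.assoc)
  qed
qed

lemma ratio_bounds:
  "AE \<omega> in P. l \<le> ratio \<theta> \<sigma> \<omega> \<and> ratio \<theta> \<sigma> \<omega> \<le> u"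
  using corridor[unfolded in_corridor_def] at_time_positive[of \<theta>] \<sigma>_finite AE_space
proof eventually_elim
  case (elim \<omega>)
  then have "ennreal (enn2real (\<sigma> \<omega>)) = \<sigma> \<omega>" by simp
  then have "l * at_time \<theta> \<omega> \<le> at_time \<sigma> \<omega> \<and> at_time \<sigma> \<omega> \<le> u * at_time \<theta> \<omega>"
    using elim(1) le2[of \<omega>] elim(4) unfolding at_time_def[of \<sigma>] space_P by (metis enn2real_nonneg order_refl)
  then show ?case using elim(2) by (simp add: ratio_def pos_le_divide_eq pos_divide_le_eq)
qed

lemma increment_mean_zero:
  assumes W: "W \<in> borel_measurable (\<F>at \<sigma>)" "AE \<omega> in P. \<bar>W \<omega>\<bar> \<le> C"
  shows "(\<integral>\<omega>. Y W N \<omega> \<partial>P) = 0"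
proof (rule increment_integral_zero[OF \<sigma> \<tau> le2 weight_measurable[OF W(1)]])
  show "integrable P (Y W N)"
    by (rule integrable_bounded[OF F_measurable_P[OF increment_adapted[OF \<sigma> \<tau> le2 weight_measurable[OF W(1)]]]
          normalized_increment_bound[OF W(2)]]) auto
qed auto

lemma dur_measurable: "dur N \<in> borel_measurable P"
  using stopping_measurable_P[OF \<sigma>] stopping_measurable_P[OF \<tau>] by measurable

lemma dur_bounds: "\<omega> \<in> path_space \<Longrightarrow> 0 \<le> dur N \<omega> \<and> dur N \<omega> \<le> real N"
proof -
  assume \<omega>: "\<omega> \<in> path_space"
  have "enn2real (min (\<sigma> \<omega>) (ennreal (real N))) \<le> enn2real (min (\<tau> \<omega>) (ennreal (real N)))"
    using le2[OF \<omega>] by (intro enn2real_mono min.mono) (auto simp: min_less_iff_disj)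
  moreover have "enn2real (min (\<tau> \<omega>) (ennreal (real N))) \<le> real N"
    by (intro enn2real_leI) auto
  ultimately show ?thesis using enn2real_nonneg[of "min (\<sigma> \<omega>) (ennreal (real N))"] by linarith
qed

text \<open>
  The corridor bounds the derivative of the quadratic variation by multiples of \<open>B\<^sub>\<theta>\<^sup>2\<close>, which the
  normalisation of the increment cancels.
\<close>

lemma energy_duration_bounds:
  assumes H: "H \<in> sets (\<F>at \<sigma>)"
  shows "(lo * l)\<^sup>2 * (\<integral>\<omega>. indicator H \<omega> * dur N \<omega> \<partial>P) \<le> (\<integral>\<omega>. (Y (indicator H) N \<omega>)\<^sup>2 \<partial>P)"
    and "(\<integral>\<omega>. (Y (indicator H) N \<omega>)\<^sup>2 \<partial>P) \<le> (hi * u)\<^sup>2 * (\<integral>\<omega>. indicator H \<omega> * dur N \<omega> \<partial>P)"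
    and "integrable P (\<lambda>\<omega>. indicator H \<omega> * dur N \<omega>)"
proof -
  have Hm: "(indicator H :: _ \<Rightarrow> real) \<in> borel_measurable (\<F>at \<sigma>)" using H by measurable
  have [measurable]: "H \<in> sets P" using H subalgebra_at[OF \<sigma>] unfolding subalgebra_def by blast
  have Hb: "AE \<omega> in P. \<bar>indicator H \<omega> :: real\<bar> \<le> 1" by (auto simp: indicator_def)
  note [measurable] = dur_measurable
  have dint: "integrable P (\<lambda>\<omega>. indicator H \<omega> * dur N \<omega>)"
    by (rule integrable_bounded[where C="real N"]) (use dur_bounds in \<open>auto simp: indicator_def space_P\<close>)
  then show "integrable P (\<lambda>\<omega>. indicator H \<omega> * dur N \<omega>)" .
  let ?V = "\<lambda>\<omega>. indicator H \<omega> / at_time \<theta> \<omega>"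
  obtain L where L: "integrable P L" "(\<integral>\<omega>. L \<omega> \<partial>P) = (\<integral>\<omega>. (Y (indicator H) N \<omega>)\<^sup>2 \<partial>P)"
    "AE \<omega> in P. L \<omega> = (?V \<omega>)\<^sup>2 * (A (enn2real (min (\<tau> \<omega>) (ennreal (real N)))) \<omega> - A (enn2real (min (\<sigma> \<omega>) (ennreal (real N)))) \<omega>)"
    by (rule increment_energy[OF \<sigma> \<tau> le2 weight_measurable[OF Hm] normalized_increment_bound[OF Hb], where N=N])
  have pt: "AE \<omega> in P. (lo * l)\<^sup>2 * (indicator H \<omega> * dur N \<omega>) \<le> L \<omega> \<and> L \<omega> \<le> (hi * u)\<^sup>2 * (indicator H \<omega> * dur N \<omega>)"
    using L(3) quadratic_variation_bounds corridor[unfolded in_corridor_def] at_time_positive[of \<theta>] AE_space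
  proof eventually_elim
    case (elim \<omega>)
    have \<omega>: "\<omega> \<in> path_space" using elim(5) by (simp add: space_P)
    define a where "a = enn2real (min (\<sigma> \<omega>) (ennreal (real N)))"
    define b where "b = enn2real (min (\<tau> \<omega>) (ennreal (real N)))"
    have a: "ennreal a = min (\<sigma> \<omega>) (ennreal (real N))" "0 \<le> a" unfolding a_def enn2real_min by auto
    have b: "ennreal b = min (\<tau> \<omega>) (ennreal (real N))" "0 \<le> b" unfolding b_def enn2real_min by auto
    have "ennreal a \<le> ennreal b" unfolding a b using le2[OF \<omega>] by (intro min.mono) auto
    then have ab: "a \<le> b" by (simp only: ennreal_le_iff[OF b(2)])
    have dur_ab: "dur N \<omega> = b - a" unfolding a_def b_def ..
    let ?B = "at_time \<theta> \<omega>"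
    have A_bounds: "(lo * (l * ?B))\<^sup>2 * (b - a) \<le> A b \<omega> - A a \<omega> \<and> A b \<omega> - A a \<omega> \<le> (hi * (u * ?B))\<^sup>2 * (b - a)"
    proof (cases "\<sigma> \<omega> \<le> ennreal (real N)")
      case False
      then have "ennreal (real N) \<le> \<sigma> \<omega>" "ennreal (real N) \<le> \<tau> \<omega>" using le2[OF \<omega>] by auto
      then have "a = b" unfolding a_def b_def by (simp add: min_absorb2)
      then show ?thesis by simp
    next
      case True
      have "\<forall>t\<in>{a..b}. l * ?B \<le> \<omega> t \<and> \<omega> t \<le> u * ?B"
      proof
        fix t assume t: "t \<in> {a..b}"
        then have t0: "0 \<le> t" using a(2) by simp
        have "\<sigma> \<omega> = ennreal a" using True unfolding a(1) by (simp add: min_absorb1)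
        also have "\<dots> \<le> ennreal t" using t by (intro ennreal_leI) simp
        finally have st: "\<sigma> \<omega> \<le> ennreal t" .
        have "ennreal t \<le> ennreal b" using t by (intro ennreal_leI) simp
        also have "\<dots> \<le> \<tau> \<omega>" unfolding b by simp
        finally have "ennreal t \<le> \<tau> \<omega>" .
        with elim(3) st t0 show "l * ?B \<le> \<omega> t \<and> \<omega> t \<le> u * ?B" by blast
      qed
      moreover have "0 \<le> l * ?B" using l elim(4) by simp
      ultimately show ?thesis using elim(2) a(2) ab by blast
    qed
    have Lab: "L \<omega> = indicator H \<omega> * ((1 / ?B)\<^sup>2 * (A b \<omega> - A a \<omega>))"
      unfolding elim(1) a_def b_def by (auto simp: indicator_def)
    have "(1 / ?B)\<^sup>2 * ((lo * (l * ?B))\<^sup>2 * (b - a)) \<le> (1 / ?B)\<^sup>2 * (A b \<omega> - A a \<omega>)"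
      "(1 / ?B)\<^sup>2 * (A b \<omega> - A a \<omega>) \<le> (1 / ?B)\<^sup>2 * ((hi * (u * ?B))\<^sup>2 * (b - a))"
      using A_bounds by (auto intro!: mult_left_mono)
    moreover have "(1 / ?B)\<^sup>2 * ((k * (m * ?B))\<^sup>2 * (b - a)) = (k * m)\<^sup>2 * (b - a)" for k m
      using elim(4) by (simp add: power2_eq_square divide_simps)
    ultimately have "(lo * l)\<^sup>2 * (b - a) \<le> (1 / ?B)\<^sup>2 * (A b \<omega> - A a \<omega>)"
      "(1 / ?B)\<^sup>2 * (A b \<omega> - A a \<omega>) \<le> (hi * u)\<^sup>2 * (b - a)" by auto
    then show ?case unfolding Lab dur_ab by (auto simp: indicator_def)
  qed
  have "(\<integral>\<omega>. (lo * l)\<^sup>2 * (indicator H \<omega> * dur N \<omega>) \<partial>P) \<le> (\<integral>\<omega>. L \<omega> \<partial>P)"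
    by (rule integral_mono_AE[OF integrable_mult_right[OF dint] L(1)]) (use pt in \<open>eventually_elim, blast\<close>)
  then show "(lo * l)\<^sup>2 * (\<integral>\<omega>. indicator H \<omega> * dur N \<omega> \<partial>P) \<le> (\<integral>\<omega>. (Y (indicator H) N \<omega>)\<^sup>2 \<partial>P)"
    unfolding L(2) by simp
  have "(\<integral>\<omega>. L \<omega> \<partial>P) \<le> (\<integral>\<omega>. (hi * u)\<^sup>2 * (indicator H \<omega> * dur N \<omega>) \<partial>P)"
    by (rule integral_mono_AE[OF L(1) integrable_mult_right[OF dint]]) (use pt in \<open>eventually_elim, blast\<close>)
  then show "(\<integral>\<omega>. (Y (indicator H) N \<omega>)\<^sup>2 \<partial>P) \<le> (hi * u)\<^sup>2 * (\<integral>\<omega>. indicator H \<omega> * dur N \<omega> \<partial>P)"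
    unfolding L(2) by simp
qed

lemma duration_as_SUP:
  assumes H: "H \<in> sets (\<F>at \<sigma>)"
  shows "(\<integral>\<^sup>+\<omega>\<in>H. (\<tau> \<omega> - \<sigma> \<omega>) \<partial>P) = (SUP N. ennreal (\<integral>\<omega>. indicator H \<omega> * dur N \<omega> \<partial>P))"
proof -
  have [measurable]: "H \<in> sets P" using H subalgebra_at[OF \<sigma>] unfolding subalgebra_def by blast
  note [measurable] = dur_measurable
  have "(\<integral>\<^sup>+\<omega>\<in>H. (\<tau> \<omega> - \<sigma> \<omega>) \<partial>P) = (\<integral>\<^sup>+\<omega>. (SUP N. ennreal (indicator H \<omega> * dur N \<omega>)) \<partial>P)"
  proof (rule nn_integral_cong_AE)
    show "AE \<omega> in P. (\<tau> \<omega> - \<sigma> \<omega>) * indicator H \<omega> = (SUP N. ennreal (indicator H \<omega> * dur N \<omega>))"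
      using \<sigma>_finite AE_space
    proof eventually_elim
      case (elim \<omega>)
      then show ?case using ennreal_duration_SUP(1)[OF le2, of \<omega>] by (simp add: indicator_def space_P)
    qed
  qed
  also have "\<dots> = (SUP N. \<integral>\<^sup>+\<omega>. ennreal (indicator H \<omega> * dur N \<omega>) \<partial>P)"
  proof (rule nn_integral_monotone_convergence_SUP_AE)
    show "AE \<omega> in P. ennreal (indicator H \<omega> * dur N \<omega>) \<le> ennreal (indicator H \<omega> * dur (Suc N) \<omega>)" for N
      using \<sigma>_finite AE_space
    proof eventually_elim
      case (elim \<omega>)
      then have "incseq (\<lambda>N. ennreal (dur N \<omega>))" using ennreal_duration_SUP(2)[OF le2, of \<omega>] by (simp add: space_P)
      from incseq_SucD[OF this, of N] show ?case by (cases "\<omega> \<in> H") (simp_all del: of_nat_Suc)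
    qed
  qed measurable
  also have "\<dots> = (SUP N. ennreal (\<integral>\<omega>. indicator H \<omega> * dur N \<omega> \<partial>P))"
    by (intro SUP_cong refl nn_integral_eq_integral energy_duration_bounds(3)[OF H])
       (use dur_bounds in \<open>auto simp: indicator_def space_P\<close>)
  finally show ?thesis .
qed

text \<open>
  The energy of a bounded increment is bounded, uniformly in the time horizon, and it dominates a multiple of the duration.
\<close>

lemma mean_duration_finite:
  "(\<integral>\<^sup>+\<omega>. (\<tau> \<omega> - \<sigma> \<omega>) \<partial>P) \<le> ennreal (u\<^sup>2 / (lo * l)\<^sup>2)"
proof -
  have H: "path_space \<in> sets (\<F>at \<sigma>)" by (rule path_space_pre_sigma)
  have c: "0 < (lo * l)\<^sup>2" using lo l by simp
  have "(\<integral>\<omega>. indicator path_space \<omega> * dur N \<omega> \<partial>P) \<le> u\<^sup>2 / (lo * l)\<^sup>2" for N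
  proof -
    have Hm: "(indicator path_space :: _ \<Rightarrow> real) \<in> borel_measurable (\<F>at \<sigma>)" using H by measurable
    have b: "AE \<omega> in P. \<bar>Y (indicator path_space) N \<omega>\<bar> \<le> 1 * u"
      by (rule normalized_increment_bound) (auto simp: indicator_def)
    have "AE \<omega> in P. (Y (indicator path_space) N \<omega>)\<^sup>2 \<le> u\<^sup>2"
      using b
    proof eventually_elim
      case (elim \<omega>)
      then have "\<bar>Y (indicator path_space) N \<omega>\<bar>\<^sup>2 \<le> u\<^sup>2" by (intro power_mono) auto
      then show ?case by simp
    qed
    moreover have m: "Y (indicator path_space) N \<in> borel_measurable P"
      by (rule F_measurable_P[OF increment_adapted[OF \<sigma> \<tau> le2 weight_measurable[OF Hm]]]) auto
    ultimately have "(\<integral>\<omega>. (Y (indicator path_space) N \<omega>)\<^sup>2 \<partial>P) \<le> (\<integral>\<omega>. u\<^sup>2 \<partial>P)"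
      by (intro integral_mono_AE integrable_bounded[where C="u\<^sup>2"]) auto
    then have "(lo * l)\<^sup>2 * (\<integral>\<omega>. indicator path_space \<omega> * dur N \<omega> \<partial>P) \<le> u\<^sup>2"
      using energy_duration_bounds(1)[OF H, of N] by (simp add: prob_space)
    then show ?thesis using c by (simp add: pos_le_divide_eq mult.commute)
  qed
  then have "(SUP N. ennreal (\<integral>\<omega>. indicator path_space \<omega> * dur N \<omega> \<partial>P)) \<le> ennreal (u\<^sup>2 / (lo * l)\<^sup>2)"
    by (intro SUP_least ennreal_leI)
  moreover have "(\<integral>\<^sup>+\<omega>. (\<tau> \<omega> - \<sigma> \<omega>) \<partial>P) = (\<integral>\<^sup>+\<omega>\<in>path_space. (\<tau> \<omega> - \<sigma> \<omega>) \<partial>P)"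
    by (intro nn_integral_cong) (simp add: space_P)
  ultimately show ?thesis unfolding duration_as_SUP[OF H] by simp
qed

lemma corridor_exit_finite: "AE \<omega> in P. \<tau> \<omega> < \<infinity>"
proof -
  note [measurable] = stopping_measurable_P[OF \<sigma>] stopping_measurable_P[OF \<tau>]
  have "AE \<omega> in P. \<tau> \<omega> - \<sigma> \<omega> \<noteq> \<infinity>"
    by (rule nn_integral_PInf_AE) (use le_less_trans[OF mean_duration_finite ennreal_less_top] in auto)
  then show ?thesis using \<sigma>_finite
  proof eventually_elim
    case (elim \<omega>)
    then show ?case by (cases "\<tau> \<omega>"; cases "\<sigma> \<omega>") auto
  qed
qed

lemma increment_limit:
  "AE \<omega> in P. (\<lambda>N. Y W N \<omega>) \<longlonglongrightarrow> W \<omega> * (ratio \<theta> \<tau> \<omega> - ratio \<theta> \<sigma> \<omega>)"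
  using corridor_exit_finite \<sigma>_finite
proof eventually_elim
  case (elim \<omega>)
  then obtain t s where ts: "\<tau> \<omega> = ennreal t" "0 \<le> t" "\<sigma> \<omega> = ennreal s" "0 \<le> s"
    by (cases "\<tau> \<omega>"; cases "\<sigma> \<omega>") auto
  obtain N0 :: nat where N0: "max t s \<le> real N0" using real_arch_simple by blast
  have "Y W N \<omega> = W \<omega> * (ratio \<theta> \<tau> \<omega> - ratio \<theta> \<sigma> \<omega>)" if "N0 \<le> N" for N
  proof -
    have "max t s \<le> real N" using N0 that by (meson of_nat_le_iff order_trans)
    then have "\<tau> \<omega> \<le> ennreal (real N)" "\<sigma> \<omega> \<le> ennreal (real N)"
      unfolding ts by (auto intro!: ennreal_leI simp del: ennreal_of_nat_eq_real_of_nat)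
    then show ?thesis by (simp add: increment_def stopped_simps ratio_def diff_divide_distrib algebra_simps)
  qed
  then show ?case by (intro tendsto_eventually) (auto simp: eventually_sequentially)
qed

text \<open>
  Almost surely the increments are bounded and eventually constant in the time horizon, so limits may be
  taken under the integral.
\<close>

lemma ratio_optional_stopping:
  assumes W: "W \<in> borel_measurable (\<F>at \<sigma>)" "AE \<omega> in P. \<bar>W \<omega>\<bar> \<le> C"
  shows "(\<integral>\<omega>. W \<omega> * (ratio \<theta> \<tau> \<omega> - ratio \<theta> \<sigma> \<omega>) \<partial>P) = 0"
    and "(\<lambda>N. \<integral>\<omega>. (Y W N \<omega>)\<^sup>2 \<partial>P) \<longlonglongrightarrow> (\<integral>\<omega>. (W \<omega>)\<^sup>2 * (ratio \<theta> \<tau> \<omega> - ratio \<theta> \<sigma> \<omega>)\<^sup>2 \<partial>P)"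
proof -
  note [measurable] = ratio_measurable[OF \<theta> \<tau>] ratio_measurable[OF \<theta> \<sigma>] at_measurable_P[OF \<sigma> W(1)]
  have Ym [measurable]: "Y W N \<in> borel_measurable P" for N
    by (rule F_measurable_P[OF increment_adapted[OF \<sigma> \<tau> le2 weight_measurable[OF W(1)]]]) auto
  have Yb: "AE \<omega> in P. \<bar>Y W N \<omega>\<bar> \<le> C * u" for N
    by (rule normalized_increment_bound[OF W(2)]) simp
  have "(\<lambda>N. \<integral>\<omega>. Y W N \<omega> \<partial>P) \<longlonglongrightarrow> (\<integral>\<omega>. W \<omega> * (ratio \<theta> \<tau> \<omega> - ratio \<theta> \<sigma> \<omega>) \<partial>P)"
    by (rule bounded_convergence(1)[OF _ Ym increment_limit Yb]) measurable
  then show "(\<integral>\<omega>. W \<omega> * (ratio \<theta> \<tau> \<omega> - ratio \<theta> \<sigma> \<omega>) \<partial>P) = 0"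
    unfolding increment_mean_zero[OF W] by (simp add: LIMSEQ_const_iff)
  show "(\<lambda>N. \<integral>\<omega>. (Y W N \<omega>)\<^sup>2 \<partial>P) \<longlonglongrightarrow> (\<integral>\<omega>. (W \<omega>)\<^sup>2 * (ratio \<theta> \<tau> \<omega> - ratio \<theta> \<sigma> \<omega>)\<^sup>2 \<partial>P)"
  proof (rule bounded_convergence(1)[where C="(C * u)\<^sup>2"])
    show "AE \<omega> in P. (\<lambda>N. (Y W N \<omega>)\<^sup>2) \<longlonglongrightarrow> (W \<omega>)\<^sup>2 * (ratio \<theta> \<tau> \<omega> - ratio \<theta> \<sigma> \<omega>)\<^sup>2"
      using increment_limit[of W]
    proof eventually_elim
      case (elim \<omega>)
      from tendsto_power[OF elim, of 2] show ?case by (simp only: power_mult_distrib)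
    qed
    show "AE \<omega> in P. \<bar>(Y W N \<omega>)\<^sup>2\<bar> \<le> (C * u)\<^sup>2" for N
      using Yb[of N]
    proof eventually_elim
      case (elim \<omega>)
      then have "\<bar>Y W N \<omega>\<bar>\<^sup>2 \<le> (C * u)\<^sup>2" by (intro power_mono) auto
      then show ?case by simp
    qed
  qed measurable
qed

lemma ratio_bounds_end: "AE \<omega> in P. l \<le> ratio \<theta> \<tau> \<omega> \<and> ratio \<theta> \<tau> \<omega> \<le> u"
  using corridor[unfolded in_corridor_def] at_time_positive[of \<theta>] corridor_exit_finite AE_space
proof eventually_elim
  case (elim \<omega>)
  then have "ennreal (enn2real (\<tau> \<omega>)) = \<tau> \<omega>" by simp
  then have "l * at_time \<theta> \<omega> \<le> at_time \<tau> \<omega> \<and> at_time \<tau> \<omega> \<le> u * at_time \<theta> \<omega>"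
    using elim(1) le2[of \<omega>] elim(4) unfolding at_time_def[of \<tau>] space_P by (metis enn2real_nonneg order_refl)
  then show ?case using elim(2) by (simp add: ratio_def pos_le_divide_eq pos_divide_le_eq)
qed

text \<open>
  By optional stopping, a squared increment of a martingale may be exchanged for the increment of its square.
\<close>

lemma ratio_squares_integral:
  assumes H: "H \<in> sets (\<F>at \<sigma>)"
  shows "(\<lambda>N. \<integral>\<omega>. (Y (indicator H) N \<omega>)\<^sup>2 \<partial>P) \<longlonglongrightarrow> (\<integral>\<omega>. indicator H \<omega> * ((ratio \<theta> \<tau> \<omega>)\<^sup>2 - (ratio \<theta> \<sigma> \<omega>)\<^sup>2) \<partial>P)"
proof -
  have [measurable]: "H \<in> sets P" using H subalgebra_at[OF \<sigma>] unfolding subalgebra_def by blast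
  note [measurable] = ratio_measurable[OF \<theta> \<tau>] ratio_measurable[OF \<theta> \<sigma>]
  have Hm: "(indicator H :: _ \<Rightarrow> real) \<in> borel_measurable (\<F>at \<sigma>)" using H by measurable
  have Hb: "AE \<omega> in P. \<bar>indicator H \<omega> :: real\<bar> \<le> 1" by (auto simp: indicator_def)
  have rs: "ratio \<theta> \<sigma> \<in> borel_measurable (\<F>at \<sigma>)"
    using weight_measurable[OF at_time_measurable[OF \<sigma>]] unfolding ratio_def[abs_def] .
  have W: "(\<lambda>\<omega>. indicator H \<omega> * ratio \<theta> \<sigma> \<omega>) \<in> borel_measurable (\<F>at \<sigma>)" using Hm rs by measurable
  have Wb: "AE \<omega> in P. \<bar>indicator H \<omega> * ratio \<theta> \<sigma> \<omega>\<bar> \<le> u"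
    using ratio_bounds by eventually_elim (use l lu in \<open>auto simp: indicator_def\<close>)
  have bR: "ess_bounded (ratio \<theta> \<tau>)" "ess_bounded (ratio \<theta> \<sigma>)"
  proof -
    show "ess_bounded (ratio \<theta> \<tau>)"
      by (rule ess_boundedI[where C=u], measurable) (use ratio_bounds_end in \<open>eventually_elim, use l in linarith\<close>)
    show "ess_bounded (ratio \<theta> \<sigma>)"
      by (rule ess_boundedI[where C=u], measurable) (use ratio_bounds in \<open>eventually_elim, use l in linarith\<close>)
  qed
  have bH: "ess_bounded (indicator H)" by (rule ess_boundedI[OF _ Hb]) measurable
  note bd = ess_bounded_integrable ess_bounded_intros bR bH
  have "(\<integral>\<omega>. (indicator H \<omega>)\<^sup>2 * (ratio \<theta> \<tau> \<omega> - ratio \<theta> \<sigma> \<omega>)\<^sup>2 \<partial>P) =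
     (\<integral>\<omega>. indicator H \<omega> * ((ratio \<theta> \<tau> \<omega>)\<^sup>2 - (ratio \<theta> \<sigma> \<omega>)\<^sup>2) - 2 * ((indicator H \<omega> * ratio \<theta> \<sigma> \<omega>) * (ratio \<theta> \<tau> \<omega> - ratio \<theta> \<sigma> \<omega>)) \<partial>P)"
    by (intro Bochner_Integration.integral_cong) (auto simp: indicator_def power2_eq_square algebra_simps)
  also have "\<dots> = (\<integral>\<omega>. indicator H \<omega> * ((ratio \<theta> \<tau> \<omega>)\<^sup>2 - (ratio \<theta> \<sigma> \<omega>)\<^sup>2) \<partial>P)
     - (\<integral>\<omega>. 2 * ((indicator H \<omega> * ratio \<theta> \<sigma> \<omega>) * (ratio \<theta> \<tau> \<omega> - ratio \<theta> \<sigma> \<omega>)) \<partial>P)"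
    by (intro Bochner_Integration.integral_diff bd)
  also have "(\<integral>\<omega>. 2 * ((indicator H \<omega> * ratio \<theta> \<sigma> \<omega>) * (ratio \<theta> \<tau> \<omega> - ratio \<theta> \<sigma> \<omega>)) \<partial>P) = 0"
    using ratio_optional_stopping(1)[OF W Wb] by simp
  finally have "(\<integral>\<omega>. (indicator H \<omega>)\<^sup>2 * (ratio \<theta> \<tau> \<omega> - ratio \<theta> \<sigma> \<omega>)\<^sup>2 \<partial>P) =
     (\<integral>\<omega>. indicator H \<omega> * ((ratio \<theta> \<tau> \<omega>)\<^sup>2 - (ratio \<theta> \<sigma> \<omega>)\<^sup>2) \<partial>P)" by simp
  with ratio_optional_stopping(2)[OF Hm Hb] show ?thesis by simp
qed

lemma duration_bounds:
  assumes H: "H \<in> sets (\<F>at \<sigma>)"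
  shows "ennreal ((lo * l)\<^sup>2) * (\<integral>\<^sup>+\<omega>\<in>H. (\<tau> \<omega> - \<sigma> \<omega>) \<partial>P)
      \<le> ennreal (\<integral>\<omega>. indicator H \<omega> * ((ratio \<theta> \<tau> \<omega>)\<^sup>2 - (ratio \<theta> \<sigma> \<omega>)\<^sup>2) \<partial>P)" (is "?lower \<le> ennreal ?E")
    and "ennreal (\<integral>\<omega>. indicator H \<omega> * ((ratio \<theta> \<tau> \<omega>)\<^sup>2 - (ratio \<theta> \<sigma> \<omega>)\<^sup>2) \<partial>P)
      \<le> ennreal ((hi * u)\<^sup>2) * (\<integral>\<^sup>+\<omega>\<in>H. (\<tau> \<omega> - \<sigma> \<omega>) \<partial>P)" (is "_ \<le> ?upper")
proof -
  let ?d = "\<lambda>N. \<integral>\<omega>. indicator H \<omega> * dur N \<omega> \<partial>P"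
  let ?e = "\<lambda>N. \<integral>\<omega>. (Y (indicator H) N \<omega>)\<^sup>2 \<partial>P"
  have lim: "(\<lambda>N. ennreal (?e N)) \<longlonglongrightarrow> ennreal ?E"
    by (intro tendsto_ennrealI ratio_squares_integral[OF H])
  have dinc: "incseq (\<lambda>N. ennreal (?d N))"
  proof (rule incseq_SucI, rule ennreal_leI, rule integral_mono_AE[OF energy_duration_bounds(3)[OF H] energy_duration_bounds(3)[OF H]])
    fix N
    show "AE \<omega> in P. indicator H \<omega> * dur N \<omega> \<le> indicator H \<omega> * dur (Suc N) \<omega>"
      using \<sigma>_finite AE_space
    proof eventually_elim
      case (elim \<omega>)
      then have "incseq (\<lambda>N. ennreal (dur N \<omega>))" using ennreal_duration_SUP(2)[OF le2, of \<omega>] by (simp add: space_P)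
      from incseq_SucD[OF this, of N] have "dur N \<omega> \<le> dur (Suc N) \<omega>"
        using dur_bounds[of \<omega> "Suc N"] elim(2) by (simp add: space_P del: of_nat_Suc)
      then show ?case by (intro mult_left_mono) auto
    qed
  qed
  have dlim: "(\<lambda>N. ennreal (?d N)) \<longlonglongrightarrow> (\<integral>\<^sup>+\<omega>\<in>H. (\<tau> \<omega> - \<sigma> \<omega>) \<partial>P)"
    unfolding duration_as_SUP[OF H] by (rule LIMSEQ_SUP[OF dinc])
  have dnn: "0 \<le> ?d N" for N
    by (intro integral_nonneg_AE AE_I2 mult_nonneg_nonneg) (use dur_bounds in \<open>auto simp: space_P\<close>)
  show "?lower \<le> ennreal ?E"
  proof (rule LIMSEQ_le[OF ennreal_tendsto_cmult[OF _ dlim] lim])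
    show "\<exists>N. \<forall>n\<ge>N. ennreal ((lo * l)\<^sup>2) * ennreal (?d n) \<le> ennreal (?e n)"
      using energy_duration_bounds(1)[OF H] dnn by (auto simp: ennreal_mult[symmetric] intro!: ennreal_leI)
  qed simp
  show "ennreal ?E \<le> ?upper"
  proof (rule LIMSEQ_le[OF lim ennreal_tendsto_cmult[OF _ dlim]])
    show "\<exists>N. \<forall>n\<ge>N. ennreal (?e n) \<le> ennreal ((hi * u)\<^sup>2) * ennreal (?d n)"
      using energy_duration_bounds(2)[OF H] dnn by (auto simp: ennreal_mult[symmetric] intro!: ennreal_leI)
  qed simp
qed

end

end

section \<open>Exit and return times\<close>

lemma path_left_closure:
  assumes \<omega>: "\<omega> \<in> path_space" and at: "0 \<le> a" "a < t"
    and bd: "\<And>s. a \<le> s \<Longrightarrow> s < t \<Longrightarrow> m \<le> \<omega> s \<and> \<omega> s \<le> M"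
  shows "m \<le> \<omega> t \<and> \<omega> t \<le> M"
proof -
  let ?x = "\<lambda>n. t - (t - a) / real (Suc n)"
  have x: "a \<le> ?x n \<and> ?x n < t" for n
  proof -
    have "(t - a) / real (Suc n) \<le> (t - a) / 1" using at by (intro divide_left_mono) auto
    moreover have "0 < (t - a) / real (Suc n)" using at by simp
    ultimately show ?thesis by simp
  qed
  have "(\<lambda>n. t - (t - a) / real (Suc n)) \<longlonglongrightarrow> t - 0"
    by (intro tendsto_diff tendsto_const LIMSEQ_Suc[OF lim_const_over_n])
  then have "?x \<longlonglongrightarrow> t" by simp
  then have lim: "(\<lambda>n. \<omega> (?x n)) \<longlonglongrightarrow> \<omega> t"
    using at order_trans[OF at(1) conjunct1[OF x]] by (intro path_tendsto[OF \<omega>]) auto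
  show ?thesis using bd x by (intro conjI LIMSEQ_le_const[OF lim] LIMSEQ_le_const2[OF lim]) auto
qed

text \<open>
  The levels are set with \<open>\<bar>B\<^sub>\<theta>\<bar>\<close> instead of \<open>B\<^sub>\<theta>\<close>. On positive paths there is no difference, but on every
  path the exit time is then monotone in \<open>x\<close>, so that the stopping times are ordered everywhere and
  not only almost surely.
\<close>

definition exit_gap :: "real \<Rightarrow> ((real \<Rightarrow> real) \<Rightarrow> ennreal) \<Rightarrow> ((real \<Rightarrow> real) \<Rightarrow> real) \<Rightarrow> real \<Rightarrow> (real \<Rightarrow> real) \<Rightarrow> real" where
  "exit_gap h \<theta> x t \<omega> =
     min (at_time \<theta> \<omega> + (exp h - 1) * x \<omega> * \<bar>at_time \<theta> \<omega>\<bar> - \<omega> t)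
         (\<omega> t - (at_time \<theta> \<omega> - (1 - exp (- h)) * x \<omega> * \<bar>at_time \<theta> \<omega>\<bar>))"

definition return_gap :: "real \<Rightarrow> ((real \<Rightarrow> real) \<Rightarrow> ennreal) \<Rightarrow> real \<Rightarrow> (real \<Rightarrow> real) \<Rightarrow> real" where
  "return_gap h \<theta> t \<omega> = min \<bar>\<omega> t - at_time \<theta> \<omega>\<bar>
     (min (exp h * at_time \<theta> \<omega> - \<omega> t) (\<omega> t - exp (- h) * at_time \<theta> \<omega>))"

definition exit_time :: "real \<Rightarrow> ((real \<Rightarrow> real) \<Rightarrow> ennreal) \<Rightarrow> ((real \<Rightarrow> real) \<Rightarrow> real) \<Rightarrow> (real \<Rightarrow> real) \<Rightarrow> ennreal" where
  "exit_time h \<theta> x = first_hit \<theta> (exit_gap h \<theta> x)"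

definition return_time :: "real \<Rightarrow> ((real \<Rightarrow> real) \<Rightarrow> ennreal) \<Rightarrow> ((real \<Rightarrow> real) \<Rightarrow> real) \<Rightarrow> (real \<Rightarrow> real) \<Rightarrow> ennreal" where
  "return_time h \<theta> x = first_hit (exit_time h \<theta> x) (return_gap h \<theta>)"

lemma path_continuous_from:
  "\<omega> \<in> path_space \<Longrightarrow> continuous_on {t. 0 \<le> t \<and> r \<le> ennreal t} \<omega>"
  by (rule continuous_on_subset[of "{0..}"]) (auto simp: path_space_def)

lemma gap_continuous:
  assumes "\<omega> \<in> path_space"
  shows "continuous_on {t. 0 \<le> t \<and> r \<le> ennreal t} (\<lambda>t. exit_gap h \<theta> x t \<omega>)"
    and "continuous_on {t. 0 \<le> t \<and> r \<le> ennreal t} (\<lambda>t. return_gap h \<theta> t \<omega>)"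
  unfolding exit_gap_def return_gap_def
  by (intro continuous_intros path_continuous_from[OF assms])+

lemma exit_time_stopping:
  assumes \<theta>: "stopping \<theta>" and x: "x \<in> borel_measurable (\<F>at \<theta>)"
  shows "stopping (exit_time h \<theta> x)"
  unfolding exit_time_def
proof (rule first_hit_stopping[OF \<theta>])
  let ?u = "\<lambda>\<omega>. at_time \<theta> \<omega> + (exp h - 1) * x \<omega> * \<bar>at_time \<theta> \<omega>\<bar>"
  let ?l = "\<lambda>\<omega>. at_time \<theta> \<omega> - (1 - exp (- h)) * x \<omega> * \<bar>at_time \<theta> \<omega>\<bar>"
  note [measurable] = x at_time_measurable[OF \<theta>]
  have u: "?u \<in> borel_measurable (\<F>at \<theta>)" and l: "?l \<in> borel_measurable (\<F>at \<theta>)" by measurable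
  fix t :: real assume t: "0 \<le> t"
  note [measurable] = measurable_before[OF \<theta> u, of "ennreal t"] measurable_before[OF \<theta> l, of "ennreal t"]
    eval_measurable_F[OF t order_refl] stopping_timeD[OF \<theta>, of "ennreal t"]
  have "(\<lambda>\<omega>. if \<theta> \<omega> \<le> ennreal t then min ((if \<theta> \<omega> \<le> ennreal t then ?u \<omega> else 0) - \<omega> t) (\<omega> t - (if \<theta> \<omega> \<le> ennreal t then ?l \<omega> else 0)) else 0)
      \<in> borel_measurable (\<F> (ennreal t))" by measurable
  then show "(\<lambda>\<omega>. if \<theta> \<omega> \<le> ennreal t then exit_gap h \<theta> x t \<omega> else 0) \<in> borel_measurable (\<F> (ennreal t))"
    by (rule measurable_cong[THEN iffD1, rotated]) (simp add: exit_gap_def)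
qed (rule gap_continuous)

lemma theta_le_exit: "\<theta> \<omega> \<le> exit_time h \<theta> x \<omega>"
  unfolding exit_time_def by (rule first_hit_ge)

lemma exit_le_return: "exit_time h \<theta> x \<omega> \<le> return_time h \<theta> x \<omega>"
  unfolding return_time_def by (rule first_hit_ge)

lemma theta_le_return: "\<theta> \<omega> \<le> return_time h \<theta> x \<omega>"
  using theta_le_exit exit_le_return by (rule order_trans)

lemma return_time_stopping:
  assumes \<theta>: "stopping \<theta>" and x: "x \<in> borel_measurable (\<F>at \<theta>)"
  shows "stopping (return_time h \<theta> x)"
  unfolding return_time_def
proof (rule first_hit_stopping)
  show \<rho>: "stopping (exit_time h \<theta> x)" by (rule exit_time_stopping[OF \<theta> x])
  fix t :: real assume t: "0 \<le> t"
  have B: "at_time \<theta> \<in> borel_measurable (\<F>at (exit_time h \<theta> x))"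
    by (rule pre_sigma_measurable_mono[OF \<theta> \<rho> theta_le_exit at_time_measurable[OF \<theta>]])
  note [measurable] = measurable_before[OF \<rho> B, of "ennreal t"]
    eval_measurable_F[OF t order_refl] stopping_timeD[OF \<rho>, of "ennreal t"]
  let ?r = "\<lambda>\<omega>. exit_time h \<theta> x \<omega> \<le> ennreal t"
  let ?b = "\<lambda>\<omega>. if ?r \<omega> then at_time \<theta> \<omega> else 0"
  have "(\<lambda>\<omega>. if ?r \<omega> then min \<bar>\<omega> t - ?b \<omega>\<bar> (min (exp h * ?b \<omega> - \<omega> t) (\<omega> t - exp (- h) * ?b \<omega>)) else 0)
      \<in> borel_measurable (\<F> (ennreal t))" by measurable
  then show "(\<lambda>\<omega>. if ?r \<omega> then return_gap h \<theta> t \<omega> else 0) \<in> borel_measurable (\<F> (ennreal t))"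
    by (rule measurable_cong[THEN iffD1, rotated]) (simp add: return_gap_def)
qed (rule gap_continuous)

lemma exit_time_pointwise: "exit_time h \<theta> x \<omega> = exit_time h \<theta> (\<lambda>_. x \<omega>) \<omega>"
  by (simp add: exit_time_def first_hit_def exit_gap_def)

text \<open>
  The return time at a path depends on the level only through its value at that path. Random levels are
  therefore covered by a function of a real level and a path.
\<close>

lemma return_time_pointwise: "return_time h \<theta> x \<omega> = return_time h \<theta> (\<lambda>_. x \<omega>) \<omega>"
  by (simp add: return_time_def first_hit_def exit_time_pointwise[of h \<theta> x])

lemma first_hit_mono:
  assumes "\<theta> \<omega> \<le> \<theta>' \<omega>" "\<And>t. g t \<omega> \<le> g' t \<omega>"
  shows "first_hit \<theta> g \<omega> \<le> first_hit \<theta>' g' \<omega>"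
  unfolding first_hit_def using assms by (intro Inf_superset_mono) (auto intro: order_trans)

lemma return_time_mono:
  assumes h: "0 \<le> h" and xy: "x \<omega> \<le> y \<omega>"
  shows "return_time h \<theta> x \<omega> \<le> return_time h \<theta> y \<omega>"
  unfolding return_time_def
proof (rule first_hit_mono[OF _ order_refl], unfold exit_time_def, rule first_hit_mono[OF order_refl])
  fix t
  have "0 \<le> exp h - 1" "0 \<le> 1 - exp (- h)" using h by auto
  then have "(exp h - 1) * x \<omega> * \<bar>at_time \<theta> \<omega>\<bar> \<le> (exp h - 1) * y \<omega> * \<bar>at_time \<theta> \<omega>\<bar>"
    "(1 - exp (- h)) * x \<omega> * \<bar>at_time \<theta> \<omega>\<bar> \<le> (1 - exp (- h)) * y \<omega> * \<bar>at_time \<theta> \<omega>\<bar>"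
    using xy by (auto intro!: mult_right_mono mult_left_mono)
  then show "exit_gap h \<theta> x t \<omega> \<le> exit_gap h \<theta> y t \<omega>"
    unfolding exit_gap_def by (intro min.mono) auto
qed

lemma first_hit_immediate:
  assumes "g (enn2real (\<theta> \<omega>)) \<omega> \<le> 0"
  shows "first_hit \<theta> g \<omega> = \<theta> \<omega>"
proof (rule antisym[OF _ first_hit_ge])
  show "first_hit \<theta> g \<omega> \<le> \<theta> \<omega>"
  proof (cases "\<theta> \<omega>" rule: ennreal_cases)
    case (real r)
    then show ?thesis using assms unfolding first_hit_def by (intro Inf_lower) auto
  qed simp
qed

lemma return_time_zero: "return_time h \<theta> (\<lambda>_. 0) \<omega> = \<theta> \<omega>"
proof -
  have e: "exit_time h \<theta> (\<lambda>_. 0) \<omega> = \<theta> \<omega>"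
    unfolding exit_time_def by (rule first_hit_immediate) (simp add: at_time_def exit_gap_def)
  have "return_time h \<theta> (\<lambda>_. 0) \<omega> = exit_time h \<theta> (\<lambda>_. 0) \<omega>"
    unfolding return_time_def by (rule first_hit_immediate) (simp add: e at_time_def[of \<theta>] return_gap_def)
  then show ?thesis using e by simp
qed

text \<open>
  Before the exit time the path is between the two exit levels, and between exit and return it is
  inside the corridor and does not meet \<open>B\<^sub>\<theta>\<close>. Continuity extends the bounds to the end points, and by the
  intermediate value theorem the path stays on the side on which it left. For \<open>x = 0\<close> the exit time
  is already a return.
\<close>

lemma return_path:
  assumes \<omega>: "\<omega> \<in> path_space" and h: "0 \<le> h" and x: "0 \<le> x \<omega>" "x \<omega> \<le> 1"
    and fin: "\<theta> \<omega> < \<infinity>" and B: "0 < at_time \<theta> \<omega>"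
  defines "b \<equiv> at_time \<theta> \<omega>" and "\<rho> \<equiv> exit_time h \<theta> x" and "\<kappa> \<equiv> return_time h \<theta> x"
  shows "\<And>t. 0 \<le> t \<Longrightarrow> \<theta> \<omega> \<le> ennreal t \<Longrightarrow> ennreal t \<le> \<kappa> \<omega> \<Longrightarrow> exp (- h) * b \<le> \<omega> t \<and> \<omega> t \<le> exp h * b"
    and "\<rho> \<omega> < \<infinity> \<Longrightarrow> at_time \<rho> \<omega> = (1 + (exp h - 1) * x \<omega>) * b \<or> at_time \<rho> \<omega> = (1 - (1 - exp (- h)) * x \<omega>) * b"
    and "\<kappa> \<omega> < \<infinity> \<Longrightarrow> at_time \<kappa> \<omega> = b \<or> (b \<le> at_time \<rho> \<omega> \<and> at_time \<kappa> \<omega> = exp h * b) \<or> (at_time \<rho> \<omega> < b \<and> at_time \<kappa> \<omega> = exp (- h) * b)"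
proof -
  define a where "a = enn2real (\<theta> \<omega>)"
  have a: "\<theta> \<omega> = ennreal a" "0 \<le> a" using fin by (auto simp: a_def)
  have ba: "\<omega> a = b" unfolding b_def a_def at_time_def ..
  have b0: "0 < b" using B by (simp add: b_def)
  let ?u = "(1 + (exp h - 1) * x \<omega>) * b" and ?l = "(1 - (1 - exp (- h)) * x \<omega>) * b"
  have U: "0 \<le> exp h - 1" "0 \<le> 1 - exp (- h)" using h by auto
  note mult_left_mono[OF x(2) U(1)] mult_left_mono[OF x(2) U(2)]
  then have lev: "?u \<le> exp h * b" "exp (- h) * b \<le> ?l"
    using b0 by (auto intro!: mult_right_mono)
  have "0 \<le> (exp h - 1) * x \<omega>" "0 \<le> (1 - exp (- h)) * x \<omega>"
    using x U by (auto intro!: mult_nonneg_nonneg)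
  then have "1 * b \<le> ?u" "?l \<le> 1 * b"
    using b0 by (intro mult_right_mono; simp)+
  then have levb: "b \<le> ?u" "?l \<le> b" by simp_all
  have ex_eq: "at_time \<theta> \<omega> + (exp h - 1) * x \<omega> * \<bar>at_time \<theta> \<omega>\<bar> = ?u"
    "at_time \<theta> \<omega> - (1 - exp (- h)) * x \<omega> * \<bar>at_time \<theta> \<omega>\<bar> = ?l"
    using B unfolding b_def by (auto simp: algebra_simps)
  have before_\<rho>: "?l < \<omega> t \<and> \<omega> t < ?u" if "0 \<le> t" "\<theta> \<omega> \<le> ennreal t" "ennreal t < \<rho> \<omega>" for t
    using first_hit_before[OF that(1,2) that(3)[unfolded \<rho>_def exit_time_def]] unfolding exit_gap_def ex_eq by simp
  have before_\<kappa>: "\<omega> t \<noteq> b \<and> exp (- h) * b < \<omega> t \<and> \<omega> t < exp h * b" if "0 \<le> t" "\<rho> \<omega> \<le> ennreal t" "ennreal t < \<kappa> \<omega>" for t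
    using first_hit_before[OF that(1) that(2)[unfolded \<rho>_def] that(3)[unfolded \<kappa>_def return_time_def]]
    unfolding return_gap_def b_def[symmetric] by auto
  have strict: "exp (- h) * b \<le> \<omega> t \<and> \<omega> t \<le> exp h * b" if t: "0 \<le> t" "\<theta> \<omega> \<le> ennreal t" "ennreal t < \<kappa> \<omega>" for t
  proof (cases "ennreal t < \<rho> \<omega>")
    case True then show ?thesis using before_\<rho>[OF t(1,2)] lev by linarith
  next
    case False
    then have "\<rho> \<omega> \<le> ennreal t" by simp
    from before_\<kappa>[OF t(1) this t(3)] show ?thesis by simp
  qed
  have eb: "exp (- h) * b \<le> b" "b \<le> exp h * b" using b0 h by (auto simp: mult_le_cancel_right2 mult_le_cancel_right1)
  show corridor: "exp (- h) * b \<le> \<omega> t \<and> \<omega> t \<le> exp h * b" if t: "0 \<le> t" "\<theta> \<omega> \<le> ennreal t" "ennreal t \<le> \<kappa> \<omega>" for t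
  proof (cases "t = a")
    case True then show ?thesis using ba eb by simp
  next
    case False
    then have at: "a < t" using t a by simp
    show ?thesis
    proof (rule path_left_closure[OF \<omega> a(2) at])
      fix s assume s: "a \<le> s" "s < t"
      then have "ennreal s < ennreal t" using a by (simp add: ennreal_less_iff)
      then have "ennreal s < \<kappa> \<omega>" using t(3) by simp
      moreover have "\<theta> \<omega> \<le> ennreal s" using s a by (simp add: ennreal_leI)
      ultimately show "exp (- h) * b \<le> \<omega> s \<and> \<omega> s \<le> exp h * b" using s a by (intro strict) auto
    qed
  qed
  show exit_value: "at_time \<rho> \<omega> = ?u \<or> at_time \<rho> \<omega> = ?l" if \<rho>fin: "\<rho> \<omega> < \<infinity>"
  proof -
    define r where "r = enn2real (\<rho> \<omega>)"
    have r: "\<rho> \<omega> = ennreal r" "0 \<le> r" using \<rho>fin by (auto simp: r_def)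
    have ar: "a \<le> r" using theta_le_exit[of \<theta> \<omega> h x] r a unfolding \<rho>_def by simp
    have "exit_gap h \<theta> x r \<omega> \<le> 0"
      using first_hit_attained[OF gap_continuous(1)[OF \<omega>] \<rho>fin[unfolded \<rho>_def exit_time_def]]
      unfolding r_def \<rho>_def exit_time_def .
    then have "min (?u - \<omega> r) (\<omega> r - ?l) \<le> 0" unfolding exit_gap_def ex_eq .
    moreover have "?l \<le> \<omega> r \<and> \<omega> r \<le> ?u"
    proof (cases "r = a")
      case True then show ?thesis using ba levb by simp
    next
      case False
      then have at: "a < r" using ar by simp
      show ?thesis
      proof (rule path_left_closure[OF \<omega> a(2) at])
        fix s assume s: "a \<le> s" "s < r"
        then have "ennreal s < \<rho> \<omega>" using a r by (simp add: ennreal_less_iff)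
        moreover have "\<theta> \<omega> \<le> ennreal s" using s a by (simp add: ennreal_leI)
        ultimately show "?l \<le> \<omega> s \<and> \<omega> s \<le> ?u" using s a before_\<rho>[of s] by auto
      qed
    qed
    ultimately show ?thesis unfolding at_time_def r_def[symmetric] by (auto simp: min_def split: if_splits)
  qed
  show "at_time \<kappa> \<omega> = b \<or> (b \<le> at_time \<rho> \<omega> \<and> at_time \<kappa> \<omega> = exp h * b) \<or> (at_time \<rho> \<omega> < b \<and> at_time \<kappa> \<omega> = exp (- h) * b)"
    if \<kappa>fin: "\<kappa> \<omega> < \<infinity>"
  proof -
    define k where "k = enn2real (\<kappa> \<omega>)"
    have k: "\<kappa> \<omega> = ennreal k" "0 \<le> k" using \<kappa>fin by (auto simp: k_def)
    have \<rho>\<kappa>: "\<rho> \<omega> \<le> \<kappa> \<omega>" unfolding \<rho>_def \<kappa>_def by (rule exit_le_return)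
    define r where "r = enn2real (\<rho> \<omega>)"
    have r: "\<rho> \<omega> = ennreal r" "0 \<le> r" using le_less_trans[OF \<rho>\<kappa> \<kappa>fin] by (auto simp: r_def)
    have rk: "r \<le> k" using \<rho>\<kappa> r k by simp
    have boundary: "u = v \<or> u = p \<or> u = q" if "min \<bar>u - v\<bar> (min (p - u) (u - q)) \<le> 0" "q \<le> u \<and> u \<le> p" for u v p q :: real
      using that by (auto simp: min_le_iff_disj)
    have "return_gap h \<theta> k \<omega> \<le> 0"
      using first_hit_attained[OF gap_continuous(2)[OF \<omega>] \<kappa>fin[unfolded \<kappa>_def return_time_def]]
      unfolding k_def \<kappa>_def return_time_def .
    then have "min \<bar>\<omega> k - b\<bar> (min (exp h * b - \<omega> k) (\<omega> k - exp (- h) * b)) \<le> 0"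
      unfolding return_gap_def b_def .
    moreover have "exp (- h) * b \<le> \<omega> k \<and> \<omega> k \<le> exp h * b"
    proof (rule corridor[OF k(2)])
      show "\<theta> \<omega> \<le> ennreal k" unfolding k(1)[symmetric] \<kappa>_def by (rule theta_le_return)
      show "ennreal k \<le> \<kappa> \<omega>" unfolding k(1) ..
    qed
    ultimately have three: "\<omega> k = b \<or> \<omega> k = exp h * b \<or> \<omega> k = exp (- h) * b"
      by (rule boundary)
    have cont: "continuous_on {r..k} \<omega>"
    proof (rule continuous_on_subset)
      show "continuous_on {0..} \<omega>" using \<omega> by (simp add: path_space_def)
      show "{r..k} \<subseteq> {0..}" using r(2) by auto
    qed
    have side: "(b \<le> \<omega> r \<longrightarrow> b \<le> \<omega> k) \<and> (\<omega> r < b \<longrightarrow> \<omega> k \<le> b)"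
    proof (intro conjI impI; rule ccontr)
      assume 1: "b \<le> \<omega> r" "\<not> b \<le> \<omega> k"
      obtain s where s: "r \<le> s" "s \<le> k" "\<omega> s = b"
        using IVT2'[of \<omega> k b r] 1 rk cont by auto
      with 1 have "s < k" by (cases "s = k") auto
      then show False using before_\<kappa>[of s] s r k by (auto simp: ennreal_leI ennreal_less_iff)
    next
      assume 1: "\<omega> r < b" "\<not> \<omega> k \<le> b"
      obtain s where s: "r \<le> s" "s \<le> k" "\<omega> s = b"
        using IVT'[of \<omega> r b k] 1 rk cont by auto
      with 1 have "s < k" by (cases "s = k") auto
      then show False using before_\<kappa>[of s] s r k by (auto simp: ennreal_leI ennreal_less_iff)
    qed
    have "at_time \<kappa> \<omega> = \<omega> k" "at_time \<rho> \<omega> = \<omega> r" unfolding at_time_def k_def r_def by auto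
    then show ?thesis using three side eb by auto
  qed
qed

section \<open>The level that yields the prescribed duration\<close>

definition admissible :: "((real \<Rightarrow> real) \<Rightarrow> ennreal) \<Rightarrow> ((real \<Rightarrow> real) \<Rightarrow> real) \<Rightarrow> bool" where
  "admissible \<theta> x \<longleftrightarrow> x \<in> borel_measurable (\<F>at \<theta>) \<and> (\<forall>\<omega>\<in>path_space. x \<omega> \<in> {0..1})"

lemma admissible_const: "0 \<le> c \<Longrightarrow> c \<le> 1 \<Longrightarrow> admissible \<theta> (\<lambda>_. c)"
  by (simp add: admissible_def)

text \<open>
  This is the conditional expectation of \<open>R\<^sup>2 - 1\<close> at the first exit from the corridor, i.e. for level 1.
\<close>

definition level_gap :: "real \<Rightarrow> real" where
  "level_gap h = (exp h - 1) * (1 - exp (- h))"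

lemma level_gap_pos: "0 < h \<Longrightarrow> 0 < level_gap h"
  by (simp add: level_gap_def)

context bounded_volatility
begin

context
  fixes \<theta> :: "(real \<Rightarrow> real) \<Rightarrow> ennreal" and h :: real
  assumes \<theta>: "stopping \<theta>" and h: "0 < h" and \<theta>_finite: "AE \<omega> in P. \<theta> \<omega> < \<infinity>"
begin

abbreviation \<rho> :: "((real \<Rightarrow> real) \<Rightarrow> real) \<Rightarrow> (real \<Rightarrow> real) \<Rightarrow> ennreal" where "\<rho> \<equiv> exit_time h \<theta>"
abbreviation \<kappa> :: "((real \<Rightarrow> real) \<Rightarrow> real) \<Rightarrow> (real \<Rightarrow> real) \<Rightarrow> ennreal" where "\<kappa> \<equiv> return_time h \<theta>"

lemma exp_order: "0 < exp (- h)" "exp (- h) \<le> exp h" using h by auto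

lemma exit_stopping: "admissible \<theta> x \<Longrightarrow> stopping (\<rho> x)"
  by (rule exit_time_stopping[OF \<theta>]) (simp add: admissible_def)

lemma return_stopping: "admissible \<theta> x \<Longrightarrow> stopping (\<kappa> x)"
  by (rule return_time_stopping[OF \<theta>]) (simp add: admissible_def)

lemma corridor_until_return:
  assumes x: "admissible \<theta> x" and le: "\<And>\<omega>. \<omega> \<in> path_space \<Longrightarrow> \<theta> \<omega> \<le> \<sigma> \<omega>" "\<And>\<omega>. \<omega> \<in> path_space \<Longrightarrow> \<tau> \<omega> \<le> \<kappa> x \<omega>"
  shows "in_corridor (exp (- h)) (exp h) \<theta> \<sigma> \<tau>"
  unfolding in_corridor_def using at_time_positive[of \<theta>] \<theta>_finite AE_space
proof eventually_elim
  case (elim \<omega>)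
  then have \<omega>: "\<omega> \<in> path_space" by (simp add: space_P)
  have x01: "0 \<le> x \<omega>" "x \<omega> \<le> 1" using x \<omega> by (auto simp: admissible_def)
  show ?case
  proof (intro allI impI, elim conjE)
    fix t assume t: "0 \<le> t" "\<sigma> \<omega> \<le> ennreal t" "ennreal t \<le> \<tau> \<omega>"
    show "exp (- h) * at_time \<theta> \<omega> \<le> \<omega> t \<and> \<omega> t \<le> exp h * at_time \<theta> \<omega>"
      by (rule return_path(1)[OF \<omega> less_imp_le[OF h] x01 elim(2,1) t(1) order_trans[OF le(1)[OF \<omega>] t(2)] order_trans[OF t(3) le(2)[OF \<omega>]]])
  qed
qed

lemma return_finite:
  assumes x: "admissible \<theta> x" shows "AE \<omega> in P. \<kappa> x \<omega> < \<infinity>"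
  by (rule corridor_exit_finite[OF \<theta> \<theta> return_stopping[OF x] order_refl theta_le_return exp_order
        corridor_until_return[OF x order_refl order_refl] \<theta>_finite])

lemma exit_finite:
  assumes x: "admissible \<theta> x" shows "AE \<omega> in P. \<rho> x \<omega> < \<infinity>"
  using return_finite[OF x] by eventually_elim (rule le_less_trans[OF exit_le_return])

lemma ratio_self: "AE \<omega> in P. ratio \<theta> \<theta> \<omega> = 1"
  using at_time_positive[of \<theta>] by eventually_elim (simp add: ratio_def)

lemma ratio_values:
  assumes x: "admissible \<theta> x"
  shows "AE \<omega> in P. (ratio \<theta> (\<rho> x) \<omega> = 1 + (exp h - 1) * x \<omega> \<or> ratio \<theta> (\<rho> x) \<omega> = 1 - (1 - exp (- h)) * x \<omega>) \<and>
     (ratio \<theta> (\<kappa> x) \<omega> = 1 \<or> 1 \<le> ratio \<theta> (\<rho> x) \<omega> \<and> ratio \<theta> (\<kappa> x) \<omega> = exp h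
       \<or> ratio \<theta> (\<rho> x) \<omega> < 1 \<and> ratio \<theta> (\<kappa> x) \<omega> = exp (- h))"
  using at_time_positive[of \<theta>] \<theta>_finite exit_finite[OF x] return_finite[OF x] AE_space
proof eventually_elim
  case (elim \<omega>)
  then have \<omega>: "\<omega> \<in> path_space" by (simp add: space_P)
  have x01: "0 \<le> x \<omega>" "x \<omega> \<le> 1" using x \<omega> by (auto simp: admissible_def)
  note rp = return_path(2,3)[where x=x and \<theta>=\<theta> and h=h, OF \<omega> less_imp_le[OF h] x01 elim(2,1)]
  have r: "ratio \<theta> \<tau> \<omega> = k \<longleftrightarrow> at_time \<tau> \<omega> = k * at_time \<theta> \<omega>" for \<tau> k
    using elim(1) by (auto simp: ratio_def divide_eq_eq)
  have r1: "1 \<le> ratio \<theta> (\<rho> x) \<omega> \<longleftrightarrow> at_time \<theta> \<omega> \<le> at_time (\<rho> x) \<omega>"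
    "ratio \<theta> (\<rho> x) \<omega> < 1 \<longleftrightarrow> at_time (\<rho> x) \<omega> < at_time \<theta> \<omega>"
    using elim(1) by (auto simp: ratio_def)
  show ?case unfolding r r1 using rp(1)[OF elim(3)] rp(2)[OF elim(4)] by auto
qed

lemma prior_sets_mono:
  assumes "stopping \<tau>" "\<And>\<omega>. \<theta> \<omega> \<le> \<tau> \<omega>" "H \<in> sets (\<F>at \<theta>)" shows "H \<in> sets (\<F>at \<tau>)"
  using canonical.mono_pre_sigma[OF \<theta> assms(1)] assms(2,3) by blast

lemma ratio_ess_bounded:
  assumes x: "admissible \<theta> x" shows "ess_bounded (ratio \<theta> (\<kappa> x))" "ess_bounded (ratio \<theta> (\<rho> x))"
proof -
  have e: "exp (- h) \<le> 1" "1 \<le> exp h" "0 < exp (- h)" using h by auto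
  show "ess_bounded (ratio \<theta> (\<kappa> x))"
  proof (rule ess_boundedI[OF ratio_measurable[OF \<theta> return_stopping[OF x]], where C="exp h"])
    show "AE \<omega> in P. \<bar>ratio \<theta> (\<kappa> x) \<omega>\<bar> \<le> exp h"
      using ratio_values[OF x] by eventually_elim (use e in auto)
  qed
  show "ess_bounded (ratio \<theta> (\<rho> x))"
  proof (rule ess_boundedI[where C="exp h"])
    show "ratio \<theta> (\<rho> x) \<in> borel_measurable P" by (rule ratio_measurable[OF \<theta> exit_stopping[OF x]])
    show "AE \<omega> in P. \<bar>ratio \<theta> (\<rho> x) \<omega>\<bar> \<le> exp h"
      using ratio_values[OF x] AE_space
    proof eventually_elim
      case (elim \<omega>)
      have x01: "0 \<le> x \<omega>" "x \<omega> \<le> 1" using x elim(2) by (auto simp: admissible_def space_P)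
      have nn: "0 \<le> exp h - 1" "0 \<le> 1 - exp (- h)" using e by auto
      note f = mult_left_mono[OF x01(2) nn(1)] mult_left_mono[OF x01(2) nn(2)]
        mult_nonneg_nonneg[OF nn(1) x01(1)] mult_nonneg_nonneg[OF nn(2) x01(1)]
      from conjunct1[OF elim(1)] show ?case
      proof
        assume R: "ratio \<theta> (\<rho> x) \<omega> = 1 + (exp h - 1) * x \<omega>"
        have "0 \<le> ratio \<theta> (\<rho> x) \<omega>" "ratio \<theta> (\<rho> x) \<omega> \<le> exp h" using R f(1,3) by simp_all
        then show ?thesis by simp
      next
        assume R: "ratio \<theta> (\<rho> x) \<omega> = 1 - (1 - exp (- h)) * x \<omega>"
        have "(1 - exp (- h)) * x \<omega> \<le> 1 - exp (- h)" using f(2) by simp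
        then have "0 \<le> ratio \<theta> (\<rho> x) \<omega>" "ratio \<theta> (\<rho> x) \<omega> \<le> 1" using R f(4) e(3) by linarith+
        then show ?thesis using e(2) by linarith
      qed
    qed
  qed
qed

lemma x_ess_bounded: "admissible \<theta> x \<Longrightarrow> ess_bounded x"
  by (rule ess_boundedI[where C=1]) (auto simp: admissible_def space_P intro: at_measurable_P[OF \<theta>])

lemma indicator_ess_bounded: "H \<in> sets (\<F>at \<theta>) \<Longrightarrow> ess_bounded (indicator H)"
  using subalgebra_at[OF \<theta>] by (intro ess_boundedI[where C=1]) (auto simp: subalgebra_def indicator_def)

lemma exit_mean:
  assumes x: "admissible \<theta> x" and H: "H \<in> sets (\<F>at \<theta>)"
  shows "(\<integral>\<omega>. indicator H \<omega> * (ratio \<theta> (\<rho> x) \<omega> - 1) \<partial>P) = 0"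
proof -
  have HF: "(indicator H :: _ \<Rightarrow> real) \<in> borel_measurable (\<F>at \<theta>)" using H by measurable
  have "(\<integral>\<omega>. indicator H \<omega> * (ratio \<theta> (\<rho> x) \<omega> - ratio \<theta> \<theta> \<omega>) \<partial>P) = 0"
    by (rule ratio_optional_stopping(1)[OF \<theta> \<theta> exit_stopping[OF x] order_refl theta_le_exit exp_order
        corridor_until_return[OF x order_refl exit_le_return] \<theta>_finite HF, where C=1]) (auto simp: indicator_def)
  moreover have "(\<integral>\<omega>. indicator H \<omega> * (ratio \<theta> (\<rho> x) \<omega> - 1) \<partial>P) = (\<integral>\<omega>. indicator H \<omega> * (ratio \<theta> (\<rho> x) \<omega> - ratio \<theta> \<theta> \<omega>) \<partial>P)"
  proof (rule integral_cong_AE)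
    show "AE \<omega> in P. indicator H \<omega> * (ratio \<theta> (\<rho> x) \<omega> - 1) = indicator H \<omega> * (ratio \<theta> (\<rho> x) \<omega> - ratio \<theta> \<theta> \<omega>)"
      using ratio_self by eventually_elim simp
    have "ess_bounded (ratio \<theta> \<theta>)"
      by (rule ess_boundedI[where C=1, OF ratio_measurable[OF \<theta> \<theta>]])
         (use ratio_self in \<open>eventually_elim, simp\<close>)
    then show "(\<lambda>\<omega>. indicator H \<omega> * (ratio \<theta> (\<rho> x) \<omega> - 1)) \<in> borel_measurable P"
      "(\<lambda>\<omega>. indicator H \<omega> * (ratio \<theta> (\<rho> x) \<omega> - ratio \<theta> \<theta> \<omega>)) \<in> borel_measurable P"
      using ratio_ess_bounded(2)[OF x] indicator_ess_bounded[OF H] unfolding ess_bounded_def by auto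
  qed
  ultimately show ?thesis by simp
qed

text \<open>
  Since \<open>R\<close> ends in \<open>{1, e\<^sup>h}\<close> or in \<open>{e\<^bsup>-h\<^esup>, 1}\<close>, according to the side of the exit, \<open>R\<^sup>2 - 1 = w (R - 1)\<close> with a
  factor \<open>w\<close> that is known at the exit time. Optional stopping replaces the final value of \<open>R\<close> by its value
  at the exit, which is one of two numbers that depend on \<open>x\<close>; there \<open>w (R - 1)\<close> is an affine function of
  \<open>R - 1\<close> and \<open>x\<close>, and \<open>R - 1\<close> has mean 0. The exit levels are linear in \<open>x\<close> to make the result linear in \<open>x\<close>.
\<close>

lemma return_means:
  assumes x: "admissible \<theta> x" and H: "H \<in> sets (\<F>at \<theta>)"
  shows "(\<integral>\<omega>. indicator H \<omega> * (ratio \<theta> (\<kappa> x) \<omega> - 1) \<partial>P) = 0"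
    and "(\<integral>\<omega>. indicator H \<omega> * ((ratio \<theta> (\<kappa> x) \<omega>)\<^sup>2 - 1) \<partial>P) = level_gap h * (\<integral>\<omega>. indicator H \<omega> * x \<omega> \<partial>P)"
proof -
  let ?R = "ratio \<theta> (\<rho> x)" and ?K = "ratio \<theta> (\<kappa> x)"
  note bd = ess_bounded_integrable ess_bounded_intros ratio_ess_bounded[OF x] x_ess_bounded[OF x] indicator_ess_bounded[OF H]
  have \<rho>: "stopping (\<rho> x)" and \<kappa>: "stopping (\<kappa> x)" by (rule exit_stopping[OF x] return_stopping[OF x])+
  have opt: "(\<integral>\<omega>. W \<omega> * (?K \<omega> - ?R \<omega>) \<partial>P) = 0"
    if "W \<in> borel_measurable (\<F>at (\<rho> x))" "AE \<omega> in P. \<bar>W \<omega>\<bar> \<le> C" for W C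
    by (rule ratio_optional_stopping(1)[OF \<theta> \<rho> \<kappa> theta_le_exit exit_le_return exp_order
        corridor_until_return[where \<sigma>="\<rho> x" and \<tau>="\<kappa> x", OF x theta_le_exit order_refl] exit_finite[OF x] that])
  have H\<rho>: "H \<in> sets (\<F>at (\<rho> x))" by (rule prior_sets_mono[OF \<rho> theta_le_exit H])
  have IH [measurable]: "(indicator H :: _ \<Rightarrow> real) \<in> borel_measurable (\<F>at (\<rho> x))" using H\<rho> by measurable
  have R [measurable]: "?R \<in> borel_measurable (\<F>at (\<rho> x))"
    unfolding ratio_def[abs_def]
    using at_time_measurable[OF \<rho>] pre_sigma_measurable_mono[OF \<theta> \<rho> theta_le_exit at_time_measurable[OF \<theta>]]
    by measurable
  have "(\<integral>\<omega>. indicator H \<omega> * (?K \<omega> - 1) \<partial>P) =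
    (\<integral>\<omega>. indicator H \<omega> * (?K \<omega> - ?R \<omega>) + indicator H \<omega> * (?R \<omega> - 1) \<partial>P)"
    by (intro Bochner_Integration.integral_cong) (auto simp: algebra_simps)
  also have "\<dots> = (\<integral>\<omega>. indicator H \<omega> * (?K \<omega> - ?R \<omega>) \<partial>P) + (\<integral>\<omega>. indicator H \<omega> * (?R \<omega> - 1) \<partial>P)"
    by (intro Bochner_Integration.integral_add bd)
  also have "\<dots> = 0" using opt[OF IH, of 1] exit_mean[OF x H] by (auto simp: indicator_def)
  finally show "(\<integral>\<omega>. indicator H \<omega> * (?K \<omega> - 1) \<partial>P) = 0" .
  define w where "w = (\<lambda>\<omega>. if 1 \<le> ?R \<omega> then 1 + exp h else 1 + exp (- h))"
  have W: "(\<lambda>\<omega>. indicator H \<omega> * w \<omega>) \<in> borel_measurable (\<F>at (\<rho> x))" unfolding w_def by measurable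
  have e: "exp (- h) \<le> 1" "1 \<le> exp h" "0 < exp (- h)" using h by auto
  have Wb: "AE \<omega> in P. \<bar>indicator H \<omega> * w \<omega>\<bar> \<le> 1 + exp h"
    using e by (auto simp: w_def indicator_def)
  have bW: "ess_bounded (\<lambda>\<omega>. indicator H \<omega> * w \<omega>)"
    by (rule ess_boundedI[OF at_measurable_P[OF \<rho> W] Wb])
  have pt: "AE \<omega> in P. indicator H \<omega> * ((?K \<omega>)\<^sup>2 - 1) = indicator H \<omega> * w \<omega> * (?K \<omega> - ?R \<omega>) +
      ((exp h + exp (- h)) * (indicator H \<omega> * (?R \<omega> - 1)) + level_gap h * (indicator H \<omega> * x \<omega>))"
    using ratio_values[OF x] AE_space
  proof eventually_elim
    case (elim \<omega>)
    have x0: "0 \<le> x \<omega>" using x elim(2) by (auto simp: admissible_def space_P)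
    have a: "w \<omega> * (?K \<omega> - 1) = (?K \<omega>)\<^sup>2 - 1"
      using elim(1) unfolding w_def by (auto simp: power2_eq_square algebra_simps)
    have b: "w \<omega> * (?R \<omega> - 1) = (exp h + exp (- h)) * (?R \<omega> - 1) + level_gap h * x \<omega>"
    proof (cases "x \<omega> = 0")
      case True
      then show ?thesis using elim(1) by auto
    next
      case False
      then have "0 < (exp h - 1) * x \<omega>" "0 < (1 - exp (- h)) * x \<omega>" using x0 h by auto
      then consider "?R \<omega> = 1 + (exp h - 1) * x \<omega>" "1 \<le> ?R \<omega>" | "?R \<omega> = 1 - (1 - exp (- h)) * x \<omega>" "\<not> 1 \<le> ?R \<omega>"
        using elim(1) by linarith
      then show ?thesis
      proof cases
        case 1
        have "w \<omega> = 1 + exp h" using 1(2) by (simp add: w_def)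
        then show ?thesis unfolding 1(1) level_gap_def by (simp add: algebra_simps)
      next
        case 2
        have "w \<omega> = 1 + exp (- h)" using 2(2) by (simp add: w_def)
        then show ?thesis unfolding 2(1) level_gap_def by (simp add: algebra_simps)
      qed
    qed
    have "w \<omega> * (?K \<omega> - ?R \<omega>) = w \<omega> * (?K \<omega> - 1) - w \<omega> * (?R \<omega> - 1)" by (simp add: algebra_simps)
    then have "(?K \<omega>)\<^sup>2 - 1 = w \<omega> * (?K \<omega> - ?R \<omega>) + ((exp h + exp (- h)) * (?R \<omega> - 1) + level_gap h * x \<omega>)"
      unfolding a b by linarith
    then show ?case by (auto simp: indicator_def)
  qed
  have "(\<integral>\<omega>. indicator H \<omega> * ((?K \<omega>)\<^sup>2 - 1) \<partial>P) = (\<integral>\<omega>. indicator H \<omega> * w \<omega> * (?K \<omega> - ?R \<omega>) +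
      ((exp h + exp (- h)) * (indicator H \<omega> * (?R \<omega> - 1)) + level_gap h * (indicator H \<omega> * x \<omega>)) \<partial>P)"
    by (rule integral_cong_AE[OF _ _ pt]; rule borel_measurable_integrable; intro bd bW)
  also have "\<dots> = (\<integral>\<omega>. indicator H \<omega> * w \<omega> * (?K \<omega> - ?R \<omega>) \<partial>P) +
      ((\<integral>\<omega>. (exp h + exp (- h)) * (indicator H \<omega> * (?R \<omega> - 1)) \<partial>P) + (\<integral>\<omega>. level_gap h * (indicator H \<omega> * x \<omega>) \<partial>P))"
    by (subst Bochner_Integration.integral_add Bochner_Integration.integral_add, (intro bd bW)+)+ simp
  also have "\<dots> = level_gap h * (\<integral>\<omega>. indicator H \<omega> * x \<omega> \<partial>P)"
    using opt[OF W Wb] exit_mean[OF x H] by simp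
  finally show "(\<integral>\<omega>. indicator H \<omega> * ((?K \<omega>)\<^sup>2 - 1) \<partial>P) = level_gap h * (\<integral>\<omega>. indicator H \<omega> * x \<omega> \<partial>P)" .
qed

text \<open>
  This makes the expected duration a Lipschitz function of the level.
\<close>

lemma duration_between_returns:
  assumes x: "admissible \<theta> x" and y: "admissible \<theta> y" and xy: "\<And>\<omega>. \<omega> \<in> path_space \<Longrightarrow> x \<omega> \<le> y \<omega>"
    and H: "H \<in> sets (\<F>at \<theta>)"
  shows "ennreal ((lo * exp (- h))\<^sup>2) * (\<integral>\<^sup>+\<omega>\<in>H. (\<kappa> y \<omega> - \<kappa> x \<omega>) \<partial>P)
    \<le> ennreal (level_gap h * (\<integral>\<omega>. indicator H \<omega> * (y \<omega> - x \<omega>) \<partial>P))"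
proof -
  let ?X = "ratio \<theta> (\<kappa> x)" and ?Y = "ratio \<theta> (\<kappa> y)"
  note bd = ess_bounded_integrable ess_bounded_intros ratio_ess_bounded[OF x] ratio_ess_bounded[OF y]
    x_ess_bounded[OF x] x_ess_bounded[OF y] indicator_ess_bounded[OF H]
  have mono: "\<kappa> x \<omega> \<le> \<kappa> y \<omega>" if "\<omega> \<in> path_space" for \<omega>
    using h xy[OF that] by (intro return_time_mono) auto
  have H': "H \<in> sets (\<F>at (\<kappa> x))" by (rule prior_sets_mono[OF return_stopping[OF x] theta_le_return H])
  have "ennreal ((lo * exp (- h))\<^sup>2) * (\<integral>\<^sup>+\<omega>\<in>H. (\<kappa> y \<omega> - \<kappa> x \<omega>) \<partial>P)
      \<le> ennreal (\<integral>\<omega>. indicator H \<omega> * ((?Y \<omega>)\<^sup>2 - (?X \<omega>)\<^sup>2) \<partial>P)"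
    by (rule duration_bounds(1)[OF \<theta> return_stopping[OF x] return_stopping[OF y] theta_le_return mono exp_order
          corridor_until_return[where \<sigma>="\<kappa> x" and \<tau>="\<kappa> y", OF y theta_le_return order_refl] return_finite[OF x] H'])
  also have "(\<integral>\<omega>. indicator H \<omega> * ((?Y \<omega>)\<^sup>2 - (?X \<omega>)\<^sup>2) \<partial>P) =
      (\<integral>\<omega>. indicator H \<omega> * ((?Y \<omega>)\<^sup>2 - 1) - indicator H \<omega> * ((?X \<omega>)\<^sup>2 - 1) \<partial>P)"
    by (intro Bochner_Integration.integral_cong) (auto simp: algebra_simps)
  also have "\<dots> = (\<integral>\<omega>. indicator H \<omega> * ((?Y \<omega>)\<^sup>2 - 1) \<partial>P) - (\<integral>\<omega>. indicator H \<omega> * ((?X \<omega>)\<^sup>2 - 1) \<partial>P)"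
    by (intro Bochner_Integration.integral_diff bd)
  also have "\<dots> = level_gap h * ((\<integral>\<omega>. indicator H \<omega> * y \<omega> \<partial>P) - (\<integral>\<omega>. indicator H \<omega> * x \<omega> \<partial>P))"
    unfolding return_means(2)[OF x H] return_means(2)[OF y H] by (simp add: algebra_simps)
  also have "(\<integral>\<omega>. indicator H \<omega> * y \<omega> \<partial>P) - (\<integral>\<omega>. indicator H \<omega> * x \<omega> \<partial>P) = (\<integral>\<omega>. indicator H \<omega> * y \<omega> - indicator H \<omega> * x \<omega> \<partial>P)"
    by (intro Bochner_Integration.integral_diff[symmetric] bd)
  also have "\<dots> = (\<integral>\<omega>. indicator H \<omega> * (y \<omega> - x \<omega>) \<partial>P)" by (simp add: right_diff_distrib)
  finally show ?thesis .
qed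

text \<open>
  At level 1 the expected duration is at least the target of \<open>return_level_exists\<close>.
\<close>

lemma duration_full_return:
  assumes H: "H \<in> sets (\<F>at \<theta>)"
  shows "ennreal (level_gap h * measure P H) \<le> ennreal ((hi * exp h)\<^sup>2) * (\<integral>\<^sup>+\<omega>\<in>H. (\<kappa> (\<lambda>_. 1) \<omega> - \<theta> \<omega>) \<partial>P)"
proof -
  have x: "admissible \<theta> (\<lambda>_. 1)" by (rule admissible_const) auto
  have HP [measurable]: "H \<in> sets P" using H subalgebra_at[OF \<theta>] unfolding subalgebra_def by blast
  let ?K = "ratio \<theta> (\<kappa> (\<lambda>_. 1))"
  have "ennreal (\<integral>\<omega>. indicator H \<omega> * ((?K \<omega>)\<^sup>2 - (ratio \<theta> \<theta> \<omega>)\<^sup>2) \<partial>P)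
      \<le> ennreal ((hi * exp h)\<^sup>2) * (\<integral>\<^sup>+\<omega>\<in>H. (\<kappa> (\<lambda>_. 1) \<omega> - \<theta> \<omega>) \<partial>P)"
    by (rule duration_bounds(2)[OF \<theta> \<theta> return_stopping[OF x] order_refl theta_le_return exp_order
          corridor_until_return[OF x order_refl order_refl] \<theta>_finite H])
  also have "(\<integral>\<omega>. indicator H \<omega> * ((?K \<omega>)\<^sup>2 - (ratio \<theta> \<theta> \<omega>)\<^sup>2) \<partial>P) = (\<integral>\<omega>. indicator H \<omega> * ((?K \<omega>)\<^sup>2 - 1) \<partial>P)"
  proof (rule integral_cong_AE)
    note [measurable] = ratio_measurable[OF \<theta> \<theta>]
    have [measurable]: "?K \<in> borel_measurable P" using ratio_ess_bounded(1)[OF x] unfolding ess_bounded_def by blast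
    show "(\<lambda>\<omega>. indicator H \<omega> * ((?K \<omega>)\<^sup>2 - (ratio \<theta> \<theta> \<omega>)\<^sup>2)) \<in> borel_measurable P"
      "(\<lambda>\<omega>. indicator H \<omega> * ((?K \<omega>)\<^sup>2 - 1)) \<in> borel_measurable P" by measurable
    show "AE \<omega> in P. indicator H \<omega> * ((?K \<omega>)\<^sup>2 - (ratio \<theta> \<theta> \<omega>)\<^sup>2) = indicator H \<omega> * ((?K \<omega>)\<^sup>2 - 1)"
      using ratio_self by eventually_elim simp
  qed
  also have "\<dots> = level_gap h * measure P H"
    unfolding return_means(2)[OF x H] using HP by simp
  finally show ?thesis .
qed

lemma return_level_exists:
  obtains x where "admissible \<theta> x"
    "\<And>H. H \<in> sets (\<F>at \<theta>) \<Longrightarrow> (\<integral>\<^sup>+\<omega>\<in>H. (\<kappa> x \<omega> - \<theta> \<omega>) \<partial>P) = ennreal (level_gap h / (hi * exp h)\<^sup>2) * emeasure P H"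
proof -
  let ?z = "level_gap h / (hi * exp h)\<^sup>2" and ?C = "level_gap h / (lo * exp (- h))\<^sup>2"
  let ?d = "\<lambda>r \<omega>. \<kappa> (\<lambda>_. r) \<omega> - \<theta> \<omega>"
  have ennreal_div: "I \<le> ennreal (b / a)" if "0 < a" "ennreal a * I \<le> ennreal b" for a b :: real and I
  proof (cases I)
    case (real i)
    have "ennreal (a * i) \<le> ennreal b" using that real by (simp add: ennreal_mult)
    also have "\<dots> \<le> ennreal (max b 0)" by (intro ennreal_leI) simp
    finally have "ennreal (a * i) \<le> ennreal (max b 0)" .
    then have "a * i \<le> max b 0" by (simp only: ennreal_le_iff[OF max.cobounded2])
    then have "i \<le> b / a \<or> i \<le> 0" using that by (auto simp: max_def pos_le_divide_eq mult.commute mult_le_0_iff split: if_splits)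
    then show ?thesis using real by (auto intro: ennreal_leI)
  next
    case top
    then show ?thesis using that by (simp add: ennreal_mult_top ennreal_top_mult top_unique split: if_splits)
  qed
  have ennreal_div': "ennreal (b / a) \<le> I" if "0 < a" "0 \<le> b" "ennreal b \<le> ennreal a * I" for a b :: real and I
  proof (cases I)
    case (real i)
    have "ennreal b \<le> ennreal (a * i)" using that real by (simp add: ennreal_mult)
    then have "b \<le> a * i" using that real by (subst (asm) ennreal_le_iff) auto
    then have "b / a \<le> i" using that by (simp add: pos_divide_le_eq mult.commute)
    then show ?thesis using real by (auto intro: ennreal_leI)
  qed simp
  have gap: "0 < level_gap h" by (rule level_gap_pos[OF h])
  have lo2: "0 < (lo * exp (- h))\<^sup>2" using lo by simp
  have hi2: "0 < (hi * exp h)\<^sup>2" using lo lo_hi by simp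
  have HP: "H \<in> sets P" if "H \<in> sets (\<F>at \<theta>)" for H using that subalgebra_at[OF \<theta>] unfolding subalgebra_def by blast
  have adm: "admissible \<theta> x" if "x \<in> borel_measurable (\<F>at \<theta>)" "\<And>\<omega>. \<omega> \<in> space P \<Longrightarrow> x \<omega> \<in> {0..1}" for x
    using that by (auto simp: admissible_def space_P)
  have dx: "(\<lambda>\<omega>. ?d (x \<omega>) \<omega>) = (\<lambda>\<omega>. \<kappa> x \<omega> - \<theta> \<omega>)" for x
    by (simp add: return_time_pointwise[of h \<theta> x])
  have dm: "(\<lambda>\<omega>. \<kappa> x \<omega> - \<theta> \<omega>) \<in> borel_measurable P" if "admissible \<theta> x" for x
    using stopping_measurable_P[OF \<theta>] stopping_measurable_P[OF return_stopping[OF that]] by measurable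
  show ?thesis
  proof (rule conditional_intermediate_value[where d="?d" and z="?z" and C="?C", OF subalgebra_at[OF \<theta>]])
    show "(\<lambda>\<omega>. ?d (x \<omega>) \<omega>) \<in> borel_measurable P"
      if "x \<in> borel_measurable (\<F>at \<theta>)" "\<And>\<omega>. \<omega> \<in> space P \<Longrightarrow> x \<omega> \<in> {0..1}" for x
      unfolding dx by (rule dm[OF adm[OF that]])
  next
    fix x y :: "(real \<Rightarrow> real) \<Rightarrow> real" and \<epsilon> H
    assume m: "x \<in> borel_measurable (\<F>at \<theta>)" "y \<in> borel_measurable (\<F>at \<theta>)"
      and b: "\<And>\<omega>. \<omega> \<in> space P \<Longrightarrow> 0 \<le> x \<omega> \<and> x \<omega> \<le> y \<omega> \<and> y \<omega> \<le> 1 \<and> y \<omega> \<le> x \<omega> + \<epsilon>"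
      and H: "H \<in> sets (\<F>at \<theta>)"
    have b': "x \<omega> \<in> {0..1}" "y \<omega> \<in> {0..1}" if "\<omega> \<in> space P" for \<omega> using b[OF that] by auto
    have x: "admissible \<theta> x" and y: "admissible \<theta> y" using adm[OF m(1) b'(1)] adm[OF m(2) b'(2)] by auto
    have xy: "x \<omega> \<le> y \<omega>" if "\<omega> \<in> path_space" for \<omega> using b[of \<omega>] that by (simp add: space_P)
    have mono: "\<kappa> x \<omega> \<le> \<kappa> y \<omega>" if "\<omega> \<in> path_space" for \<omega>
      using h xy[OF that] by (intro return_time_mono) auto
    note [measurable] = HP[OF H] stopping_measurable_P[OF \<theta>] stopping_measurable_P[OF return_stopping[OF x]]
      stopping_measurable_P[OF return_stopping[OF y]]
    have eps: "0 \<le> \<epsilon>" using b not_empty by fastforce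
    have "(\<integral>\<omega>. indicator H \<omega> * (y \<omega> - x \<omega>) \<partial>P) \<le> (\<integral>\<omega>. \<epsilon> \<partial>P)"
    proof (rule integral_mono)
      show "integrable P (\<lambda>\<omega>. indicator H \<omega> * (y \<omega> - x \<omega>))"
        by (intro ess_bounded_integrable ess_bounded_intros x_ess_bounded x y indicator_ess_bounded H)
      show "indicator H \<omega> * (y \<omega> - x \<omega>) \<le> \<epsilon>" if "\<omega> \<in> space P" for \<omega>
        using b[OF that] by (auto simp: indicator_def)
    qed simp
    then have "level_gap h * (\<integral>\<omega>. indicator H \<omega> * (y \<omega> - x \<omega>) \<partial>P) \<le> level_gap h * \<epsilon>"
      using gap by (intro mult_left_mono) (auto simp: prob_space)
    then have "ennreal ((lo * exp (- h))\<^sup>2) * (\<integral>\<^sup>+\<omega>\<in>H. (\<kappa> y \<omega> - \<kappa> x \<omega>) \<partial>P) \<le> ennreal (level_gap h * \<epsilon>)"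
      using duration_between_returns[OF x y xy H] by (meson ennreal_leI order_trans)
    then have inc: "(\<integral>\<^sup>+\<omega>\<in>H. (\<kappa> y \<omega> - \<kappa> x \<omega>) \<partial>P) \<le> ennreal (?C * \<epsilon>)"
      using ennreal_div[OF lo2] by simp
    \<comment> \<open>subtraction of extended numbers is additive here because the return times are almost surely finite\<close>
    have "(\<integral>\<^sup>+\<omega>\<in>H. (\<kappa> y \<omega> - \<theta> \<omega>) \<partial>P) = (\<integral>\<^sup>+\<omega>. (\<kappa> x \<omega> - \<theta> \<omega>) * indicator H \<omega> + (\<kappa> y \<omega> - \<kappa> x \<omega>) * indicator H \<omega> \<partial>P)"
    proof (rule nn_integral_cong_AE)
      show "AE \<omega> in P. (\<kappa> y \<omega> - \<theta> \<omega>) * indicator H \<omega> = (\<kappa> x \<omega> - \<theta> \<omega>) * indicator H \<omega> + (\<kappa> y \<omega> - \<kappa> x \<omega>) * indicator H \<omega>"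
        using return_finite[OF y] AE_space
      proof eventually_elim
        case (elim \<omega>)
        have o: "\<theta> \<omega> \<le> \<kappa> x \<omega>" "\<kappa> x \<omega> \<le> \<kappa> y \<omega>" using theta_le_return mono elim(2) by (auto simp: space_P)
        then have "\<kappa> y \<omega> < \<infinity>" "\<kappa> x \<omega> < \<infinity>" "\<theta> \<omega> < \<infinity>" using elim(1) by auto
        then obtain ky kx t where k: "\<kappa> y \<omega> = ennreal ky" "0 \<le> ky" "\<kappa> x \<omega> = ennreal kx" "0 \<le> kx" "\<theta> \<omega> = ennreal t" "0 \<le> t"
          by (metis ennreal_cases infinity_ennreal_def less_irrefl)
        have "t \<le> kx" "kx \<le> ky" using o unfolding k by (simp_all add: k)
        then have "\<kappa> y \<omega> - \<theta> \<omega> = (\<kappa> x \<omega> - \<theta> \<omega>) + (\<kappa> y \<omega> - \<kappa> x \<omega>)"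
          unfolding k using k(2,4,6) by (simp add: ennreal_minus ennreal_plus[symmetric] del: ennreal_plus)
        then show ?case by (simp add: distrib_right)
      qed
    qed
    also have "\<dots> = (\<integral>\<^sup>+\<omega>\<in>H. (\<kappa> x \<omega> - \<theta> \<omega>) \<partial>P) + (\<integral>\<^sup>+\<omega>\<in>H. (\<kappa> y \<omega> - \<kappa> x \<omega>) \<partial>P)"
      by (rule nn_integral_add; measurable)
    also have "\<dots> \<le> (\<integral>\<^sup>+\<omega>\<in>H. (\<kappa> x \<omega> - \<theta> \<omega>) \<partial>P) + ennreal (?C * \<epsilon>)"
      by (rule add_left_mono[OF inc])
    finally show "(\<integral>\<^sup>+\<omega>\<in>H. ?d (y \<omega>) \<omega> \<partial>P) \<le> (\<integral>\<^sup>+\<omega>\<in>H. ?d (x \<omega>) \<omega> \<partial>P) + ennreal (?C * \<epsilon>)"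
      unfolding return_time_pointwise[of h \<theta> x, symmetric] return_time_pointwise[of h \<theta> y, symmetric] .
  next
    fix H assume H: "H \<in> sets (\<F>at \<theta>)"
    have "AE \<omega> in P. ?d 0 \<omega> * indicator H \<omega> = 0"
      using \<theta>_finite by eventually_elim (simp add: return_time_zero)
    then have "(\<integral>\<^sup>+\<omega>\<in>H. ?d 0 \<omega> \<partial>P) = (\<integral>\<^sup>+\<omega>. 0 \<partial>P)"
      by (rule nn_integral_cong_AE)
    then show "(\<integral>\<^sup>+\<omega>\<in>H. ?d 0 \<omega> \<partial>P) \<le> ennreal ?z * emeasure P H" by simp
    have "ennreal (level_gap h * measure P H / (hi * exp h)\<^sup>2) \<le> (\<integral>\<^sup>+\<omega>\<in>H. ?d 1 \<omega> \<partial>P)"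
      using gap by (intro ennreal_div'[OF hi2 _ duration_full_return[OF H]]) simp
    moreover have "ennreal (level_gap h * measure P H / (hi * exp h)\<^sup>2) = ennreal ?z * emeasure P H"
      using gap by (simp add: emeasure_eq_measure ennreal_mult[symmetric])
    ultimately show "ennreal ?z * emeasure P H \<le> (\<integral>\<^sup>+\<omega>\<in>H. ?d 1 \<omega> \<partial>P)" by simp
  next
    fix x assume x: "x \<in> borel_measurable (\<F>at \<theta>)" "\<And>\<omega>. \<omega> \<in> space P \<Longrightarrow> x \<omega> \<in> {0..1}"
      "\<And>H. H \<in> sets (\<F>at \<theta>) \<Longrightarrow> (\<integral>\<^sup>+\<omega>\<in>H. ?d (x \<omega>) \<omega> \<partial>P) = ennreal ?z * emeasure P H"
    show thesis
      by (rule that[OF adm[OF x(1,2)]]) (use x(3) in \<open>simp_all add: return_time_pointwise[of h \<theta> x, symmetric]\<close>)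
  qed
qed

end

end

section \<open>Conditional probabilities at the return time\<close>

lemma level_gap_alt: "level_gap h = exp h + exp (- h) - 2"
proof -
  have "exp h * exp (- h) = 1" by (simp add: exp_minus)
  then show ?thesis unfolding level_gap_def by (simp add: algebra_simps)
qed

text \<open>
  Substituting \<open>E = e\<^sup>h\<close>, the fraction in the definition of the constant reduces to \<open>E + 1/E - 2\<close>, because
  \<open>E\<^sup>2 + 1/E\<^sup>2 - 2 = (E + 1/E - 2) (2 + E + 1/E)\<close>.
\<close>

lemma z_const_eq:
  fixes \<sigma> T :: real and n :: nat
  defines "h \<equiv> \<sigma> * sqrt (T / n)"
  shows "z_const T \<sigma> n = level_gap h / (\<sigma> * exp h)\<^sup>2"
proof -
  define E where "E = exp h"
  have E: "0 < E" by (simp add: E_def)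
  have e: "exp (- h) = 1 / E" by (simp add: E_def exp_minus inverse_eq_divide)
  have e2: "exp (2 * h) = E\<^sup>2" "exp (- 2 * h) = 1 / E\<^sup>2"
    by (simp_all add: E_def exp_minus exp_double inverse_eq_divide)
  have p: "0 < 2 + E + 1 / E" using E by (intro add_pos_pos) auto
  have "(E\<^sup>2 + 1 / E\<^sup>2 - 2) = (E + 1 / E - 2) * (2 + E + 1 / E)"
    using E by (simp add: field_simps power2_eq_square)
  then have q: "(E\<^sup>2 + 1 / E\<^sup>2 - 2) / (2 + E + 1 / E) = E + 1 / E - 2" using p by simp
  have "z_const T \<sigma> n = exp (- 2 * h) * (1 / \<sigma>\<^sup>2) * ((exp (2 * h) + exp (- 2 * h) - 2) / (2 + exp h + exp (- h)))"
    unfolding z_const_def h_def by (simp add: mult.assoc)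
  also have "\<dots> = 1 / E\<^sup>2 * (1 / \<sigma>\<^sup>2) * (E + 1 / E - 2)"
    unfolding e e2 E_def[symmetric] q ..
  also have "\<dots> = level_gap h / (\<sigma> * exp h)\<^sup>2"
    unfolding level_gap_alt e E_def[symmetric] by (simp add: power_mult_distrib)
  finally show ?thesis .
qed

context bounded_volatility
begin

text \<open>
  At the return time \<open>R\<close> is \<open>E = e\<^sup>h\<close>, \<open>1/E\<close> or 1. Let \<open>pu\<close> and \<open>pd\<close> be the probabilities of the first two on an
  event \<open>H\<close> of the past of \<open>\<theta>\<close>. The mean of \<open>R - 1\<close> yields \<open>pd = E pu\<close>, the mean of \<open>R\<^sup>2 - 1\<close> then determines \<open>pu\<close>
  by the level, and the level is bounded below by means of the expected duration. As \<open>H\<close> is arbitrary,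
  these relations hold for the conditional probabilities.
\<close>

lemma return_time_properties:
  fixes \<theta> :: "(real \<Rightarrow> real) \<Rightarrow> ennreal" and h :: real
  assumes \<theta>: "stopping \<theta>" and h: "0 < h" and fin: "AE \<omega> in P. \<theta> \<omega> < \<infinity>"
  defines "z \<equiv> level_gap h / (hi * exp h)\<^sup>2"
  shows "\<exists>\<theta>'. stopping \<theta>' \<and> (\<forall>\<omega>\<in>path_space. \<theta> \<omega> \<le> \<theta>' \<omega>) \<and>
    (AE \<omega> in P. \<theta>' \<omega> < \<infinity> \<and> at_time \<theta>' \<omega> / at_time \<theta> \<omega> \<in> {exp (- h), 1, exp h}) \<and>
    (AE \<omega> in P. nn_cond_exp P (\<F>at \<theta>) (\<lambda>\<omega>. \<theta>' \<omega> - \<theta> \<omega>) \<omega> = ennreal z) \<and>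
    (let up = cond_prob_given P (\<F>at \<theta>) (\<lambda>\<omega>. at_time \<theta>' \<omega> / at_time \<theta> \<omega> = exp h);
         down = cond_prob_given P (\<F>at \<theta>) (\<lambda>\<omega>. at_time \<theta>' \<omega> / at_time \<theta> \<omega> = exp (- h));
         stay = cond_prob_given P (\<F>at \<theta>) (\<lambda>\<omega>. at_time \<theta>' \<omega> = at_time \<theta> \<omega>)
     in (AE \<omega> in P. up \<omega> \<in> {1 / (1 + exp h) * (exp (- 4 * h) * lo\<^sup>2 / hi\<^sup>2) .. 1 / (1 + exp h)}) \<and>
        (AE \<omega> in P. down \<omega> = exp h * up \<omega>) \<and>
        (AE \<omega> in P. stay \<omega> = 1 - up \<omega> - down \<omega>))"
proof -
  have "\<exists>x. admissible \<theta> x \<and> (\<forall>H\<in>sets (\<F>at \<theta>).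
      (\<integral>\<^sup>+\<omega>\<in>H. (return_time h \<theta> x \<omega> - \<theta> \<omega>) \<partial>P) = ennreal z * emeasure P H)"
  proof (rule return_level_exists[OF \<theta> h fin])
    fix x assume x: "admissible \<theta> x" "\<And>H. H \<in> sets (\<F>at \<theta>) \<Longrightarrow>
      (\<integral>\<^sup>+\<omega>\<in>H. (return_time h \<theta> x \<omega> - \<theta> \<omega>) \<partial>P) = ennreal (level_gap h / (hi * exp h)\<^sup>2) * emeasure P H"
    show "\<exists>x. admissible \<theta> x \<and> (\<forall>H\<in>sets (\<F>at \<theta>).
      (\<integral>\<^sup>+\<omega>\<in>H. (return_time h \<theta> x \<omega> - \<theta> \<omega>) \<partial>P) = ennreal z * emeasure P H)"
      unfolding z_def by (intro exI[of _ x] conjI ballI x)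
  qed
  then obtain x where x: "admissible \<theta> x"
    and dur': "\<forall>H\<in>sets (\<F>at \<theta>). (\<integral>\<^sup>+\<omega>\<in>H. (return_time h \<theta> x \<omega> - \<theta> \<omega>) \<partial>P) = ennreal z * emeasure P H"
    by (elim exE conjE)
  note dur = bspec[OF dur']
  define \<theta>' where "\<theta>' = return_time h \<theta> x"
  define K where "K = ratio \<theta> \<theta>'"
  have st: "stopping \<theta>'" unfolding \<theta>'_def by (rule return_stopping[OF \<theta> h fin x])
  have le: "\<theta> \<omega> \<le> \<theta>' \<omega>" for \<omega> unfolding \<theta>'_def by (rule theta_le_return)
  have fin': "AE \<omega> in P. \<theta>' \<omega> < \<infinity>" unfolding \<theta>'_def by (rule return_finite[OF \<theta> h fin x])
  have vals: "AE \<omega> in P. K \<omega> \<in> {exp (- h), 1, exp h}"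
    using ratio_values[OF \<theta> h fin x] unfolding K_def \<theta>'_def by eventually_elim auto
  have bK: "ess_bounded K" unfolding K_def \<theta>'_def by (rule ratio_ess_bounded(1)[OF \<theta> h fin x])
  then have [measurable]: "K \<in> borel_measurable P" unfolding ess_bounded_def by blast
  interpret fs: finite_measure_subalgebra P "\<F>at \<theta>" by unfold_locales (rule subalgebra_at[OF \<theta>])
  have HP: "H \<in> sets P" if "H \<in> sets (\<F>at \<theta>)" for H using that subalgebra_at[OF \<theta>] unfolding subalgebra_def by blast
  have iH: "ess_bounded (indicator H)" if "H \<in> sets (\<F>at \<theta>)" for H
    by (rule indicator_ess_bounded[OF \<theta> h fin that])
  define E where "E = exp h"
  have E1: "1 < E" using h by (simp add: E_def)
  have e: "exp (- h) = 1 / E" by (simp add: E_def exp_minus inverse_eq_divide)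
  have e4: "exp (- 4 * h) = 1 / E ^ 4"
  proof -
    have "exp (- 4 * h) = exp (- h) ^ 4" by (simp add: exp_of_nat_mult[symmetric])
    then show ?thesis unfolding e by (simp add: power_divide)
  qed
  define c where "c = level_gap h"
  have c: "c = (E - 1)\<^sup>2 / E" "0 < c"
    unfolding c_def using level_gap_pos[OF h] E1 by (auto simp: level_gap_alt e E_def[symmetric] field_simps power2_eq_square)
  have z: "z = c / (hi * E)\<^sup>2" by (simp add: z_def c_def E_def)
  have hi: "0 < hi" using lo lo_hi by simp
  have z0: "0 \<le> z" unfolding z using c(2) by (intro divide_nonneg_nonneg) auto
  have cond_dur: "AE \<omega> in P. ennreal z = nn_cond_exp P (\<F>at \<theta>) (\<lambda>\<omega>. \<theta>' \<omega> - \<theta> \<omega>) \<omega>"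
  proof (rule fs.nn_cond_exp_charact)
    show "(\<lambda>\<omega>. \<theta>' \<omega> - \<theta> \<omega>) \<in> borel_measurable P"
      using stopping_measurable_P[OF \<theta>] stopping_measurable_P[OF st] by measurable
    fix H assume H: "H \<in> sets (\<F>at \<theta>)"
    show "(\<integral>\<^sup>+\<omega>\<in>H. (\<theta>' \<omega> - \<theta> \<omega>) \<partial>P) = (\<integral>\<^sup>+\<omega>\<in>H. ennreal z \<partial>P)"
      unfolding \<theta>'_def dur[OF H] using HP[OF H] by (simp add: nn_integral_cmult_indicator)
  qed simp
  define SU where "SU = {\<omega> \<in> space P. at_time \<theta>' \<omega> / at_time \<theta> \<omega> = exp h}"
  define SD where "SD = {\<omega> \<in> space P. at_time \<theta>' \<omega> / at_time \<theta> \<omega> = exp (- h)}"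
  define SS where "SS = {\<omega> \<in> space P. at_time \<theta>' \<omega> = at_time \<theta> \<omega>}"
  have UDS: "SU = {\<omega> \<in> space P. K \<omega> = E}" "SD = {\<omega> \<in> space P. K \<omega> = 1 / E}"
    by (auto simp: SU_def SD_def K_def ratio_def E_def e[unfolded E_def])
  have [measurable]: "SU \<in> sets P" "SD \<in> sets P" unfolding UDS by measurable
  have [measurable]: "at_time \<theta> \<in> borel_measurable P" "at_time \<theta>' \<in> borel_measurable P"
    using at_measurable_P[OF \<theta> at_time_measurable[OF \<theta>]] at_measurable_P[OF st at_time_measurable[OF st]] by auto
  have [measurable]: "SS \<in> sets P" unfolding SS_def by measurable
  have bI: "ess_bounded (indicator A)" if "A \<in> sets P" for A
    by (rule ess_boundedI[where C=1]) (use that in \<open>auto simp: indicator_def\<close>)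
  note bd = ess_bounded_integrable ess_bounded_intros bK bI iH
  have parts: "AE \<omega> in P. (\<omega> \<in> SU \<and> \<omega> \<notin> SD \<and> \<omega> \<notin> SS \<and> K \<omega> = E) \<or> (\<omega> \<notin> SU \<and> \<omega> \<in> SD \<and> \<omega> \<notin> SS \<and> K \<omega> = 1 / E)
      \<or> (\<omega> \<notin> SU \<and> \<omega> \<notin> SD \<and> \<omega> \<in> SS \<and> K \<omega> = 1)"
    using vals at_time_positive[of \<theta>] AE_space
  proof eventually_elim
    case (elim \<omega>)
    have d: "1 / E < 1" using E1 by simp
    have S: "\<omega> \<in> SS \<longleftrightarrow> K \<omega> = 1" using elim(2,3) by (auto simp: SS_def K_def ratio_def)
    have UD: "\<omega> \<in> SU \<longleftrightarrow> K \<omega> = E" "\<omega> \<in> SD \<longleftrightarrow> K \<omega> = 1 / E" unfolding UDS using elim(3) by auto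
    from elim(1) have "K \<omega> = 1 / E \<or> K \<omega> = 1 \<or> K \<omega> = E" unfolding e E_def[symmetric] by auto
    moreover have "E \<noteq> 1 / E" "1 / E \<noteq> 1" "E \<noteq> 1" using E1 d by linarith+
    ultimately show ?case unfolding S UD by metis
  qed
  define pu :: "(real \<Rightarrow> real) set \<Rightarrow> real" where "pu = (\<lambda>H. \<integral>\<omega>. indicator H \<omega> * indicator SU \<omega> \<partial>P)"
  define pd :: "(real \<Rightarrow> real) set \<Rightarrow> real" where "pd = (\<lambda>H. \<integral>\<omega>. indicator H \<omega> * indicator SD \<omega> \<partial>P)"
  have down_up: "pd H = E * pu H" if H: "H \<in> sets (\<F>at \<theta>)" for H
  proof -
    have "0 = (\<integral>\<omega>. indicator H \<omega> * (K \<omega> - 1) \<partial>P)"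
      unfolding K_def \<theta>'_def return_means(1)[OF \<theta> h fin x H] ..
    also have "\<dots> = (\<integral>\<omega>. (E - 1) * (indicator H \<omega> * indicator SU \<omega>) - (1 - 1 / E) * (indicator H \<omega> * indicator SD \<omega>) \<partial>P)"
    proof (rule integral_cong_AE)
      show "AE \<omega> in P. indicator H \<omega> * (K \<omega> - 1) = (E - 1) * (indicator H \<omega> * indicator SU \<omega>) - (1 - 1 / E) * (indicator H \<omega> * indicator SD \<omega>)"
        using parts by eventually_elim (auto simp: indicator_def)
    qed (rule borel_measurable_integrable, intro bd HP[OF H] H; measurable)+
    also have "\<dots> = (E - 1) * pu H - (1 - 1 / E) * pd H"
      unfolding pu_def pd_def
      by (subst Bochner_Integration.integral_diff, (intro bd HP[OF H] H; measurable)+) simp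
    finally have "(1 - 1 / E) * pd H = (E - 1) * pu H" by simp
    moreover have "(E - 1) * pu H = (1 - 1 / E) * (E * pu H)" using E1 by (simp add: field_simps)
    moreover have "1 - 1 / E \<noteq> 0" using E1 by simp
    ultimately show ?thesis by (metis mult_left_cancel)
  qed
  have second: "(1 + E) * c * pu H = c * (\<integral>\<omega>. indicator H \<omega> * x \<omega> \<partial>P)" if H: "H \<in> sets (\<F>at \<theta>)" for H
  proof -
    have "c * (\<integral>\<omega>. indicator H \<omega> * x \<omega> \<partial>P) = (\<integral>\<omega>. indicator H \<omega> * ((K \<omega>)\<^sup>2 - 1) \<partial>P)"
      unfolding K_def \<theta>'_def c_def return_means(2)[OF \<theta> h fin x H] ..
    also have "\<dots> = (\<integral>\<omega>. (E\<^sup>2 - 1) * (indicator H \<omega> * indicator SU \<omega>) - (1 - 1 / E\<^sup>2) * (indicator H \<omega> * indicator SD \<omega>) \<partial>P)"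
    proof (rule integral_cong_AE)
      show "AE \<omega> in P. indicator H \<omega> * ((K \<omega>)\<^sup>2 - 1) = (E\<^sup>2 - 1) * (indicator H \<omega> * indicator SU \<omega>) - (1 - 1 / E\<^sup>2) * (indicator H \<omega> * indicator SD \<omega>)"
        using parts by eventually_elim (auto simp: indicator_def power_divide)
    qed (rule borel_measurable_integrable, intro bd HP[OF H] H; measurable)+
    also have "\<dots> = (E\<^sup>2 - 1) * pu H - (1 - 1 / E\<^sup>2) * pd H"
      unfolding pu_def pd_def
      by (subst Bochner_Integration.integral_diff, (intro bd HP[OF H] H; measurable)+) simp
    also have "\<dots> = ((E\<^sup>2 - 1) - (1 - 1 / E\<^sup>2) * E) * pu H" unfolding down_up[OF H] by (simp add: algebra_simps)
    also have "(E\<^sup>2 - 1) - (1 - 1 / E\<^sup>2) * E = (1 + E) * c"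
      unfolding c(1) using E1 by (simp add: field_simps power2_eq_square)
    finally show ?thesis by (rule sym)
  qed
  have pu_lower: "1 / (1 + E) * (lo\<^sup>2 / E ^ 4 / hi\<^sup>2) * measure P H \<le> pu H" if H: "H \<in> sets (\<F>at \<theta>)" for H
  proof -
    have "AE \<omega> in P. 0 \<le> indicator H \<omega> * x \<omega>" using x unfolding admissible_def by (auto simp: space_P indicator_def)
    then have x0: "0 \<le> (\<integral>\<omega>. indicator H \<omega> * x \<omega> \<partial>P)" by (rule integral_nonneg_AE)
    \<comment> \<open>the energy bound is applied between the return times for the levels 0, which is \<open>\<theta>\<close>, and \<open>x\<close>\<close>
    have a0: "admissible \<theta> (\<lambda>_. 0)" by (rule admissible_const) auto
    have "ennreal ((lo * exp (- h))\<^sup>2) * (\<integral>\<^sup>+\<omega>\<in>H. (return_time h \<theta> x \<omega> - return_time h \<theta> (\<lambda>_. 0) \<omega>) \<partial>P)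
      \<le> ennreal (level_gap h * (\<integral>\<omega>. indicator H \<omega> * (x \<omega> - 0) \<partial>P))"
      by (rule duration_between_returns[OF \<theta> h fin a0 x _ H]) (use x in \<open>auto simp: admissible_def\<close>)
    then have "ennreal ((lo / E)\<^sup>2) * (ennreal z * ennreal (measure P H)) \<le> ennreal (c * (\<integral>\<omega>. indicator H \<omega> * x \<omega> \<partial>P))"
      unfolding return_time_zero dur[OF H] emeasure_eq_measure e c_def by simp
    then have "ennreal ((lo / E)\<^sup>2 * (z * measure P H)) \<le> ennreal (c * (\<integral>\<omega>. indicator H \<omega> * x \<omega> \<partial>P))"
      using z0 by (simp add: ennreal_mult)
    moreover have "0 \<le> c * (\<integral>\<omega>. indicator H \<omega> * x \<omega> \<partial>P)" using c(2) x0 by simp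
    ultimately have "(lo / E)\<^sup>2 * (z * measure P H) \<le> c * (\<integral>\<omega>. indicator H \<omega> * x \<omega> \<partial>P)"
      by (simp only: ennreal_le_iff)
    then have "(lo / E)\<^sup>2 * (z * measure P H) \<le> (1 + E) * c * pu H" unfolding second[OF H] .
    moreover have "(lo / E)\<^sup>2 * (z * measure P H) = (1 + E) * c * (1 / (1 + E) * (lo\<^sup>2 / E ^ 4 / hi\<^sup>2) * measure P H)"
    proof -
      have cancel: "(1 + E) * c * (1 / (1 + E) * w) = c * w" for w using E1 by simp
      show ?thesis unfolding mult.assoc[of "1 / (1 + E)"] cancel z
        using E1 hi by (simp add: field_simps power2_eq_square power4_eq_xxxx)
    qed
    ultimately have "(1 + E) * c * (1 / (1 + E) * (lo\<^sup>2 / E ^ 4 / hi\<^sup>2) * measure P H) \<le> (1 + E) * c * pu H" by simp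
    moreover have "0 < (1 + E) * c" using E1 c(2) by simp
    ultimately show ?thesis by (simp only: mult_le_cancel_left_pos)
  qed
  have pu_upper: "pu H \<le> 1 / (1 + E) * measure P H" if H: "H \<in> sets (\<F>at \<theta>)" for H
  proof -
    have "(1 + E) * pu H = pu H + pd H" unfolding down_up[OF H] by (simp add: algebra_simps)
    also have "\<dots> = (\<integral>\<omega>. indicator H \<omega> * indicator SU \<omega> + indicator H \<omega> * indicator SD \<omega> \<partial>P)"
      unfolding pu_def pd_def
      by (rule Bochner_Integration.integral_add[symmetric]) (intro bd HP[OF H] H; measurable)+
    also have "\<dots> \<le> (\<integral>\<omega>. indicator H \<omega> \<partial>P)"
    proof (rule integral_mono_AE)
      show "AE \<omega> in P. indicator H \<omega> * indicator SU \<omega> + indicator H \<omega> * indicator SD \<omega> \<le> (indicator H \<omega> :: real)"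
        using parts by eventually_elim (auto simp: indicator_def)
    qed (intro bd HP[OF H] H; measurable)+
    also have "\<dots> = measure P H" using HP[OF H] by simp
    finally show ?thesis using E1 by (simp add: pos_le_divide_eq mult.commute)
  qed
  define up where "up = real_cond_exp P (\<F>at \<theta>) (indicator SU)"
  define down where "down = real_cond_exp P (\<F>at \<theta>) (indicator SD)"
  define stay where "stay = real_cond_exp P (\<F>at \<theta>) (indicator SS)"
  have ints: "integrable P (indicator SU :: _ \<Rightarrow> real)" "integrable P (indicator SD :: _ \<Rightarrow> real)" "integrable P (indicator SS :: _ \<Rightarrow> real)"
    by (intro bd; measurable)+
  have upF [measurable]: "up \<in> borel_measurable (\<F>at \<theta>)" and upI: "integrable P up"
    unfolding up_def using fs.real_cond_exp_int(1)[OF ints(1)] by auto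
  have downF [measurable]: "down \<in> borel_measurable (\<F>at \<theta>)" and downI: "integrable P down"
    unfolding down_def using fs.real_cond_exp_int(1)[OF ints(2)] by auto
  have up_int: "(\<integral>\<omega>. indicator H \<omega> * up \<omega> \<partial>P) = pu H" if H: "H \<in> sets (\<F>at \<theta>)" for H
    using fs.real_cond_exp_intA[OF ints(1) H] unfolding up_def pu_def set_lebesgue_integral_def by simp
  have down_int: "(\<integral>\<omega>. indicator H \<omega> * down \<omega> \<partial>P) = pd H" if H: "H \<in> sets (\<F>at \<theta>)" for H
    using fs.real_cond_exp_intA[OF ints(2) H] unfolding down_def pd_def set_lebesgue_integral_def by simp
  have Hint: "integrable P (\<lambda>\<omega>. indicator H \<omega> * f \<omega>)" if "H \<in> sets (\<F>at \<theta>)" "integrable P f" for H and f :: "_ \<Rightarrow> real"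
    using integrable_mult_indicator[OF HP[OF that(1)] that(2)] by simp
  have up1: "AE \<omega> in P. 1 / (1 + E) * (lo\<^sup>2 / E ^ 4 / hi\<^sup>2) \<le> up \<omega>"
  proof (rule AE_le_of_set_integrals[OF subalgebra_at[OF \<theta>] _ upF _ upI])
    fix H assume H: "H \<in> sets (\<F>at \<theta>)"
    show "(\<integral>\<omega>. indicator H \<omega> * (1 / (1 + E) * (lo\<^sup>2 / E ^ 4 / hi\<^sup>2)) \<partial>P) \<le> (\<integral>\<omega>. indicator H \<omega> * up \<omega> \<partial>P)"
      using pu_lower[OF H] HP[OF H] unfolding up_int[OF H] by (simp add: mult.commute)
  qed auto
  have up2: "AE \<omega> in P. up \<omega> \<le> 1 / (1 + E)"
  proof (rule AE_le_of_set_integrals[OF subalgebra_at[OF \<theta>] upF _ upI])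
    fix H assume H: "H \<in> sets (\<F>at \<theta>)"
    show "(\<integral>\<omega>. indicator H \<omega> * up \<omega> \<partial>P) \<le> (\<integral>\<omega>. indicator H \<omega> * (1 / (1 + E)) \<partial>P)"
      using pu_upper[OF H] HP[OF H] unfolding up_int[OF H] by (simp add: mult.commute)
  qed auto
  have down_eq: "AE \<omega> in P. down \<omega> = exp h * up \<omega>"
    unfolding down_def
  proof (rule fs.real_cond_exp_charact)
    fix H assume H: "H \<in> sets (\<F>at \<theta>)"
    have "(\<integral>\<omega>. indicator H \<omega> * (E * up \<omega>) \<partial>P) = E * (\<integral>\<omega>. indicator H \<omega> * up \<omega> \<partial>P)"
      by (subst integral_mult_right_zero[symmetric]) (simp add: mult.left_commute)
    then show "(\<integral>\<omega>\<in>H. indicator SD \<omega> \<partial>P) = (\<integral>\<omega>\<in>H. exp h * up \<omega> \<partial>P)"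
      using down_up[OF H] up_int[OF H] unfolding pd_def set_lebesgue_integral_def E_def by simp
  qed (use ints upI in auto)
  have stay_eq: "AE \<omega> in P. stay \<omega> = 1 - up \<omega> - down \<omega>"
    unfolding stay_def
  proof (rule fs.real_cond_exp_charact)
    fix H assume H: "H \<in> sets (\<F>at \<theta>)"
    have "(\<integral>\<omega>. indicator H \<omega> * indicator SS \<omega> \<partial>P) =
        (\<integral>\<omega>. (indicator H \<omega> :: real) - indicator H \<omega> * indicator SU \<omega> - indicator H \<omega> * indicator SD \<omega> \<partial>P)"
    proof (rule integral_cong_AE)
      show "AE \<omega> in P. indicator H \<omega> * indicator SS \<omega> =
          (indicator H \<omega> - indicator H \<omega> * indicator SU \<omega> - indicator H \<omega> * indicator SD \<omega> :: real)"
        using parts by eventually_elim (auto simp: indicator_def)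
    qed (rule borel_measurable_integrable, intro bd HP[OF H] H; measurable)+
    also have "\<dots> = (\<integral>\<omega>. indicator H \<omega> \<partial>P) - pu H - pd H"
      unfolding pu_def pd_def
      by (subst Bochner_Integration.integral_diff Bochner_Integration.integral_diff, (intro bd HP[OF H] H; measurable)+)+ simp
    also have "\<dots> = (\<integral>\<omega>. indicator H \<omega> \<partial>P) - (\<integral>\<omega>. indicator H \<omega> * up \<omega> \<partial>P) - (\<integral>\<omega>. indicator H \<omega> * down \<omega> \<partial>P)"
      unfolding up_int[OF H] down_int[OF H] ..
    also have "\<dots> = (\<integral>\<omega>. indicator H \<omega> - indicator H \<omega> * up \<omega> - indicator H \<omega> * down \<omega> \<partial>P)"
      using Hint[OF H upI] Hint[OF H downI] ess_bounded_integrable[OF iH[OF H]] by simp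
    finally show "(\<integral>\<omega>\<in>H. indicator SS \<omega> \<partial>P) = (\<integral>\<omega>\<in>H. 1 - up \<omega> - down \<omega> \<partial>P)"
      unfolding set_lebesgue_integral_def by (simp add: right_diff_distrib)
  qed (use ints upI downI in auto)
  have up_bounds: "AE \<omega> in P. up \<omega> \<in> {1 / (1 + exp h) * (exp (- 4 * h) * lo\<^sup>2 / hi\<^sup>2) .. 1 / (1 + exp h)}"
    using up1 up2 by eventually_elim (simp only: e4 E_def[symmetric] atLeastAtMost_iff, simp add: mult.commute)
  have ratio_AE: "AE \<omega> in P. \<theta>' \<omega> < \<infinity> \<and> at_time \<theta>' \<omega> / at_time \<theta> \<omega> \<in> {exp (- h), 1, exp h}"
    using fin' vals by eventually_elim (simp add: K_def ratio_def)
  have cond_dur': "AE \<omega> in P. nn_cond_exp P (\<F>at \<theta>) (\<lambda>\<omega>. \<theta>' \<omega> - \<theta> \<omega>) \<omega> = ennreal z"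
    using cond_dur by eventually_elim simp
  show ?thesis
    unfolding Let_def cond_prob_given_def
    by (intro exI[of _ \<theta>'] conjI ballI st le ratio_AE cond_dur'
        up_bounds[unfolded up_def SU_def] down_eq[unfolded down_def up_def SU_def SD_def]
        stay_eq[unfolded stay_def down_def up_def SU_def SD_def SS_def])
qed

end

theorem lemma3p1:
  fixes T \<sigma>lo \<sigma>hi s :: real and n :: nat
    and P :: "(real \<Rightarrow> real) measure" and \<theta> :: "(real \<Rightarrow> real) \<Rightarrow> ennreal"
  assumes "0 < T" and "0 < \<sigma>lo" and "\<sigma>lo \<le> \<sigma>hi" and "1 \<le> n" and "0 < s"
    and "P \<in> martingale_laws {\<sigma>lo..\<sigma>hi} s"
    and "stopping_time canonical_filtration \<theta>"
    and "(\<integral>\<^sup>+ \<omega>. \<theta> \<omega> \<partial>P) < \<infinity>"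
  shows "let h = \<sigma>hi * sqrt (T / n) in \<exists>\<theta>'. stopping_time canonical_filtration \<theta>' \<and>
    (\<forall>\<omega>\<in>path_space. \<theta> \<omega> \<le> \<theta>' \<omega>) \<and>
    (AE \<omega> in P. \<theta>' \<omega> < \<infinity> \<and> at_time \<theta>' \<omega> / at_time \<theta> \<omega> \<in> {exp (- h), 1, exp h}) \<and>
    (AE \<omega> in P. nn_cond_exp P (canonical.pre_sigma \<theta>) (\<lambda>\<omega>. \<theta>' \<omega> - \<theta> \<omega>) \<omega>
       = ennreal (z_const T \<sigma>hi n)) \<and>
    (let up = cond_prob_given P (canonical.pre_sigma \<theta>)
           (\<lambda>\<omega>. at_time \<theta>' \<omega> / at_time \<theta> \<omega> = exp h);
         down = cond_prob_given P (canonical.pre_sigma \<theta>)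
           (\<lambda>\<omega>. at_time \<theta>' \<omega> / at_time \<theta> \<omega> = exp (- h));
         stay = cond_prob_given P (canonical.pre_sigma \<theta>)
           (\<lambda>\<omega>. at_time \<theta>' \<omega> = at_time \<theta> \<omega>)
     in (AE \<omega> in P. up \<omega> \<in> {1 / (1 + exp h) * (exp (- 4 * h) * \<sigma>lo\<^sup>2 / \<sigma>hi\<^sup>2) .. 1 / (1 + exp h)}) \<and>
        (AE \<omega> in P. down \<omega> = exp h * up \<omega>) \<and>
        (AE \<omega> in P. stay \<omega> = 1 - up \<omega> - down \<omega>))"
proof -
  define h where "h = \<sigma>hi * sqrt (T / n)"
  have h: "0 < h" using assms(1-4) by (simp add: h_def)
  from assms(6) obtain A where P: "prob_space P" "sets P = sets path_borel"
    "is_martingale P canonical_filtration (\<lambda>t \<omega>. \<omega> t)" "AE \<omega> in P. \<forall>t\<ge>0. 0 < \<omega> t"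
    "is_quadratic_variation P (\<lambda>t \<omega>. \<omega> t) A"
    "AE \<omega> in P. \<forall>b\<ge>0. absolutely_continuous_on 0 b (\<lambda>t. A t \<omega>)"
    "AE (t, \<omega>) in restrict_space lborel {0..} \<Otimes>\<^sub>M P.
       \<exists>D. ((\<lambda>u. A u \<omega>) has_real_derivative D) (at t within {0..}) \<and> sqrt D / \<omega> t \<in> {\<sigma>lo..\<sigma>hi}"
    unfolding martingale_laws_def by blast
  interpret prob_space P by (rule P(1))
  interpret bounded_volatility P \<sigma>lo \<sigma>hi A
    by unfold_locales (use P assms(2,3) in simp_all)
  have "AE \<omega> in P. \<theta> \<omega> \<noteq> \<infinity>"
    by (rule nn_integral_PInf_AE[OF stopping_measurable_P[OF assms(7)]]) (use assms(8) in simp)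
  then have fin: "AE \<omega> in P. \<theta> \<omega> < \<infinity>" by eventually_elim (simp add: less_top)
  show ?thesis
    unfolding h_def[symmetric] z_const_eq[of T \<sigma>hi n, folded h_def]
    by (subst Let_def) (rule return_time_properties[OF assms(7) h fin])
qed

end
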